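(* Assume $\eta>0$ (duality condition), that the nonzero eigenvalues $b_1,\dots,b_{N_R}$ of $B$ (counted with multiplicity) are pairwise distinct, and that the nonzero eigenvalues $b_1^\flat,\dots,b_{N_R}^\flat$ of $B^\flat$ (counted with multiplicity) are pairwise distinct. Put $b_0=b_0^\flat=0$ and $$d=\min_{0\le i,j\le N_R,\ i\neq j}|b_i-b_j|,\quad \beta_0=\frac{2\omega_{\max}}{d},\quad d^\flat=\min_{0\le i,j\le N_R,\ i\neq j}|b_i^\flat-b_j^\flat|,\quad \beta_1=\max\Big\{\beta_0,\frac{2\omega_{\max}^\flat}{d^\flat}\Big\}.$$ Then: (a) The high-loss eigenvalues $\zeta_j(\beta)$, $1\le j\le N_R$, of $A(\beta)$ are meromorphic in $z=\beta^{-1}$ at $z=0$ with expansions converging in $0<|z|<\beta_0^{-1}$; their eigenprojections are analytic in this disc and have rank one; and $\operatorname{Re}\zeta_j(\beta)=0$ for $1\le j\le N_R$ if $\beta>\beta_0$. (b) With the low-loss eigenvalues indexed so that $\rho_j=0$ for $N_R+1\le j\le 2N_R$ and $\rho_j\ne0$ for $2N_R+1\le j\le 2N$, the eigenvalues $\zeta_j(\beta)$, $N_R+1\le j\le 2N_R$, are analytic in $z=\beta^{-1}$ at $z=0$, and each converges in the punctured disc $0<|z|<\beta_1^{-1}$. Their corresponding eigenprojections $P_j(\beta)$ are analytic in $z$ in this disc with $\dim\operatorname{Ran}P_j(\beta)=1$ for $N_R+1\le j\le 2N_R$. In particular, if $\beta>\beta_1$ then $\zeta_j(\beta)$, $N_R+1\le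 j\le 2N_R$, are simple eigenvalues of $A(\beta)$ and $$\operatorname{Re}\zeta_j(\beta)=0,\qquad N_R+1\le j\le 2N_R .$$
   Context: Setting. $N\ge 1$; $\alpha,\eta,\theta,R$ are real $N\times N$ matrices with $\alpha^{\mathrm T}=\alpha>0$, $\eta^{\mathrm T}=\eta\ge0$, $\theta^{\mathrm T}=-\theta$, $R^{\mathrm T}=R\ge0$, and $N_R=\operatorname{rank}R>0$. $\sqrt{\cdot}$ denotes the positive semidefinite square root. On $H=\mathbb C^{2N}=\mathbb C^N\oplus\mathbb C^N$ (standard inner product) set $$\Omega=\begin{bmatrix}-2\mathrm i\sqrt\alpha^{-1}\theta\sqrt\alpha^{-1} & -\mathrm i\Phi^{\mathrm T}\\ \mathrm i\Phi&0\end{bmatrix},\quad \Phi=\sqrt\eta\sqrt\alpha^{-1},\quad B=\begin{bmatrix}\sqrt\alpha^{-1}R\sqrt\alpha^{-1}&0\\0&0\end{bmatrix},\quad A(\beta)=\Omega-\mathrm i\beta B$$ (loss parameter $\beta\ge0$, also considered complex; $\Omega$ is Hermitian, $B\ge0$, $\operatorname{rank}B=N_R$). $\omega_{\max}$ is the largest eigenvalue of $\Omega$ (it equals $\|\Omega\|$). $0<b_1\le\dots\le b_{N_R}$ are the nonzero eigenvalues of $B$ with multiplicity (equivalently of $\alpha^{-1}R$). Dual objects: when $\eta>0$, an object with superscript $\flat$ is defined exactly as the one without it but with $\alpha$ and $\eta$ interchanged. Thus $b_1^\flat\le\dots\le b_{N_R}^\flat$ are the nonzero eigenvalues of $B^\flat$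 (equivalently of $\eta^{-1}R$) and $\omega_{\max}^\flat$ is the largest eigenvalue of $\Omega^\flat$. High-loss and low-loss eigenvalues (known facts). For $\beta$ sufficiently large, $A(\beta)$ is diagonalizable with eigenvalues $\zeta_j(\beta)$, $1\le j\le 2N$ (with multiplicity) such that: (high-loss, $1\le j\le N_R$) $\zeta_j(\beta)=-\mathrm i b_j\beta+O(1)$ is a convergent Laurent series in $\beta^{-1}$ with a simple pole at $\beta^{-1}=0$; (low-loss, $N_R+1\le j\le 2N$) $\zeta_j(\beta)=\rho_j+O(\beta^{-1})$ is a convergent power series in $\beta^{-1}$, where $\rho_j$, $N_R+1\le j\le 2N$, are the eigenvalues with multiplicity of $P_B^\perp\Omega P_B^\perp|_{\operatorname{Ker}B}$ and $P_B^\perp$ is the orthogonal projection onto $\operatorname{Ker}B$. When $\eta>0$, exactly $N_R$ of the $\rho_j$, $N_R+1\le j\le2N$, are zero. *)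

theory Defs
  imports
    "HOL-Complex_Analysis.Complex_Analysis"
    "Jordan_Normal_Form.Gauss_Jordan_Elimination"
    "Jordan_Normal_Form.Matrix_Kernel"
    "Jordan_Normal_Form.Schur_Decomposition"
    "Jordan_Normal_Form.DL_Rank"
begin

definition pos_semidef_mat :: "real mat \<Rightarrow> bool" where
  "pos_semidef_mat M \<longleftrightarrow> square_mat M \<and> transpose_mat M = M \<and>
     (\<forall>x\<in>carrier_vec (dim_row M). 0 \<le> scalar_prod x (M *\<^sub>v x))"

definition pos_def_mat :: "real mat \<Rightarrow> bool" where
  "pos_def_mat M \<longleftrightarrow> square_mat M \<and> transpose_mat M = M \<and>
     (\<forall>x\<in>carrier_vec (dim_row M). x \<noteq> 0\<^sub>v (dim_row M) \<longrightarrow> 0 < scalar_prod x (M *\<^sub>v x))"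

definition psd_sqrt :: "real mat \<Rightarrow> real mat" where
  "psd_sqrt M = (THE S. S \<in> carrier_mat (dim_row M) (dim_row M) \<and> pos_semidef_mat S \<and> S * S = M)"

definition inv_sqrt :: "real mat \<Rightarrow> real mat" where
  "inv_sqrt M = the (mat_inverse (psd_sqrt M))"

definition Phi_mat :: "real mat \<Rightarrow> real mat \<Rightarrow> real mat" where
  "Phi_mat \<alpha> \<eta> = psd_sqrt \<eta> * inv_sqrt \<alpha>"

abbreviation cplx_mat :: "real mat \<Rightarrow> complex mat" where
  "cplx_mat \<equiv> map_mat complex_of_real"

definition Omega_mat :: "real mat \<Rightarrow> real mat \<Rightarrow> real mat \<Rightarrow> complex mat" where
  "Omega_mat \<alpha> \<eta> \<theta> = four_block_mat
     ((- 2 * \<i>) \<cdot>\<^sub>m cplx_mat (inv_sqrt \<alpha> * \<theta> * inv_sqrt \<alpha>))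
     ((- \<i>) \<cdot>\<^sub>m cplx_mat (transpose_mat (Phi_mat \<alpha> \<eta>)))
     (\<i> \<cdot>\<^sub>m cplx_mat (Phi_mat \<alpha> \<eta>))
     (0\<^sub>m (dim_row \<alpha>) (dim_row \<alpha>))"

definition B_mat :: "real mat \<Rightarrow> real mat \<Rightarrow> real mat" where
  "B_mat \<alpha> R = four_block_mat (inv_sqrt \<alpha> * R * inv_sqrt \<alpha>)
     (0\<^sub>m (dim_row \<alpha>) (dim_row \<alpha>)) (0\<^sub>m (dim_row \<alpha>) (dim_row \<alpha>)) (0\<^sub>m (dim_row \<alpha>) (dim_row \<alpha>))"

definition A_mat :: "real mat \<Rightarrow> real mat \<Rightarrow> real mat \<Rightarrow> real mat \<Rightarrow> complex \<Rightarrow> complex mat" where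
  "A_mat \<alpha> \<eta> \<theta> R \<beta> = Omega_mat \<alpha> \<eta> \<theta> - (\<i> * \<beta>) \<cdot>\<^sub>m cplx_mat (B_mat \<alpha> R)"

definition loss_rank :: "real mat \<Rightarrow> nat" where
  "loss_rank R = vec_space.rank (dim_row R) R"

definition omega_max :: "real mat \<Rightarrow> real mat \<Rightarrow> real mat \<Rightarrow> real" where
  "omega_max \<alpha> \<eta> \<theta> = Max {x. eigenvalue (Omega_mat \<alpha> \<eta> \<theta>) (complex_of_real x)}"

definition nonzero_eigvals :: "real mat \<Rightarrow> real list" where
  "nonzero_eigvals M = sorted_list_of_multiset (filter_mset (\<lambda>x. x \<noteq> 0) (proots (char_poly M)))"

definition b_val :: "real mat \<Rightarrow> real mat \<Rightarrow> nat \<Rightarrow> real" where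
  "b_val \<alpha> R j = (if j = 0 then 0 else nonzero_eigvals (B_mat \<alpha> R) ! (j - 1))"

definition b_gap :: "real mat \<Rightarrow> real mat \<Rightarrow> real" where
  "b_gap \<alpha> R = Min {\<bar>b_val \<alpha> R i - b_val \<alpha> R j\<bar> | i j.
     i \<le> loss_rank R \<and> j \<le> loss_rank R \<and> i \<noteq> j}"

definition beta0 :: "real mat \<Rightarrow> real mat \<Rightarrow> real mat \<Rightarrow> real mat \<Rightarrow> real" where
  "beta0 \<alpha> \<eta> \<theta> R = 2 * omega_max \<alpha> \<eta> \<theta> / b_gap \<alpha> R"

text \<open>The dual objects are obtained by interchanging the first two arguments (or, for \<^const>\<open>b_val\<close>,
  by passing \<open>\<eta>\<close> for \<open>\<alpha>\<close>).\<close>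

definition beta1 :: "real mat \<Rightarrow> real mat \<Rightarrow> real mat \<Rightarrow> real mat \<Rightarrow> real" where
  "beta1 \<alpha> \<eta> \<theta> R = max (beta0 \<alpha> \<eta> \<theta> R) (2 * omega_max \<eta> \<alpha> \<theta> / b_gap \<eta> R)"

text \<open>The eigenvalues with multiplicity of the compression of \<open>\<Omega>\<close> to \<open>Ker B\<close>. The columns of \<open>V\<close>
  form an orthonormal basis of \<open>Ker B\<close>, so \<open>V V\<^sup>*\<close> is the orthogonal projection onto \<open>Ker B\<close>,
  and \<open>V\<^sup>* \<Omega> V\<close> is the matrix of the compression in that basis.\<close>

definition low_loss_limits ::
  "real mat \<Rightarrow> real mat \<Rightarrow> real mat \<Rightarrow> real mat \<Rightarrow> (nat \<Rightarrow> real) \<Rightarrow> bool" where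
  "low_loss_limits \<alpha> \<eta> \<theta> R \<rho> \<longleftrightarrow>
     (let N = dim_row \<alpha>; r = loss_rank R in
      \<exists>V \<in> carrier_mat (2 * N) (2 * N - r).
        mat_adjoint V * V = 1\<^sub>m (2 * N - r) \<and>
        cplx_mat (B_mat \<alpha> R) * V = 0\<^sub>m (2 * N) (2 * N - r) \<and>
        char_poly (mat_adjoint V * Omega_mat \<alpha> \<eta> \<theta> * V) =
          (\<Prod>j\<in>{r + 1..2 * N}. [:- complex_of_real (\<rho> j), 1:]))"

text \<open>An eigenvalue branch is represented by its Laurent series \<open>Z\<close> at \<open>0\<close> in the
  variable \<open>\<beta>\<^sup>-\<^sup>1\<close>; the value of the branch at \<open>\<beta>\<close> is the sum of the series, which makes
  sense as long as \<open>\<bar>\<beta>\<bar>\<^sup>-\<^sup>1\<close> is below the radius of convergence.\<close>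

definition branch :: "complex fls \<Rightarrow> complex \<Rightarrow> complex" where
  "branch Z \<beta> = eval_fls Z (inverse \<beta>)"

definition loss_branches ::
  "real mat \<Rightarrow> real mat \<Rightarrow> real mat \<Rightarrow> real mat \<Rightarrow> (nat \<Rightarrow> real) \<Rightarrow> (nat \<Rightarrow> complex fls) \<Rightarrow> bool" where
  "loss_branches \<alpha> \<eta> \<theta> R \<rho> Z \<longleftrightarrow>
     (let N = dim_row \<alpha>; r = loss_rank R in
      (\<forall>j\<in>{1..2 * N}. fls_conv_radius (Z j) > 0) \<and>
      (\<forall>\<^sub>F \<beta>::real in at_top.
         similar_mat (A_mat \<alpha> \<eta> \<theta> R (of_real \<beta>))
           (mat_diag (2 * N) (\<lambda>i. branch (Z (i + 1)) (of_real \<beta>)))) \<and>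
      (\<forall>j\<in>{1..r}. fls_subdegree (Z j) = - 1 \<and>
         fls_nth (Z j) (- 1) = - \<i> * of_real (b_val \<alpha> R j)) \<and>
      (\<forall>j\<in>{r + 1..2 * N}. fls_subdegree (Z j) \<ge> 0 \<and> fls_nth (Z j) 0 = of_real (\<rho> j)) \<and>
      low_loss_limits \<alpha> \<eta> \<theta> R \<rho>)"

text \<open>The projection onto the generalized eigenspace of \<open>l\<close> along the sum of the other
  generalized eigenspaces: commuting with \<open>M\<close> makes the kernel of \<open>P\<close> an \<open>M\<close>-invariant complement
  of the generalized eigenspace, and there is only one such complement.\<close>

definition is_eigenprojection :: "complex mat \<Rightarrow> complex \<Rightarrow> complex mat \<Rightarrow> bool" where
  "is_eigenprojection M l P \<longleftrightarrow>
     P \<in> carrier_mat (dim_row M) (dim_row M) \<and> P * P = P \<and> P * M = M * P \<and>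
     (\<lambda>v. P *\<^sub>v v) ` carrier_vec (dim_row M) = mat_kernel (char_matrix M l ^\<^sub>m dim_row M)"

text \<open>For \<open>0 < \<bar>z\<bar> < r\<close> the eigenprojection of \<open>M z\<close> for \<open>l z\<close> has rank one and depends
  analytically on \<open>z\<close>, with a removable singularity at \<open>0\<close>.\<close>

definition analytic_rank_one_eigenprojections ::
  "nat \<Rightarrow> (complex \<Rightarrow> complex mat) \<Rightarrow> (complex \<Rightarrow> complex) \<Rightarrow> real \<Rightarrow> bool" where
  "analytic_rank_one_eigenprojections n M l r \<longleftrightarrow>
     (\<exists>P. (\<forall>i<n. \<forall>k<n. (\<lambda>z. P z $$ (i, k)) holomorphic_on ball 0 r) \<and>
          (\<forall>z\<in>ball 0 r - {0}. is_eigenprojection (M z) (l z) (P z) \<and> vec_space.rank n (P z) = 1))"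

end

theory Submission
  imports Defs
begin

text \<open>
  With \<open>z = \<beta>\<^sup>-\<^sup>1\<close> and the real matrix \<open>K = \<i>\<Omega>\<close> we have \<open>A(\<beta>) = -(\<i>/z) T(z)\<close> for the linear pencil
  \<open>T(z) = B + z K\<close>. Since \<open>B\<close> is symmetric and the norm of \<open>K\<close> is \<open>\<omega>\<^sub>m\<^sub>a\<^sub>x\<close>, every eigenvalue of \<open>T(z)\<close> is
  within \<open>\<bar>z\<bar> \<omega>\<^sub>m\<^sub>a\<^sub>x\<close> of some \<open>b\<^sub>k\<close> (Bauer--Fike), so for \<open>\<bar>z\<bar> < d / (2 \<omega>\<^sub>m\<^sub>a\<^sub>x)\<close> none lies on the circle of
  radius \<open>d/2\<close> about \<open>b\<^sub>j\<close>. Integrating the logarithmic derivative of the characteristic polynomial over that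
  circle shows that exactly one simple eigenvalue lies inside and that it is holomorphic in \<open>z\<close>; its
  eigenprojection is the normalized adjugate matrix. For real \<open>z\<close> the matrix \<open>T(z)\<close> is real, so this eigenvalue
  is its own conjugate, which is the vanishing of the real part. By the identity theorem the given Laurent
  series sums to this eigenvalue.

  The dual matrix satisfies \<open>A\<^sup>\<flat>(\<beta>) = -J A(\<beta>)\<^sup>-\<^sup>1 J\<close>, where \<open>J\<close> swaps the two summands. A low-loss
  eigenvalue that tends to 0 is therefore \<open>-1/\<mu>\<close> for an eigenvalue \<open>\<mu>\<close> of \<open>A\<^sup>\<flat>(\<beta>)\<close> that tends to infinity, that is,
  for a high-loss eigenvalue of the dual system.
\<close>

section \<open>Spectral theorem and square roots\<close>

text \<open>The constant \<open>2 * \<omega> / d\<close> keeps the discs of radius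
  \<open>d / 2\<close> about \<open>b_1, ..., b_r\<close> apart from each other and from the origin:
  0 counts as one more centre \<open>b_0\<close>, so the pencil eigenvalues that start at 0 cannot
  enter these discs, and the isolated ones never vanish. The latter makes their reciprocals, and
  with them the low-loss eigenvalues in question, holomorphic up to and including
  \<open>z = 0\<close>. That the largest eigenvalue of \<Omega> is also its norm rests on \<Omega>
  being \<i> times a real matrix, which makes its spectrum symmetric about 0. The delicate point is
  to identify the given series, which are tied to the matrix only for large real \<beta>. A
  high-loss series announces its centre by the leading coefficient \<open>- \<i> b_j\<close>. A
  low-loss series with limit 0 announces nothing: at each small real \<open>z\<close> its negative
  reciprocal is merely one of finitely many dual eigenvalues. One of these must recur at points
  accumulating at 0, and such recurrence is enough for the identity theorem.\<close>

lemma mat_adjoint_alt: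
  "mat_adjoint A = mat (dim_col A) (dim_row A) (\<lambda>(i, j). conjugate (A $$ (j, i)))"
  by (rule eq_matI) (auto simp: mat_adjoint_def mat_of_rows_def)

lemma mat_adjoint_carrier [simp]: "A \<in> carrier_mat n m \<Longrightarrow> mat_adjoint A \<in> carrier_mat m n"
  by (auto simp: mat_adjoint_alt)

lemma mat_adjoint_mult:
  fixes A B :: "'a::conjugatable_field mat"
  assumes "A \<in> carrier_mat n m" "B \<in> carrier_mat m k"
  shows "mat_adjoint (A * B) = mat_adjoint B * mat_adjoint A"
  using assms
  by (intro eq_matI)
     (auto simp: mat_adjoint_alt scalar_prod_def sum_conjugate conjugate_dist_mul mult.commute
           intro!: sum.cong)

lemma mat_adjoint_mat_adjoint [simp]: "mat_adjoint (mat_adjoint A) = A"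
  by (rule eq_matI) (auto simp: mat_adjoint_alt)

lemma conjugate_one [simp]: "conjugate (1::'a::conjugatable_field) = 1"
  by (metis conjugate_dist_mul conjugate_zero_iff mult.right_neutral mult_cancel_left one_neq_zero)

lemma conjugate_divide: "conjugate (a / b) = conjugate a / conjugate (b::'a::conjugatable_field)"
proof (cases "b = 0")
  case False
  then have "conjugate (a / b) * conjugate b = conjugate a"
    by (simp flip: conjugate_dist_mul)
  then show ?thesis using False by (simp add: field_simps)
qed auto

text \<open>\<open>gram_schmidt\<close> orthogonalizes a basis completion of \<open>v\<close> and
  keeps \<open>v\<close> in front, but does not normalize. The premise \<open>sq\<close> supplies
  the missing square roots of the squared lengths; it holds over the reals and over the complex
  numbers alike, so one proof serves both fields.\<close>

lemma unitary_mat_with_first_col: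
  fixes v :: "'a::conjugatable_ordered_field vec"
  assumes sq: "\<And>x::'a. 0 \<le> x \<Longrightarrow> \<exists>y. y * conjugate y = x"
    and v: "v \<in> carrier_vec n" "v \<noteq> 0\<^sub>v n"
  obtains W c where "W \<in> carrier_mat n n" "mat_adjoint W * W = 1\<^sub>m n" "c \<noteq> 0" "col W 0 = c \<cdot>\<^sub>v v"
proof -
  interpret cof_vec_space n "TYPE('a)" .
  define b where "b = basis_completion v"
  define ws where "ws = gram_schmidt n b"
  from basis_completion[OF v, folded b_def]
  have indep: "distinct b" "\<not> lin_dep (set b)" and b: "set b \<subseteq> carrier_vec n"
    and hdb: "hd b = v" and len_b: "length b = n" by auto
  have n: "n \<noteq> 0"
    using v by auto
  obtain vs where bv: "b = v # vs"
    using hdb len_b n by (cases b) auto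
  from gram_schmidt_result[OF b indep refl, folded ws_def]
  have ws: "set ws \<subseteq> carrier_vec n" "corthogonal ws" "length ws = n"
    by (auto simp: len_b)
  have "hd ws = v"
    using gram_schmidt_hd[OF v(1), of vs, folded bv] by (simp add: ws_def)
  then have ws0: "ws ! 0 = v"
    using ws(3) n by (cases ws) auto
  have wsc: "ws ! i \<in> carrier_vec n" if "i < n" for i
    using ws that by auto
  have "\<exists>y. y * conjugate y = ws ! i \<bullet>c ws ! i" for i
    by (intro sq conjugate_square_ge_0_vec)
  then obtain y where y: "\<And>i. y i * conjugate (y i) = ws ! i \<bullet>c ws ! i"
    by metis
  have y0: "y i \<noteq> 0" if "i < n" for i
    using y[of i] corthogonalD[OF ws(2), of i i] ws(3) that by auto
  define W where "W = mat n n (\<lambda>(r, k). ws ! k $ r / y k)"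
  have W: "W \<in> carrier_mat n n"
    by (simp add: W_def)
  show thesis
  proof (rule that[OF W])
    show "mat_adjoint W * W = 1\<^sub>m n"
    proof (rule eq_matI)
      fix i j assume "i < dim_row (1\<^sub>m n :: 'a mat)" "j < dim_col (1\<^sub>m n :: 'a mat)"
      then have ij: "i < n" "j < n" by auto
      have "(mat_adjoint W * W) $$ (i, j) =
          (\<Sum>r<n. conjugate (ws ! i $ r) / conjugate (y i) * (ws ! j $ r / y j))"
        using ij by (auto simp: W_def mat_adjoint_alt scalar_prod_def conjugate_divide
            atLeast0LessThan intro!: sum.cong)
      also have "\<dots> = (\<Sum>r<n. ws ! j $ r * conjugate (ws ! i $ r)) / (conjugate (y i) * y j)"
        by (simp add: sum_divide_distrib mult.commute)
      also have "(\<Sum>r<n. ws ! j $ r * conjugate (ws ! i $ r)) = ws ! j \<bullet>c ws ! i"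
        using wsc[OF ij(1)] by (auto simp: scalar_prod_def atLeast0LessThan)
      also have "ws ! j \<bullet>c ws ! i / (conjugate (y i) * y j) = (if i = j then 1 else 0)"
        using y[of i] y0[OF ij(1)] corthogonalD[OF ws(2), of j i] ws(3) ij
        by (auto simp: mult.commute)
      finally show "(mat_adjoint W * W) $$ (i, j) = 1\<^sub>m n $$ (i, j)"
        using ij by auto
    qed (auto simp: W_def mat_adjoint_alt)
    show "1 / y 0 \<noteq> 0"
      using y0 n by auto
    show "col W 0 = 1 / y 0 \<cdot>\<^sub>v v"
      using n v ws0 by (auto simp: W_def)
  qed
qed

lemma mat_adjoint_eq_inverse:
  assumes "U \<in> carrier_mat n n" "mat_adjoint U * U = 1\<^sub>m n"
  shows "U * mat_adjoint U = 1\<^sub>m n"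
  using mat_mult_left_right_inverse[OF _ assms(1,2)] assms(1) by auto

lemma mult_block_diag_mat:
  assumes "A \<in> carrier_mat a a" "A' \<in> carrier_mat a a" "D \<in> carrier_mat b b" "D' \<in> carrier_mat b b"
  shows "four_block_mat A (0\<^sub>m a b) (0\<^sub>m b a) D * four_block_mat A' (0\<^sub>m a b) (0\<^sub>m b a) D' =
         four_block_mat (A * A') (0\<^sub>m a b) (0\<^sub>m b a) (D * D')"
  using assms
  by (subst mult_four_block_mat[of _ a a _ b _ b _ _ a _ b]) (auto simp: left_mult_zero_mat)

text \<open>Deflation: with an eigenvector as first column of a unitary \<open>W\<close>,
  conjugation by \<open>W\<close> clears the first column below the corner, and hermiticity then
  clears the first row, leaving a smaller Hermitian block with one root less. The field is kept
  general so that the real case yields a real \<open>U\<close>; the splitting of the characteristic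
  polynomial is a premise because it is not automatic over the reals.\<close>

theorem hermitian_unitary_diagonalization:
  fixes A :: "'a::conjugatable_ordered_field mat"
  assumes sq: "\<And>x::'a. 0 \<le> x \<Longrightarrow> \<exists>y. y * conjugate y = x"
    and "A \<in> carrier_mat n n" "mat_adjoint A = A" "char_poly A = (\<Prod>e\<leftarrow>es. [:- e, 1:])"
  shows "\<exists>U\<in>carrier_mat n n. mat_adjoint U * U = 1\<^sub>m n \<and> A * U = U * mat_diag n ((!) es)"
  using assms(2-)
proof (induction es arbitrary: n A)
  case Nil
  then have "n = 0"
    using degree_monic_char_poly[OF Nil(1)] by auto
  then show ?case
    using Nil(1) by (intro bexI[of _ "1\<^sub>m 0"] conjI) (auto simp: mat_adjoint_alt mat_diag_def intro!: eq_matI)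
next
  case (Cons e es)
  note A = Cons.prems(1) and herm = Cons.prems(2)
  have deg: "degree (char_poly A) = Suc (length es)"
    using degree_linear_factors[of uminus "e # es"] by (simp only: Cons.prems(3)) simp
  define m where "m = n - 1"
  have n: "n = Suc m"
    using deg degree_monic_char_poly[OF A] by (simp add: m_def)
  have "eigenvalue A e"
    unfolding eigenvalue_root_char_poly[OF A] using Cons.prems(3) by simp
  then obtain v where v: "v \<in> carrier_vec n" "v \<noteq> 0\<^sub>v n" and Av: "A *\<^sub>v v = e \<cdot>\<^sub>v v"
    using A by (auto simp: eigenvalue_def eigenvector_def)
  obtain W c where W: "W \<in> carrier_mat n n" and WW: "mat_adjoint W * W = 1\<^sub>m n"
    and c: "c \<noteq> 0" "col W 0 = c \<cdot>\<^sub>v v"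
    using unitary_mat_with_first_col[OF sq v] by blast
  note WW' = mat_adjoint_eq_inverse[OF W WW]
  define A' where "A' = mat_adjoint W * A * W"
  have A': "A' \<in> carrier_mat n n"
    using W A by (intro carrier_matI) (auto simp: A'_def mat_adjoint_alt)
  have adjW: "mat_adjoint W \<in> carrier_mat n n"
    using W by simp
  have herm': "mat_adjoint A' = A'"
    using W A herm
    by (simp add: A'_def mat_adjoint_mult[of _ n n _ n] assoc_mult_mat[of _ n n _ n _ n])
  have cW: "col W 0 \<in> carrier_vec n" and n0: "0 < n"
    using W n by (auto intro!: carrier_vecI)
  have "col (A * W) 0 = e \<cdot>\<^sub>v col W 0"
    using A W v Av c n
    by (simp add: col_mult2[OF A W] mult_mat_vec[OF A] smult_smult_assoc mult.commute del: col_mult)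
  then have "col A' 0 = e \<cdot>\<^sub>v col (mat_adjoint W * W) 0"
    using A W adjW n0 mult_mat_vec[OF adjW cW]
    by (simp add: A'_def assoc_mult_mat[of _ n n _ n _ n] col_mult2[of _ n n _ n] del: col_mult)
  then have col0: "col A' 0 = e \<cdot>\<^sub>v unit_vec n 0"
    using n by (simp add: WW)
  have a0: "A' $$ (i, 0) = (if i = 0 then e else 0)" if "i < n" for i
    using arg_cong[OF col0, of "\<lambda>u. vec_index u i"] that A' n by auto
  have a0': "A' $$ (0, j) = 0" if "j < n" "j \<noteq> 0" for j
    using arg_cong[OF herm', of "\<lambda>u. u $$ (0, j)"] a0[OF that(1)] that A' n
    by (auto simp: mat_adjoint_alt)
  define A3 where "A3 = mat m m (\<lambda>(i, j). A' $$ (Suc i, Suc j))"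
  define E where "E = mat 1 1 (\<lambda>_. e)"
  have A3: "A3 \<in> carrier_mat m m" and E: "E \<in> carrier_mat 1 1"
    by (auto simp: A3_def E_def)
  have A'block: "A' = four_block_mat E (0\<^sub>m 1 m) (0\<^sub>m m 1) A3"
    using A' n a0 a0' by (intro eq_matI) (auto simp: A3_def E_def)
  have herm3: "mat_adjoint A3 = A3"
  proof (rule eq_matI)
    fix i j assume "i < dim_row A3" "j < dim_col A3"
    then show "mat_adjoint A3 $$ (i, j) = A3 $$ (i, j)"
      using arg_cong[OF herm', of "\<lambda>u. u $$ (Suc i, Suc j)"] A' n
      by (auto simp: mat_adjoint_alt A3_def)
  qed (auto simp: mat_adjoint_alt A3_def)
  have "similar_mat_wit A' A (mat_adjoint W) W"
    using W A A' WW WW' by (intro similar_mat_witI[of _ _ n]) (auto simp: A'_def)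
  then have "char_poly A' = char_poly A"
    by (intro char_poly_similar) (auto simp: similar_mat_def)
  moreover have "char_poly A' = char_poly E * char_poly A3"
    unfolding A'block by (rule char_poly_four_block_zeros_col[OF E _ A3]) auto
  moreover have "char_poly E = [:- e, 1:]"
    by (simp add: E_def char_poly_defs det_def sign_def)
  ultimately have "[:- e, 1:] * char_poly A3 = [:- e, 1:] * (\<Prod>e\<leftarrow>es. [:- e, 1:])"
    by (simp add: Cons.prems(3))
  then have "char_poly A3 = (\<Prod>e\<leftarrow>es. [:- e, 1:])"
    by (metis mult_cancel_left pCons_eq_0_iff zero_neq_one)
  from Cons.IH[OF A3 herm3 this] obtain U3 where U3: "U3 \<in> carrier_mat m m"
    and UU3: "mat_adjoint U3 * U3 = 1\<^sub>m m" and AU3: "A3 * U3 = U3 * mat_diag m ((!) es)"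
    by blast
  define F where "F = four_block_mat (1\<^sub>m 1) (0\<^sub>m 1 m) (0\<^sub>m m 1) U3"
  have F: "F \<in> carrier_mat n n"
    using U3 by (auto simp: F_def n)
  have adjF: "mat_adjoint F = four_block_mat (1\<^sub>m 1) (0\<^sub>m 1 m) (0\<^sub>m m 1) (mat_adjoint U3)"
    using U3 by (intro eq_matI) (auto simp: F_def mat_adjoint_alt)
  have FF: "mat_adjoint F * F = 1\<^sub>m n"
    unfolding adjF unfolding F_def using U3
    by (subst mult_block_diag_mat) (auto simp: UU3 n intro!: eq_matI)
  have D: "mat_diag n ((!) (e # es)) = four_block_mat E (0\<^sub>m 1 m) (0\<^sub>m m 1) (mat_diag m ((!) es))"
    by (rule eq_matI) (auto simp: n E_def mat_diag_def)
  have A'F: "A' * F = F * mat_diag n ((!) (e # es))"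
    unfolding A'block D unfolding F_def using U3 A3 E
    by (simp add: mult_block_diag_mat AU3)
  show ?case
  proof (intro bexI[of _ "W * F"] conjI)
    have "mat_adjoint (W * F) * (W * F) = mat_adjoint F * (mat_adjoint W * W) * F"
      using W F by (simp add: mat_adjoint_mult[of _ n n _ n] assoc_mult_mat[of _ n n _ n _ n]
          mult_carrier_mat[of _ n n _ n])
    then show "mat_adjoint (W * F) * (W * F) = 1\<^sub>m n"
      using F by (simp add: WW FF right_mult_one_mat[of _ n])
    have "A * (W * F) = (W * mat_adjoint W) * A * (W * F)"
      using A by (simp add: WW')
    also have "\<dots> = W * (A' * F)"
      using A W F adjW by (simp add: A'_def assoc_mult_mat[of _ n n _ n _ n] mult_carrier_mat[of _ n n _ n])
    also have "\<dots> = W * F * mat_diag n ((!) (e # es))"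
      using W F by (simp add: A'F assoc_mult_mat[of _ n n _ n _ n])
    finally show "A * (W * F) = W * F * mat_diag n ((!) (e # es))" .
  qed (use W F in auto)
qed

lemma mat_diag_mult_vec:
  "y \<in> carrier_vec n \<Longrightarrow> mat_diag n d *\<^sub>v y = vec n (\<lambda>i. d i * y $ i)"
  by (rule eq_vecI)
     (auto simp: mat_diag_def scalar_prod_def if_distrib if_distribR sum.delta cong: if_cong)

lemma square_mult_carrier [simp]:
  "A \<in> carrier_mat n n \<Longrightarrow> B \<in> carrier_mat n n \<Longrightarrow> A * B \<in> carrier_mat n n"
  by (rule mult_carrier_mat)

lemma char_poly_diagonalization:
  fixes U :: "'a::field mat"
  assumes "U \<in> carrier_mat n n" "V \<in> carrier_mat n n" "V * U = 1\<^sub>m n" "U * V = 1\<^sub>m n"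
  shows "char_poly (U * mat_diag n d * V) = (\<Prod>i<n. [:- d i, 1:])"
proof -
  have "char_poly (U * mat_diag n d * V) = char_poly (mat_diag n d)"
  proof (rule char_poly_similar)
    have "similar_mat_wit (U * mat_diag n d * V) (mat_diag n d) U V"
      using assms by (intro similar_mat_witI[of U V n]) auto
    then show "similar_mat (U * mat_diag n d * V) (mat_diag n d)"
      by (auto simp: similar_mat_def)
  qed
  also have "\<dots> = (\<Prod>a\<leftarrow>diag_mat (mat_diag n d). [:- a, 1:])"
    by (intro char_poly_upper_triangular[of _ n]) (auto simp: mat_diag_def)
  also have "\<dots> = (\<Prod>i<n. [:- d i, 1:])"
    by (auto simp: prod.list_conv_set_nth diag_mat_def atLeast0LessThan mat_diag_def
        intro!: prod.cong)
  finally show ?thesis .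
qed

section \<open>Complex Hermitian and real symmetric matrices\<close>

lemma hermitian_complex_diagonalization:
  assumes A: "(A :: complex mat) \<in> carrier_mat n n" "mat_adjoint A = A"
  obtains U and d :: "nat \<Rightarrow> real" where "U \<in> carrier_mat n n" "mat_adjoint U * U = 1\<^sub>m n"
    "A = U * mat_diag n (\<lambda>i. of_real (d i)) * mat_adjoint U"
proof -
  obtain es where "char_poly A = (\<Prod>e\<leftarrow>es. [:- e, 1:])"
    using char_poly_factorized[OF A(1)] by auto
  \<comment> \<open>In the order on \<open>complex\<close>, \<open>0 \<le> x\<close> forces
    \<open>x\<close> to be real, so a real square root of \<open>Re x\<close> serves.\<close>
  moreover have "\<exists>y. y * conjugate y = x" if "0 \<le> x" for x :: complex
    using that by (intro exI[of _ "of_real (sqrt (Re x))"]) 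
      (auto simp: less_eq_complex_def complex_eq_iff)
  ultimately obtain U where U: "U \<in> carrier_mat n n" "mat_adjoint U * U = 1\<^sub>m n"
    and AU: "A * U = U * mat_diag n ((!) es)"
    using hermitian_unitary_diagonalization[OF _ A] by metis
  note UU = mat_adjoint_eq_inverse[OF U]
  have adjU: "mat_adjoint U \<in> carrier_mat n n"
    using U by simp
  have D: "mat_adjoint U * A * U = mat_diag n ((!) es)"
    using U A(1) adjU assoc_mult_mat[of "mat_adjoint U" n n U n "mat_diag n ((!) es)" n]
    by (simp add: assoc_mult_mat[of _ n n _ n _ n] AU left_mult_one_mat[OF mat_diag_dim])
  have "mat_adjoint (mat_adjoint U * A * U) = mat_adjoint U * A * U"
    using U A by (simp add: mat_adjoint_mult[of _ n n _ n] assoc_mult_mat[of _ n n _ n _ n])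
  then have sym: "mat_adjoint (mat_diag n ((!) es)) = mat_diag n ((!) es)"
    by (simp only: D)
  have real: "of_real (Re (es ! i)) = es ! i" if "i < n" for i
    using arg_cong[OF sym, of "\<lambda>M. M $$ (i, i)"] that
    by (auto simp: mat_adjoint_alt mat_diag_def complex_eq_iff)
  have "A = A * (U * mat_adjoint U)"
    using A by (simp add: UU)
  also have "\<dots> = U * mat_diag n ((!) es) * mat_adjoint U"
    using U A by (simp add: AU flip: assoc_mult_mat[of _ n n _ n _ n])
  also have "mat_diag n ((!) es) = mat_diag n (\<lambda>i. of_real (Re (es ! i)))"
    using real by (intro eq_matI) (auto simp: mat_diag_def)
  finally show thesis
    by (rule that[OF U])
qed

text \<open>The roots of a real polynomial need not be real. Here the complexified matrix is
  Hermitian, its diagonalization has real entries \<open>d\<close>, and the factorization descends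
  because \<open>of_real\<close> is injective on coefficients.\<close>

lemma real_symmetric_char_poly_splits:
  assumes M: "(M :: real mat) \<in> carrier_mat n n" "transpose_mat M = M"
  obtains d where "char_poly M = (\<Prod>i<n. [:- d i, 1:])"
proof -
  interpret h: map_poly_comm_ring_hom complex_of_real ..
  have "mat_adjoint (cplx_mat M) = cplx_mat M"
  proof (rule eq_matI)
    fix i j assume "i < dim_row (cplx_mat M)" "j < dim_col (cplx_mat M)"
    then show "mat_adjoint (cplx_mat M) $$ (i, j) = cplx_mat M $$ (i, j)"
      using M(1) arg_cong[OF M(2), of "\<lambda>L. L $$ (i, j)"] by (simp add: mat_adjoint_alt)
  qed (use M(1) in \<open>auto simp: mat_adjoint_alt\<close>)
  then obtain U and d :: "nat \<Rightarrow> real" where U: "U \<in> carrier_mat n n" "mat_adjoint U * U = 1\<^sub>m n"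
    and "cplx_mat M = U * mat_diag n (\<lambda>i. of_real (d i)) * mat_adjoint U"
    using hermitian_complex_diagonalization[of "cplx_mat M" n] M(1) by auto
  then have "char_poly (cplx_mat M) = (\<Prod>i<n. [:- of_real (d i), 1:])"
    using mat_adjoint_eq_inverse[OF U] by (simp add: char_poly_diagonalization)
  also have "\<dots> = map_poly complex_of_real (\<Prod>i<n. [:- d i, 1:])"
    by (simp add: h.hom_prod map_poly_pCons)
  finally have "map_poly complex_of_real (char_poly M) = map_poly complex_of_real (\<Prod>i<n. [:- d i, 1:])"
    using M(1) by (simp add: of_real_hom.char_poly_hom)
  then have "char_poly M = (\<Prod>i<n. [:- d i, 1:])"
    by (simp add: poly_eq_iff coeff_map_poly)
  then show thesis
    by (rule that)
qed

text \<open>Conjugation on the reals is trivial, so the adjoint is the transpose. Applying the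
  general theorem over the reals themselves makes \<open>U\<close> a real orthogonal matrix, from
  which square roots with real entries can be built.\<close>

lemma real_symmetric_diagonalization:
  assumes M: "(M :: real mat) \<in> carrier_mat n n" "transpose_mat M = M"
  obtains U d where "U \<in> carrier_mat n n" "transpose_mat U * U = 1\<^sub>m n" "U * transpose_mat U = 1\<^sub>m n"
    "M = U * mat_diag n d * transpose_mat U"
proof -
  have adj: "mat_adjoint L = transpose_mat L" for L :: "real mat"
    by (rule eq_matI) (auto simp: mat_adjoint_alt)
  obtain d where "char_poly M = (\<Prod>i<n. [:- d i, 1:])"
    using real_symmetric_char_poly_splits[OF M] .
  then have "char_poly M = (\<Prod>e\<leftarrow>map d [0..<n]. [:- e, 1:])"
    by (simp add: prod.list_conv_set_nth atLeast0LessThan)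
  moreover have "\<exists>y. y * conjugate y = x" if "0 \<le> x" for x :: real
    using that by (intro exI[of _ "sqrt x"]) auto
  ultimately obtain U where U: "U \<in> carrier_mat n n" "transpose_mat U * U = 1\<^sub>m n"
    and MU: "M * U = U * mat_diag n ((!) (map d [0..<n]))"
    using hermitian_unitary_diagonalization[OF _ M(1)] M(2) unfolding adj by metis
  have UU: "U * transpose_mat U = 1\<^sub>m n"
    using mat_adjoint_eq_inverse[of U n] U by (simp add: adj)
  have "M = M * (U * transpose_mat U)"
    using M by (simp add: UU)
  also have "\<dots> = U * mat_diag n ((!) (map d [0..<n])) * transpose_mat U"
    using U M by (simp add: MU flip: assoc_mult_mat[of _ n n _ n _ n])
  finally show thesis
    by (rule that[OF U UU])
qed

section \<open>Square roots of positive definite matrices\<close>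

lemma diagonalization_quadratic_form:
  assumes U: "(U :: real mat) \<in> carrier_mat n n" and x: "x \<in> carrier_vec n"
  shows "x \<bullet> ((U * mat_diag n d * transpose_mat U) *\<^sub>v x) =
         (\<Sum>i<n. d i * ((transpose_mat U *\<^sub>v x) $ i)\<^sup>2)"
proof -
  have "(U * mat_diag n d * transpose_mat U) *\<^sub>v x = U *\<^sub>v (mat_diag n d *\<^sub>v (transpose_mat U *\<^sub>v x))"
    using U x by (simp add: assoc_mult_mat_vec[of _ n n _ n])
  then have "x \<bullet> ((U * mat_diag n d * transpose_mat U) *\<^sub>v x) =
      (transpose_mat U *\<^sub>v x) \<bullet> (mat_diag n d *\<^sub>v (transpose_mat U *\<^sub>v x))"
    using U x by (simp add: transpose_vec_mult_scalar[of U n n] mult_mat_vec_carrier[of _ n n])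
  also have "\<dots> = (\<Sum>i<n. d i * ((transpose_mat U *\<^sub>v x) $ i)\<^sup>2)"
    using U x by (subst mat_diag_mult_vec)
      (auto simp: scalar_prod_def atLeast0LessThan power2_eq_square algebra_simps intro!: sum.cong)
  finally show ?thesis .
qed

lemma diagonalization_col:
  assumes U: "(U :: 'a::field mat) \<in> carrier_mat n n" "V * U = 1\<^sub>m n" "V \<in> carrier_mat n n" and i: "i < n"
  shows "(U * mat_diag n d * V) *\<^sub>v col U i = d i \<cdot>\<^sub>v col U i"
proof -
  have "V *\<^sub>v col U i = unit_vec n i"
    using U i by (simp flip: col_mult2)
  moreover have "mat_diag n d *\<^sub>v unit_vec n i = d i \<cdot>\<^sub>v unit_vec n i"
    by (subst mat_diag_mult_vec) (auto simp: unit_vec_def)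
  moreover have "U *\<^sub>v unit_vec n i = col U i"
    using U i by (intro eq_vecI) auto
  ultimately show ?thesis
    using U i by (simp add: assoc_mult_mat_vec[of _ n n _ n] mult_mat_vec)
qed

text \<open>If \<open>u\<close> is an eigenvector of \<open>D = S - T\<close> for \<open>c \<noteq> 0\<close>, then \<open>S D + D T = S\<^sup>2 - T\<^sup>2 = 0\<close> yields
  \<open>c (u \<bullet> S u + u \<bullet> T u) = 0\<close>, so both forms vanish at \<open>u\<close>, and hence so does \<open>u \<bullet> D u = c\<close>.\<close>

lemma psd_sqrt_unique:
  assumes S: "S \<in> carrier_mat n n" "pos_semidef_mat S" and T: "T \<in> carrier_mat n n" "pos_semidef_mat T"
    and eq: "S * S = T * T"
  shows "S = T"
proof -
  define D where "D = S - T"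
  have D: "D \<in> carrier_mat n n"
    using S T by (auto simp: D_def)
  have symS: "transpose_mat S = S" and symT: "transpose_mat T = T"
    using S T by (auto simp: pos_semidef_mat_def)
  have "transpose_mat D = D"
    using S T symS symT by (simp add: D_def transpose_minus[of _ n n])
  then obtain U d where U: "U \<in> carrier_mat n n" "transpose_mat U * U = 1\<^sub>m n" "U * transpose_mat U = 1\<^sub>m n"
    and DU: "D = U * mat_diag n d * transpose_mat U"
    using real_symmetric_diagonalization[OF D] by metis
  have SD: "S * D + D * T = 0\<^sub>m n n"
    using S(1) T(1) eq
    by (intro eq_matI) (auto simp: D_def mult_minus_distrib_mat[of _ n n _ n] minus_mult_distrib_mat[of _ n n _ _ n])
  have "d i = 0" if i: "i < n" for i
  proof (rule ccontr)
    assume d: "d i \<noteq> 0"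
    define u where "u = col U i"
    have u: "u \<in> carrier_vec n"
      using U i by (simp add: u_def)
    have Du: "D *\<^sub>v u = d i \<cdot>\<^sub>v u"
      unfolding DU u_def using U i by (intro diagonalization_col) auto
    have uu: "u \<bullet> u = 1"
      using arg_cong[OF U(2), of "\<lambda>M. M $$ (i, i)"] U(1) i by (simp add: u_def)
    have "u \<bullet> ((S * D) *\<^sub>v u) = d i * (u \<bullet> (S *\<^sub>v u))"
      using S(1) D u Du by (simp add: mult_mat_vec)
    moreover have "u \<bullet> ((D * T) *\<^sub>v u) = (transpose_mat D *\<^sub>v u) \<bullet> (T *\<^sub>v u)"
      using T(1) D u by (simp add: transpose_vec_mult_scalar[of _ n n])
    then have "u \<bullet> ((D * T) *\<^sub>v u) = d i * (u \<bullet> (T *\<^sub>v u))"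
      using T(1) u Du \<open>transpose_mat D = D\<close> by simp
    moreover have "u \<bullet> ((S * D) *\<^sub>v u) + u \<bullet> ((D * T) *\<^sub>v u) = u \<bullet> ((S * D + D * T) *\<^sub>v u)"
      using S(1) T(1) D u by (simp add: add_mult_distrib_mat_vec[of _ n n] scalar_prod_add_distrib[of _ n])
    moreover have "u \<bullet> ((S * D + D * T) *\<^sub>v u) = 0"
    proof -
      have "0\<^sub>m n n *\<^sub>v u = 0\<^sub>v n"
        using u by (intro eq_vecI) auto
      then show ?thesis
        using u by (simp add: SD)
    qed
    ultimately have "d i * (u \<bullet> (S *\<^sub>v u) + u \<bullet> (T *\<^sub>v u)) = 0"
      by (simp add: algebra_simps)
    moreover have "0 \<le> u \<bullet> (S *\<^sub>v u)" "0 \<le> u \<bullet> (T *\<^sub>v u)"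
      using S T u by (auto simp: pos_semidef_mat_def)
    ultimately have "u \<bullet> (S *\<^sub>v u) = 0" "u \<bullet> (T *\<^sub>v u) = 0"
      using d by auto
    moreover have "u \<bullet> (D *\<^sub>v u) = u \<bullet> (S *\<^sub>v u) - u \<bullet> (T *\<^sub>v u)"
      using S(1) T(1) u by (simp add: D_def minus_mult_distrib_mat_vec[of _ n n] scalar_prod_minus_distrib[of _ n])
    ultimately show False
      using d u uu by (simp add: Du)
  qed
  then have "mat_diag n d = 0\<^sub>m n n"
    by (intro eq_matI) (auto simp: mat_diag_def)
  then have "D = 0\<^sub>m n n"
    using U by (simp add: DU)
  then have "S $$ (i, j) = T $$ (i, j)" if "i < n" "j < n" for i j
  proof -
    have "(S - T) $$ (i, j) = 0"
      using \<open>D = 0\<^sub>m n n\<close> that by (simp flip: D_def)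
    then show ?thesis
      using S(1) T(1) that by simp
  qed
  then show ?thesis
    using S(1) T(1) by (intro eq_matI) auto
qed

text \<open>\<open>psd_sqrt\<close> is a definite description, so its properties become available
  only after a root has been exhibited, by taking square roots of the eigenvalues, and shown to be
  the only one.\<close>

lemma psd_sqrt:
  assumes M: "M \<in> carrier_mat n n" "pos_def_mat M"
  shows "psd_sqrt M \<in> carrier_mat n n" "transpose_mat (psd_sqrt M) = psd_sqrt M"
    "psd_sqrt M * psd_sqrt M = M"
proof -
  have "transpose_mat M = M"
    using M by (simp add: pos_def_mat_def)
  then obtain U d where U: "U \<in> carrier_mat n n" "transpose_mat U * U = 1\<^sub>m n" "U * transpose_mat U = 1\<^sub>m n"
    and MU: "M = U * mat_diag n d * transpose_mat U"
    using real_symmetric_diagonalization[OF M(1)] by metis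
  \<comment> \<open>The form at a unit eigenvector is the eigenvalue; its sign is what makes
    \<open>sqrt (d i)\<close> square back to \<open>d i\<close>.\<close>
  have d: "0 \<le> d i" if i: "i < n" for i
  proof -
    define u where "u = col U i"
    have u: "u \<in> carrier_vec n"
      using U i by (simp add: u_def)
    have "M *\<^sub>v u = d i \<cdot>\<^sub>v u"
      unfolding MU u_def using U i by (intro diagonalization_col) auto
    moreover have "u \<bullet> u = 1"
      using arg_cong[OF U(2), of "\<lambda>M. M $$ (i, i)"] U(1) i by (simp add: u_def)
    moreover from this have "u \<noteq> 0\<^sub>v n"
      by auto
    then have "0 < u \<bullet> (M *\<^sub>v u)"
      using M u by (auto simp: pos_def_mat_def)
    ultimately show ?thesis
      using u by simp
  qed
  define S where "S = U * mat_diag n (\<lambda>i. sqrt (d i)) * transpose_mat U"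
  have UT: "transpose_mat U \<in> carrier_mat n n"
    using U by simp
  have S: "S \<in> carrier_mat n n"
    using U by (auto simp: S_def)
  have tdiag: "transpose_mat (mat_diag n f) = mat_diag n f" for f :: "nat \<Rightarrow> real"
    by (rule eq_matI) (auto simp: mat_diag_def)
  have symS: "transpose_mat S = S"
    using U(1) UT by (simp add: S_def transpose_mult[of _ n n _ n] tdiag assoc_mult_mat[of _ n n _ n _ n] transpose_carrier_mat)
  have "S * S = U * (mat_diag n (\<lambda>i. sqrt (d i)) * ((transpose_mat U * U) * mat_diag n (\<lambda>i. sqrt (d i)))) * transpose_mat U"
    using U(1) UT by (simp add: S_def assoc_mult_mat[of _ n n _ n _ n])
  also have "mat_diag n (\<lambda>i. sqrt (d i)) * ((transpose_mat U * U) * mat_diag n (\<lambda>i. sqrt (d i))) = mat_diag n d"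
    using d by (simp add: U(2) left_mult_one_mat[OF mat_diag_dim]) (auto simp: mat_diag_def)
  finally have SS: "S * S = M"
    by (simp add: MU)
  have "0 \<le> x \<bullet> (S *\<^sub>v x)" if "x \<in> carrier_vec n" for x
    unfolding S_def diagonalization_quadratic_form[OF U(1) that] using d by (intro sum_nonneg) auto
  then have psd: "pos_semidef_mat S"
    using S symS by (auto simp: pos_semidef_mat_def)
  have "psd_sqrt M = S"
    unfolding psd_sqrt_def
  proof (rule the_equality)
    show "S \<in> carrier_mat (dim_row M) (dim_row M) \<and> pos_semidef_mat S \<and> S * S = M"
      using S SS psd M(1) by auto
    show "T = S" if "T \<in> carrier_mat (dim_row M) (dim_row M) \<and> pos_semidef_mat T \<and> T * T = M" for T
      using psd_sqrt_unique[of T n S] that S SS psd M(1) by auto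
  qed
  then show "psd_sqrt M \<in> carrier_mat n n" "transpose_mat (psd_sqrt M) = psd_sqrt M"
    "psd_sqrt M * psd_sqrt M = M"
    using S symS SS by auto
qed

lemma pos_def_mat_det: 
  assumes "M \<in> carrier_mat n n" "pos_def_mat M"
  shows "det M \<noteq> 0"
proof
  assume "det M = 0"
  then obtain v where "v \<in> carrier_vec n" "v \<noteq> 0\<^sub>v n" "M *\<^sub>v v = 0\<^sub>v n"
    using det_0_iff_vec_prod_zero_field[OF assms(1)] by auto
  then show False
    using assms by (force simp: pos_def_mat_def)
qed

text \<open>\<open>mat_inverse\<close> returns an option; a nonzero determinant rules out
  \<open>None\<close>. Symmetry follows from uniqueness of the inverse, since the transpose of the
  inverse also inverts the symmetric matrix \<open>psd_sqrt M\<close>.\<close>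

lemma inv_sqrt:
  assumes M: "M \<in> carrier_mat n n" "pos_def_mat M"
  shows "inv_sqrt M \<in> carrier_mat n n" "inv_sqrt M * psd_sqrt M = 1\<^sub>m n"
    "psd_sqrt M * inv_sqrt M = 1\<^sub>m n" "transpose_mat (inv_sqrt M) = inv_sqrt M"
proof -
  note S = psd_sqrt[OF M]
  have "det (psd_sqrt M) * det (psd_sqrt M) \<noteq> 0"
    using pos_def_mat_det[OF M] S by (metis det_mult)
  then have "psd_sqrt M \<in> Units (ring_mat TYPE(real) n ())"
    using S det_non_zero_imp_unit by auto
  then obtain W where "mat_inverse (psd_sqrt M) = Some W"
    using mat_inverse(1)[OF S(1), of "()"] by (cases "mat_inverse (psd_sqrt M)") auto
  from mat_inverse(2)[OF S(1) this] this
  show W: "inv_sqrt M \<in> carrier_mat n n" "inv_sqrt M * psd_sqrt M = 1\<^sub>m n"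
    "psd_sqrt M * inv_sqrt M = 1\<^sub>m n"
    by (auto simp: inv_sqrt_def)
  have "psd_sqrt M * transpose_mat (inv_sqrt M) = 1\<^sub>m n"
    using transpose_mult[OF W(1) S(1)] by (simp add: W(2) S(2))
  then have "inv_sqrt M * psd_sqrt M * transpose_mat (inv_sqrt M) = inv_sqrt M"
    using W(1) S by (simp add: assoc_mult_mat[of _ n n _ n _ n])
  then show "transpose_mat (inv_sqrt M) = inv_sqrt M"
    using W by (simp add: left_mult_one_mat[of _ n])
qed

section \<open>Rank and spectrum of the loss matrix\<close>

text \<open>Each summand is an outer product, of rank at most 1, and the rank is
  subadditive.\<close>

lemma rank_sum_outer_le:
  fixes u w :: "nat \<Rightarrow> nat \<Rightarrow> 'a::field"
  assumes "finite S"
  shows "vec_space.rank n (mat n n (\<lambda>(r, c). \<Sum>i\<in>S. u i r * w i c)) \<le> card S"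
  using assms
proof (induction S)
  case empty
  have zero: "mat n n (\<lambda>(r, c). \<Sum>i\<in>{}. u i r * w i c) = 0\<^sub>m n n"
    by (rule eq_matI) auto
  show ?case
    unfolding zero by (simp add: vec_space.rank_0I)
next
  case (insert x S)
  let ?X = "mat n n (\<lambda>(r, c). u x r * w x c)"
  let ?S = "mat n n (\<lambda>(r, c). \<Sum>i\<in>S. u i r * w i c)"
  have "mat n n (\<lambda>(r, c). \<Sum>i\<in>insert x S. u i r * w i c) = ?X + ?S"
    using insert.hyps by (intro eq_matI) auto
  moreover have "vec_space.rank n (?X + ?S) \<le> vec_space.rank n ?X + vec_space.rank n ?S"
    by (rule vec_space.rank_subadditive[of _ n n]) auto
  moreover have "vec_space.rank n ?X \<le> 1"
    by (rule vec_space.rank_le_1_product_entries[of _ n n "u x" "w x"]) auto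
  ultimately show ?case
    using insert by simp
qed

lemma congruence_diag_entries:
  assumes "(V :: 'a::field mat) \<in> carrier_mat n n"
  shows "V * mat_diag n d * transpose_mat V = mat n n (\<lambda>(r, c). \<Sum>i<n. (V $$ (r, i) * d i) * V $$ (c, i))"
  using assms
  by (intro eq_matI) (auto simp: mat_diag_mult_right[of V n n] scalar_prod_def atLeast0LessThan intro!: sum.cong)

text \<open>The lower bound: filling the zeros of \<open>d\<close> with ones makes the matrix invertible and raises the
  rank by at most the number of zeros.\<close>

lemma rank_congruence_diag:
  assumes V: "(V :: 'a::field mat) \<in> carrier_mat n n" "det V \<noteq> 0"
  shows "vec_space.rank n (V * mat_diag n d * transpose_mat V) = card {i. i < n \<and> d i \<noteq> 0}"
proof -
  have le: "vec_space.rank n (V * mat_diag n f * transpose_mat V) \<le> card {i. i < n \<and> f i \<noteq> 0}" for f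
  proof -
    have "V * mat_diag n f * transpose_mat V =
        mat n n (\<lambda>(r, c). \<Sum>i\<in>{i. i < n \<and> f i \<noteq> 0}. (V $$ (r, i) * f i) * V $$ (c, i))"
      unfolding congruence_diag_entries[OF V(1)]
      by (intro eq_matI) (auto intro!: sum.mono_neutral_right)
    then show ?thesis
      using rank_sum_outer_le[of "{i. i < n \<and> f i \<noteq> 0}" n "\<lambda>i r. V $$ (r, i) * f i" "\<lambda>i c. V $$ (c, i)"]
      by simp
  qed
  define e where "e = (\<lambda>i. if d i = 0 then 1 else 0 :: 'a)"
  have "det (mat_diag n (\<lambda>i. d i + e i)) \<noteq> 0"
  proof -
    have "det (mat_diag n (\<lambda>i. d i + e i)) = prod_list (diag_mat (mat_diag n (\<lambda>i. d i + e i)))"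
      by (intro det_upper_triangular[of _ n]) (auto simp: mat_diag_def)
    then show ?thesis
      by (auto simp: prod_list_zero_iff diag_mat_def mat_diag_def e_def split: if_splits)
  qed
  then have "det (V * mat_diag n (\<lambda>i. d i + e i) * transpose_mat V) \<noteq> 0"
    using V by (simp add: det_mult[of _ n] det_transpose[of _ n])
  then have "n = vec_space.rank n (V * mat_diag n (\<lambda>i. d i + e i) * transpose_mat V)"
    using vec_space.det_rank_iff[of "V * mat_diag n (\<lambda>i. d i + e i) * transpose_mat V"] V by simp
  also have "V * mat_diag n (\<lambda>i. d i + e i) * transpose_mat V =
      V * mat_diag n d * transpose_mat V + V * mat_diag n e * transpose_mat V"
    unfolding congruence_diag_entries[OF V(1)]
    by (intro eq_matI) (auto simp: algebra_simps sum.distrib)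
  also have "vec_space.rank n \<dots> \<le> vec_space.rank n (V * mat_diag n d * transpose_mat V) + vec_space.rank n (V * mat_diag n e * transpose_mat V)"
    using V by (intro vec_space.rank_subadditive[of _ n n]) auto
  also have "vec_space.rank n (V * mat_diag n e * transpose_mat V) \<le> card {i. i < n \<and> d i = 0}"
  proof -
    have "{i. i < n \<and> e i \<noteq> 0} = {i. i < n \<and> d i = 0}"
      by (auto simp: e_def)
    then show ?thesis
      using le[of e] by simp
  qed
  finally have "n \<le> vec_space.rank n (V * mat_diag n d * transpose_mat V) + card {i. i < n \<and> d i = 0}"
    by simp
  moreover have "n = card {i. i < n \<and> d i \<noteq> 0} + card {i. i < n \<and> d i = 0}"
  proof -
    have "card ({i. i < n \<and> d i \<noteq> 0} \<union> {i. i < n \<and> d i = 0}) =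
        card {i. i < n \<and> d i \<noteq> 0} + card {i. i < n \<and> d i = 0}"
      by (intro card_Un_disjoint) auto
    moreover have "{i. i < n \<and> d i \<noteq> 0} \<union> {i. i < n \<and> d i = 0} = {..<n}"
      by auto
    ultimately show ?thesis
      by simp
  qed
  ultimately show ?thesis
    using le[of d] by simp
qed

text \<open>One diagonalization of \<open>C = W * R * W\<close> serves twice. Padded with an
  identity block it diagonalizes \<open>B_mat X R\<close>; multiplied by
  \<open>S = psd_sqrt X\<close> it writes \<open>R\<close> as the congruence of
  \<open>mat_diag N d\<close> by the invertible \<open>S * V\<close>, so the number of nonzero
  eigenvalues is the rank of \<open>R\<close>, whatever \<open>X\<close> is.\<close>

lemma B_mat_diagonalization:
  assumes X: "X \<in> carrier_mat N N" "pos_def_mat X" and R: "R \<in> carrier_mat N N" "pos_semidef_mat R"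
  obtains U d where "U \<in> carrier_mat (2 * N) (2 * N)" "transpose_mat U * U = 1\<^sub>m (2 * N)"
    "U * transpose_mat U = 1\<^sub>m (2 * N)" "B_mat X R = U * mat_diag (2 * N) d * transpose_mat U"
    "card {i. i < 2 * N \<and> d i \<noteq> 0} = loss_rank R"
proof -
  define W where "W = inv_sqrt X"
  define S where "S = psd_sqrt X"
  define C where "C = W * R * W"
  note W = inv_sqrt[OF X, folded W_def S_def]
  note S = psd_sqrt[OF X, folded S_def]
  have Rsym: "transpose_mat R = R"
    using R by (simp add: pos_semidef_mat_def)
  have C: "C \<in> carrier_mat N N"
    using W R by (simp add: C_def)
  have "transpose_mat C = C"
    using W(1,4) R(1) Rsym by (simp add: C_def transpose_mult[of _ N N _ N] assoc_mult_mat[of _ N N _ N _ N])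
  then obtain V d where V: "V \<in> carrier_mat N N" "transpose_mat V * V = 1\<^sub>m N" "V * transpose_mat V = 1\<^sub>m N"
    and CV: "C = V * mat_diag N d * transpose_mat V"
    using real_symmetric_diagonalization[OF C] by metis
  have VT: "transpose_mat V \<in> carrier_mat N N"
    using V by simp
  define f where "f = (\<lambda>i. if i < N then d i else 0)"
  define U where "U = four_block_mat V (0\<^sub>m N N) (0\<^sub>m N N) (1\<^sub>m N)"
  have U: "U \<in> carrier_mat (2 * N) (2 * N)"
    using V by (auto simp: U_def mult_2)
  have UT: "transpose_mat U = four_block_mat (transpose_mat V) (0\<^sub>m N N) (0\<^sub>m N N) (1\<^sub>m N)"
    using V by (simp add: U_def transpose_four_block_mat[of _ N N _ N _ N])
  have one: "1\<^sub>m (2 * N) = four_block_mat (1\<^sub>m N) (0\<^sub>m N N) (0\<^sub>m N N) (1\<^sub>m N)"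
    by (rule eq_matI) auto
  have diag: "mat_diag (2 * N) f = four_block_mat (mat_diag N d) (0\<^sub>m N N) (0\<^sub>m N N) (0\<^sub>m N N)"
    by (rule eq_matI) (auto simp: mat_diag_def f_def)
  have UU: "transpose_mat U * U = 1\<^sub>m (2 * N)" "U * transpose_mat U = 1\<^sub>m (2 * N)"
    unfolding UT one unfolding U_def using V by (simp_all add: mult_block_diag_mat)
  have BU: "B_mat X R = U * mat_diag (2 * N) f * transpose_mat U"
    unfolding UT diag B_mat_def unfolding U_def
    using V X CV by (simp add: mult_block_diag_mat C_def W_def)
  have "R = (S * W) * R * (W * S)"
    using R W(2,3) by simp
  also have "\<dots> = S * C * S"
    using R W(1) S(1) by (simp add: C_def assoc_mult_mat[of _ N N _ N _ N])
  also have "\<dots> = (S * V) * mat_diag N d * transpose_mat (S * V)"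
    using V(1) VT S(1,2) by (simp add: CV transpose_mult[of _ N N _ N] assoc_mult_mat[of _ N N _ N _ N])
  finally have RV: "R = (S * V) * mat_diag N d * transpose_mat (S * V)" .
  have "det S * det W \<noteq> 0"
    using W(3) det_mult[OF S(1) W(1)] by simp
  moreover have "det V * det (transpose_mat V) \<noteq> 0"
    using V(3) det_mult[OF V(1) VT] by simp
  ultimately have "det (S * V) \<noteq> 0"
    using det_mult[OF S(1) V(1)] by auto
  moreover have "S * V \<in> carrier_mat N N"
    using S V by simp
  ultimately have "vec_space.rank N R = card {i. i < N \<and> d i \<noteq> 0}"
    using rank_congruence_diag[of "S * V" N d] by (simp flip: RV)
  then have "loss_rank R = card {i. i < N \<and> d i \<noteq> 0}"
    using R(1) by (simp add: loss_rank_def)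
  also have "{i. i < N \<and> d i \<noteq> 0} = {i. i < 2 * N \<and> f i \<noteq> 0}"
    by (auto simp: f_def)
  finally show thesis
    using U UU BU that by simp
qed

lemma sum_singleton_mset: "(\<Sum>i<n. {#f i#}) = image_mset f (mset_set {..<n})" for n :: nat
  by (induction n) (auto simp: lessThan_Suc)

lemma nonzero_eigvals_of_char_poly:
  fixes n :: nat
  assumes "char_poly M = (\<Prod>i<n. [:- d i, 1:])"
  shows "mset (nonzero_eigvals M) = filter_mset (\<lambda>x. x \<noteq> 0) (image_mset d (mset_set {..<n}))"
proof -
  have "proots (char_poly M) = (\<Sum>i<n. {#d i#})"
    unfolding assms by (subst proots_prod) auto
  also have "\<dots> = image_mset d (mset_set {..<n})"
    by (rule sum_singleton_mset)
  finally show ?thesis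
    by (simp add: nonzero_eigvals_def)
qed

text \<open>\<open>b_val\<close> reads a sorted root list by position, whereas the perturbation
  argument needs positions on the diagonal. The list has exactly \<open>loss_rank R\<close> entries,
  so indices from 1 to \<open>loss_rank R\<close> stay in range. Being distinct, it has as many
  values as there are nonzero diagonal positions; this forces \<open>d\<close> to be injective
  there, so each \<open>b_k\<close> occurs once.\<close>

lemma B_mat_spectrum:
  assumes X: "X \<in> carrier_mat N N" "pos_def_mat X" and R: "R \<in> carrier_mat N N" "pos_semidef_mat R"
    and inj: "inj_on (b_val X R) {1..loss_rank R}"
  obtains U d where "U \<in> carrier_mat (2 * N) (2 * N)" "transpose_mat U * U = 1\<^sub>m (2 * N)"
    "U * transpose_mat U = 1\<^sub>m (2 * N)" "B_mat X R = U * mat_diag (2 * N) d * transpose_mat U"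
    "\<And>i. i < 2 * N \<Longrightarrow> \<exists>k\<le>loss_rank R. d i = b_val X R k"
    "\<And>k. 1 \<le> k \<Longrightarrow> k \<le> loss_rank R \<Longrightarrow> b_val X R k \<noteq> 0"
    "\<And>k. 1 \<le> k \<Longrightarrow> k \<le> loss_rank R \<Longrightarrow> \<exists>!i. i < 2 * N \<and> d i = b_val X R k"
proof -
  obtain U d where U: "U \<in> carrier_mat (2 * N) (2 * N)" "transpose_mat U * U = 1\<^sub>m (2 * N)"
    "U * transpose_mat U = 1\<^sub>m (2 * N)" "B_mat X R = U * mat_diag (2 * N) d * transpose_mat U"
    and card: "card {i. i < 2 * N \<and> d i \<noteq> 0} = loss_rank R"
    using B_mat_diagonalization[OF X R] .
  define r where "r = loss_rank R"
  define xs where "xs = nonzero_eigvals (B_mat X R)"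
  have "char_poly (B_mat X R) = (\<Prod>i<2 * N. [:- d i, 1:])"
    unfolding U(4) using U by (intro char_poly_diagonalization) auto
  from nonzero_eigvals_of_char_poly[OF this]
  have mset: "mset xs = image_mset d (mset_set {i. i < 2 * N \<and> d i \<noteq> 0})"
    by (simp add: xs_def filter_mset_image_mset lessThan_def)
  have len: "length xs = r"
    using arg_cong[OF mset, of size] card by (simp add: r_def)
  have b: "b_val X R k = xs ! (k - 1)" if "1 \<le> k" for k
    using that by (simp add: b_val_def xs_def)
  have set: "set xs = d ` {i. i < 2 * N \<and> d i \<noteq> 0}"
    using arg_cong[OF mset, of set_mset] by simp
  have "distinct xs"
    unfolding distinct_conv_nth
  proof (intro allI impI)
    fix i j assume ij: "i < length xs" "j < length xs" "i \<noteq> j"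
    then have "b_val X R (Suc i) \<noteq> b_val X R (Suc j)"
      using inj_onD[OF inj, of "Suc i" "Suc j"] len by (auto simp: r_def)
    then show "xs ! i \<noteq> xs ! j"
      using b[of "Suc i"] b[of "Suc j"] by simp
  qed
  then have inj_d: "inj_on d {i. i < 2 * N \<and> d i \<noteq> 0}"
    by (intro eq_card_imp_inj_on) (simp_all add: len r_def card distinct_card flip: set)
  show thesis
  proof (rule that[OF U])
    show "\<exists>k\<le>loss_rank R. d i = b_val X R k" if i: "i < 2 * N" for i
    proof (cases "d i = 0")
      case True
      then show ?thesis by (auto simp: b_val_def)
    next
      case False
      then have "d i \<in> set xs"
        using set i by auto
      then obtain k where "k < r" "d i = xs ! k"
        by (auto simp: in_set_conv_nth len)
      then show ?thesis
        using b[of "Suc k"] by (intro exI[of _ "Suc k"]) (auto simp: r_def)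
    qed
    fix k assume k: "1 \<le> k" "k \<le> loss_rank R"
    then have in_set: "b_val X R k \<in> set xs"
      using b[OF k(1)] len by (auto simp: r_def)
    then show nz: "b_val X R k \<noteq> 0"
      using set by auto
    obtain i where i: "i < 2 * N" "d i = b_val X R k"
      using in_set set by auto
    show "\<exists>!i. i < 2 * N \<and> d i = b_val X R k"
    proof (rule ex1I[of _ i])
      show "i' = i" if "i' < 2 * N \<and> d i' = b_val X R k" for i'
        using inj_onD[OF inj_d, of i' i] i that nz by auto
    qed (use i in auto)
  qed
qed

section \<open>Norm estimates for Hermitian matrices\<close>

text \<open>The squared Euclidean norm. The operator bounds below compare squares, so no roots are
  taken.\<close>

definition cnorm2 :: "complex vec \<Rightarrow> real" where
  "cnorm2 x = (\<Sum>i<dim_vec x. (cmod (x $ i))\<^sup>2)"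

lemma cnorm2_eq_scalar_prod: "of_real (cnorm2 x) = x \<bullet>c x"
  by (simp add: cnorm2_def scalar_prod_def atLeast0LessThan complex_norm_square flip: of_real_power)

lemma cnorm2_pos: "x \<in> carrier_vec n \<Longrightarrow> x \<noteq> 0\<^sub>v n \<Longrightarrow> 0 < cnorm2 x"
proof -
  assume x: "x \<in> carrier_vec n" "x \<noteq> 0\<^sub>v n"
  then obtain i where "i < n" "x $ i \<noteq> 0"
    by (auto simp: vec_eq_iff)
  then show ?thesis
    using x unfolding cnorm2_def by (intro sum_pos2[of _ i]) auto
qed

lemma cnorm2_smult: "cnorm2 (c \<cdot>\<^sub>v x) = (cmod c)\<^sup>2 * cnorm2 x"
  by (simp add: cnorm2_def norm_mult power_mult_distrib sum_distrib_left)

lemma mat_adjoint_scalar_prod: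
  fixes A :: "complex mat"
  assumes A: "A \<in> carrier_mat n m" and x: "x \<in> carrier_vec m" and y: "y \<in> carrier_vec n"
  shows "(A *\<^sub>v x) \<bullet>c y = x \<bullet>c (mat_adjoint A *\<^sub>v y)"
proof -
  have "(A *\<^sub>v x) \<bullet>c y = (\<Sum>i<n. \<Sum>j<m. A $$ (i, j) * x $ j * cnj (y $ i))"
    using assms by (simp add: scalar_prod_def atLeast0LessThan sum_distrib_right)
  also have "\<dots> = (\<Sum>j<m. \<Sum>i<n. A $$ (i, j) * x $ j * cnj (y $ i))"
    by (rule sum.swap)
  also have "\<dots> = x \<bullet>c (mat_adjoint A *\<^sub>v y)"
    using assms by (simp add: scalar_prod_def atLeast0LessThan mat_adjoint_alt sum_distrib_left mult_ac)
  finally show ?thesis .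
qed

lemma cnorm2_unitary:
  assumes U: "U \<in> carrier_mat n n" "mat_adjoint U * U = 1\<^sub>m n" and x: "x \<in> carrier_vec n"
  shows "cnorm2 (U *\<^sub>v x) = cnorm2 x"
proof -
  have "mat_adjoint U *\<^sub>v (U *\<^sub>v x) = x"
    using U x by (simp flip: assoc_mult_mat_vec[of _ n n _ n])
  then have "of_real (cnorm2 (U *\<^sub>v x)) = complex_of_real (cnorm2 x)"
    using U x by (simp add: cnorm2_eq_scalar_prod mat_adjoint_scalar_prod[of U n n])
  then show ?thesis
    by simp
qed

text \<open>Parseval's identity in the eigenbasis given by the columns of \<open>U\<close>:
  \<open>y\<close> collects the coordinates of \<open>x\<close>, and the matrix multiplies them by
  the \<open>d i\<close>.\<close>

lemma cnorm2_diagonalization: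
  fixes x y :: "complex vec"
  assumes U: "U \<in> carrier_mat n n" "mat_adjoint U * U = 1\<^sub>m n" and x: "x \<in> carrier_vec n"
  defines "y \<equiv> mat_adjoint U *\<^sub>v x"
  shows "cnorm2 x = (\<Sum>i<n. (cmod (y $ i))\<^sup>2)"
    and "cnorm2 ((U * mat_diag n d * mat_adjoint U) *\<^sub>v x) = (\<Sum>i<n. (cmod (d i))\<^sup>2 * (cmod (y $ i))\<^sup>2)"
proof -
  have adjU: "mat_adjoint U \<in> carrier_mat n n"
    using U by simp
  have y: "y \<in> carrier_vec n"
    unfolding y_def using adjU x by (rule mult_mat_vec_carrier)
  have "cnorm2 y = cnorm2 x"
    unfolding y_def using U x mat_adjoint_eq_inverse[OF U] by (intro cnorm2_unitary) auto
  then show "cnorm2 x = (\<Sum>i<n. (cmod (y $ i))\<^sup>2)"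
    using y by (simp add: cnorm2_def)
  have "(U * mat_diag n d * mat_adjoint U) *\<^sub>v x = U *\<^sub>v (mat_diag n d *\<^sub>v y)"
    using U x adjU by (simp add: assoc_mult_mat_vec[of _ n n _ n] y_def mult_mat_vec_carrier[of _ n n])
  also have "mat_diag n d *\<^sub>v y = vec n (\<lambda>i. d i * y $ i)"
    using y by (rule mat_diag_mult_vec)
  finally show "cnorm2 ((U * mat_diag n d * mat_adjoint U) *\<^sub>v x) = (\<Sum>i<n. (cmod (d i))\<^sup>2 * (cmod (y $ i))\<^sup>2)"
    using U by (simp add: cnorm2_unitary) (simp add: cnorm2_def norm_mult power_mult_distrib)
qed

text \<open>If every \<open>d i\<close> exceeded \<open>e\<close> in modulus, each nonzero
  coordinate of \<open>x\<close> in the eigenbasis would be stretched by more than \<open>e\<close>,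
  and there is at least one. This is the core of the Bauer--Fike bound.\<close>

lemma cnorm2_diagonalization_lower_bound:
  assumes U: "U \<in> carrier_mat n n" "mat_adjoint U * U = 1\<^sub>m n" and x: "x \<in> carrier_vec n" "x \<noteq> 0\<^sub>v n"
    and "0 \<le> e" and le: "cnorm2 ((U * mat_diag n d * mat_adjoint U) *\<^sub>v x) \<le> e\<^sup>2 * cnorm2 x"
  shows "\<exists>i<n. cmod (d i) \<le> e"
proof (rule ccontr)
  assume "\<not> ?thesis"
  then have gt: "e\<^sup>2 < (cmod (d i))\<^sup>2" if "i < n" for i
    using that \<open>0 \<le> e\<close> by (auto simp: not_le intro!: power_strict_mono)
  define y where "y = mat_adjoint U *\<^sub>v x"
  note eqs = cnorm2_diagonalization[OF U x(1), folded y_def]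
  have "0 < (\<Sum>i<n. (cmod (y $ i))\<^sup>2)"
    using cnorm2_pos[OF x] eqs(1) by simp
  then obtain i where i: "i < n" "0 < (cmod (y $ i))\<^sup>2"
    by (metis lessThan_iff not_less sum_nonpos)
  have "(\<Sum>i<n. e\<^sup>2 * (cmod (y $ i))\<^sup>2) < (\<Sum>i<n. (cmod (d i))\<^sup>2 * (cmod (y $ i))\<^sup>2)"
  proof (rule sum_strict_mono_ex1)
    show "\<forall>i\<in>{..<n}. e\<^sup>2 * (cmod (y $ i))\<^sup>2 \<le> (cmod (d i))\<^sup>2 * (cmod (y $ i))\<^sup>2"
      using gt by (intro ballI mult_right_mono) (auto intro: less_imp_le)
    show "\<exists>i\<in>{..<n}. e\<^sup>2 * (cmod (y $ i))\<^sup>2 < (cmod (d i))\<^sup>2 * (cmod (y $ i))\<^sup>2"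
      using i gt by (intro bexI[of _ i] mult_strict_right_mono) auto
  qed auto
  then show False
    using le eqs by (simp add: sum_distrib_left)
qed

text \<open>The premise \<open>imag\<close> says that \<open>H\<close> is \<i> times a real matrix.
  Conjugating an eigenvector for \<open>t\<close> then gives one for \<open>- t\<close>, so the
  largest eigenvalue bounds the moduli of all eigenvalues.\<close>

lemma hermitian_norm_bound:
  assumes H: "H \<in> carrier_mat n n" "mat_adjoint H = H" and imag: "map_mat cnj H = - H"
    and x: "x \<in> carrier_vec n"
  defines "w \<equiv> Max {t. eigenvalue H (complex_of_real t)}"
  shows "cnorm2 (H *\<^sub>v x) \<le> w\<^sup>2 * cnorm2 x" and "0 < n \<Longrightarrow> 0 \<le> w"
proof -
  obtain U d where U: "U \<in> carrier_mat n n" "mat_adjoint U * U = 1\<^sub>m n"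
    and HU: "H = U * mat_diag n (\<lambda>i. of_real (d i)) * mat_adjoint U"
    using hermitian_complex_diagonalization[OF H] .
  have cp: "char_poly H = (\<Prod>i<n. [:- of_real (d i), 1:])"
    unfolding HU using U mat_adjoint_eq_inverse[OF U] by (intro char_poly_diagonalization) auto
  have ev: "eigenvalue H (of_real t) \<longleftrightarrow> t \<in> d ` {..<n}" for t
    unfolding eigenvalue_root_char_poly[OF H(1)] cp by (auto simp: poly_prod)
  then have spec: "{t. eigenvalue H (complex_of_real t)} = d ` {..<n}"
    by auto
  have neg: "- t \<in> d ` {..<n}" if t: "t \<in> d ` {..<n}" for t
  proof -
    obtain v where v: "v \<in> carrier_vec n" "v \<noteq> 0\<^sub>v n" "H *\<^sub>v v = of_real t \<cdot>\<^sub>v v"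
      using t H unfolding ev[symmetric] eigenvalue_def eigenvector_def by auto
    have Hcnj: "cnj (H $$ (i, j)) = - H $$ (i, j)" if "i < n" "j < n" for i j
      using arg_cong[OF imag, of "\<lambda>M. M $$ (i, j)"] H that by simp
    define u where "u = map_vec cnj v"
    have "H *\<^sub>v u = of_real (- t) \<cdot>\<^sub>v u"
    proof (rule eq_vecI)
      fix i assume "i < dim_vec (of_real (- t) \<cdot>\<^sub>v u)"
      then have i: "i < n"
        using v by (simp add: u_def)
      have "(H *\<^sub>v u) $ i = (\<Sum>j<n. H $$ (i, j) * cnj (v $ j))"
        using H v i by (simp add: u_def scalar_prod_def atLeast0LessThan)
      also have "\<dots> = - cnj (\<Sum>j<n. H $$ (i, j) * v $ j)"
        using Hcnj i by (simp add: sum_negf)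
      also have "(\<Sum>j<n. H $$ (i, j) * v $ j) = (H *\<^sub>v v) $ i"
        using H v(1) i by (simp add: scalar_prod_def atLeast0LessThan)
      finally show "(H *\<^sub>v u) $ i = (of_real (- t) \<cdot>\<^sub>v u) $ i"
        using v i by (simp add: u_def)
    qed (use H v in \<open>simp add: u_def\<close>)
    moreover have "u \<in> carrier_vec n" "u \<noteq> 0\<^sub>v n"
      using v by (auto simp: u_def vec_eq_iff)
    ultimately have "eigenvalue H (of_real (- t))"
      using H unfolding eigenvalue_def eigenvector_def by auto
    then show ?thesis
      using ev by blast
  qed
  have fin: "finite (d ` {..<n})"
    by simp
  have le: "\<bar>d i\<bar> \<le> w" if "i < n" for i
  proof -
    have "d i \<in> d ` {..<n}"
      using that by auto
    from Max_ge[OF fin this] Max_ge[OF fin neg[OF this]] show ?thesis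
      by (simp add: w_def spec)
  qed
  then show "0 < n \<Longrightarrow> 0 \<le> w"
    using abs_ge_zero order_trans by blast
  have "(cmod (of_real (d i)))\<^sup>2 \<le> w\<^sup>2" if "i < n" for i
    using power_mono[OF le[OF that], of 2] by simp
  then have "(\<Sum>i<n. (cmod (of_real (d i)))\<^sup>2 * (cmod ((mat_adjoint U *\<^sub>v x) $ i))\<^sup>2) \<le>
      (\<Sum>i<n. w\<^sup>2 * (cmod ((mat_adjoint U *\<^sub>v x) $ i))\<^sup>2)"
    by (intro sum_mono mult_right_mono) auto
  then show "cnorm2 (H *\<^sub>v x) \<le> w\<^sup>2 * cnorm2 x"
    unfolding cnorm2_diagonalization(1)[OF U x] HU cnorm2_diagonalization(2)[OF U x]
    by (simp add: sum_distrib_left)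
qed

section \<open>Contour integrals of logarithmic derivatives\<close>

lemma circlepath_root_integral:
  assumes f: "f holomorphic_on UNIV" and "0 < \<rho>" "cmod (e - b) \<noteq> \<rho>"
  shows "((\<lambda>w. f w / (w - e)) has_contour_integral
          (if cmod (e - b) < \<rho> then 2 * of_real pi * \<i> * f e else 0)) (circlepath b \<rho>)"
proof (cases "cmod (e - b) < \<rho>")
  case True
  then show ?thesis
    using Cauchy_integral_circlepath_simple[of f b \<rho> e] holomorphic_on_subset[OF f] by simp
next
  case False
  then have "\<rho> < cmod (e - b)"
    using assms by simp
  \<comment> \<open>The open ball that reaches just to \<open>e\<close> contains the circle but not
    \<open>e\<close>, and it is convex, so Cauchy's theorem applies on it.\<close>
  then have "e \<notin> ball b (cmod (e - b))"
    by (simp add: dist_norm norm_minus_commute)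
  then have "(\<lambda>w. f w / (w - e)) holomorphic_on ball b (cmod (e - b))"
    by (intro holomorphic_intros holomorphic_on_subset[OF f]) auto
  then have "((\<lambda>w. f w / (w - e)) has_contour_integral 0) (circlepath b \<rho>)"
    using \<open>\<rho> < cmod (e - b)\<close> \<open>0 < \<rho>\<close>
    by (intro Cauchy_theorem_convex_simple[of _ "ball b (cmod (e - b))"]) (auto simp: dist_norm)
  then show ?thesis
    using False by simp
qed

lemma pderiv_linear_factor_quotient:
  fixes w e :: complex
  assumes "w \<noteq> e" "poly q w \<noteq> 0"
  shows "poly (pderiv ([:- e, 1:] * q)) w / poly ([:- e, 1:] * q) w = 1 / (w - e) + poly (pderiv q) w / poly q w"
proof -
  have "poly (pderiv ([:- e, 1:] * q)) w = (w - e) * poly (pderiv q) w + poly q w"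
    unfolding pderiv_mult by (simp add: pderiv_pCons algebra_simps)
  moreover have "poly ([:- e, 1:] * q) w = (w - e) * poly q w"
    by (simp add: algebra_simps)
  ultimately show ?thesis
    using assms by (simp only:) (simp add: add_divide_distrib)
qed

text \<open>The argument principle with weight \<open>f\<close>, for a factored polynomial: the
  logarithmic derivative splits into simple fractions, one per entry of \<open>es\<close>, and
  induction on the list sums their integrals. Repeated entries account for multiplicities.\<close>

lemma circlepath_log_derivative_integral:
  assumes f: "f holomorphic_on UNIV" and \<rho>: "0 < \<rho>" and "\<And>e. e \<in> set es \<Longrightarrow> cmod (e - b) \<noteq> \<rho>"
    and "p = (\<Prod>e\<leftarrow>es. [:- e, 1:])"
  shows "((\<lambda>w. f w * poly (pderiv p) w / poly p w) has_contour_integral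
          2 * of_real pi * \<i> * (\<Sum>e\<leftarrow>filter (\<lambda>e. cmod (e - b) < \<rho>) es. f e)) (circlepath b \<rho>)"
  using assms(3,4)
proof (induction es arbitrary: p)
  case Nil
  then show ?case
    by (simp add: has_contour_integral_0)
next
  case (Cons e es)
  define q where "q = (\<Prod>e\<leftarrow>es. [:- e, 1:])"
  have q: "((\<lambda>w. f w * poly (pderiv q) w / poly q w) has_contour_integral
      2 * of_real pi * \<i> * (\<Sum>e\<leftarrow>filter (\<lambda>e. cmod (e - b) < \<rho>) es. f e)) (circlepath b \<rho>)"
    using Cons.prems by (intro Cons.IH) (auto simp: q_def)
  have "((\<lambda>w. f w / (w - e) + f w * poly (pderiv q) w / poly q w) has_contour_integral
     (if cmod (e - b) < \<rho> then 2 * of_real pi * \<i> * f e else 0) +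
      2 * of_real pi * \<i> * (\<Sum>e\<leftarrow>filter (\<lambda>e. cmod (e - b) < \<rho>) es. f e)) (circlepath b \<rho>)"
    using Cons.prems \<rho> by (intro has_contour_integral_add q circlepath_root_integral f) auto
  then have "((\<lambda>w. f w * poly (pderiv p) w / poly p w) has_contour_integral
     (if cmod (e - b) < \<rho> then 2 * of_real pi * \<i> * f e else 0) +
      2 * of_real pi * \<i> * (\<Sum>e\<leftarrow>filter (\<lambda>e. cmod (e - b) < \<rho>) es. f e)) (circlepath b \<rho>)"
  proof (rule has_contour_integral_eq)
    fix w assume "w \<in> path_image (circlepath b \<rho>)"
    then have "cmod (w - b) = \<rho>"
      using \<rho> by (auto simp: dist_norm norm_minus_commute)
    then have "w \<noteq> e" "poly q w \<noteq> 0"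
      using Cons.prems(1)[of w] by (auto simp: q_def poly_prod_list prod_list_zero_iff)
    from pderiv_linear_factor_quotient[OF this]
    have "f w * (poly (pderiv p) w / poly p w) = f w * (1 / (w - e) + poly (pderiv q) w / poly q w)"
      using Cons.prems(2) by (simp add: q_def)
    then show "f w / (w - e) + f w * poly (pderiv q) w / poly q w = f w * poly (pderiv p) w / poly p w"
      by (simp add: algebra_simps)
  qed
  then show ?case
    by (simp add: algebra_simps split: if_splits)
qed

text \<open>\<open>P\<close> and \<open>Q\<close> are polynomials in two variables: the inner one is
  the parameter \<open>z\<close>, the outer one the integration variable \<open>w\<close>. For
  \<open>w\<close> on the circle the integrand is rational in \<open>z\<close> without poles in the
  disc, so differentiation under the integral sign applies.\<close>

lemma circlepath_integral_quotient_holomorphic: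
  fixes P Q :: "complex poly poly"
  assumes f: "f holomorphic_on UNIV" and r: "0 \<le> \<rho>"
    and nz: "\<And>z w. z \<in> ball 0 r \<Longrightarrow> cmod (w - b) = \<rho> \<Longrightarrow> poly (map_poly (\<lambda>c. poly c z) Q) w \<noteq> 0"
  shows "(\<lambda>z. contour_integral (circlepath b \<rho>)
           (\<lambda>w. f w * poly (map_poly (\<lambda>c. poly c z) P) w / poly (map_poly (\<lambda>c. poly c z) Q) w))
         holomorphic_on ball 0 r"
proof -
  \<comment> \<open>Fixing the parameter may lower the degree in \<open>w\<close>; summing up to
    \<open>degree S\<close> gives one formula valid for all \<open>z\<close>. \<open>E'\<close> is
    its derivative in \<open>z\<close>.\<close>
  define E where "E = (\<lambda>(S :: complex poly poly) z w. \<Sum>k\<le>degree S. poly (coeff S k) z * w ^ k)"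
  define E' where "E' = (\<lambda>(S :: complex poly poly) z w. \<Sum>k\<le>degree S. poly (pderiv (coeff S k)) z * w ^ k)"
  have E: "poly (map_poly (\<lambda>c. poly c z) S) w = E S z w" for S z w
  proof -
    have "degree (map_poly (\<lambda>c. poly c z) S) \<le> degree S"
      by (rule degree_map_poly_le)
    then have "poly (map_poly (\<lambda>c. poly c z) S) w = (\<Sum>k\<le>degree S. coeff (map_poly (\<lambda>c. poly c z) S) k * w ^ k)"
      unfolding poly_altdef[of "map_poly (\<lambda>c. poly c z) S"]
      by (intro sum.mono_neutral_left) (auto simp: coeff_map_poly intro!: le_degree)
    then show ?thesis
      by (simp add: E_def coeff_map_poly)
  qed
  have DE: "((\<lambda>z. E S z w) has_field_derivative E' S z w) (at z within X)" for S z w X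
    unfolding E_def E'_def by (auto intro!: derivative_eq_intros poly_DERIV[THEN has_field_derivative_at_within])
  define g where "g = circlepath b \<rho>"
  define c where "c = (\<lambda>t. f (g t) * vector_derivative g (at t))"
  define F where "F = (\<lambda>z t. c t * (E P z (g t) / E Q z (g t)))"
  define F' where "F' = (\<lambda>z t. c t * ((E' P z (g t) * E Q z (g t) - E P z (g t) * E' Q z (g t)) / (E Q z (g t) * E Q z (g t))))"
  have gb: "cmod (g t - b) = \<rho>" for t
    using r by (simp add: g_def circlepath norm_mult norm_exp_eq_Re)
  have nz': "E Q z (g t) \<noteq> 0" if "z \<in> ball 0 r" for z t
    using nz[OF that gb, of t] by (simp add: E)
  have cf: "continuous_on X f" for X
    using holomorphic_on_imp_continuous_on[OF f] continuous_on_subset by blast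
  have cg: "continuous_on X g" for X
    unfolding g_def circlepath_def part_circlepath_def linepath_def by (intro continuous_intros)
  have cc: "continuous_on X c" for X
    unfolding c_def by (intro continuous_intros continuous_on_compose2[OF cf cg])
       (auto simp: g_def vector_derivative_circlepath intro!: continuous_intros)
  have "(\<lambda>z. integral (cbox 0 1) (F z)) holomorphic_on ball 0 r"
  proof (rule leibniz_rule_holomorphic)
    show "((\<lambda>z. F z t) has_field_derivative F' z t) (at z within ball 0 r)" if "z \<in> ball 0 r" for z and t :: real
      unfolding F_def F'_def using nz'[OF that] by (intro DERIV_cmult DERIV_divide DE)
    show "F z integrable_on cbox 0 1" if "z \<in> ball 0 r" for z
      unfolding F_def E_def using nz'[OF that, unfolded E_def]
      by (intro integrable_continuous continuous_intros cc cg) auto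
    show "continuous_on (ball 0 r \<times> cbox 0 1) (\<lambda>(z, t). F' z t)"
      unfolding F'_def E_def E'_def case_prod_unfold using nz'[unfolded E_def]
      by (intro continuous_intros continuous_on_compose2[OF cc] continuous_on_compose2[OF cg]) auto
  qed auto
  then show ?thesis
    by (simp add: contour_integral_integral E F_def c_def g_def algebra_simps)
qed

lemma map_poly_pderiv:
  "map_poly (\<lambda>c. poly c z) (pderiv P) = pderiv (map_poly (\<lambda>c. poly c (z :: complex)) P)"
  by (rule poly_eqI) (simp add: coeff_pderiv coeff_map_poly)

section \<open>Eigenprojections of simple eigenvalues\<close>

text \<open>The spectral projection of a simple eigenvalue, described without powers of the shifted
  matrix: the eigenspace is a line, \<open>P\<close> fixes it, and \<open>M\<close> acts on both
  sides of \<open>P\<close> as the scalar \<open>l\<close>. In this shape it passes easily through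
  scaling and inversion of \<open>M\<close>.\<close>

definition simple_eigenprojection :: "nat \<Rightarrow> complex mat \<Rightarrow> complex \<Rightarrow> complex mat \<Rightarrow> bool" where
  "simple_eigenprojection n M l P \<longleftrightarrow>
     M \<in> carrier_mat n n \<and> P \<in> carrier_mat n n \<and> P * P = P \<and> M * P = l \<cdot>\<^sub>m P \<and> P * M = l \<cdot>\<^sub>m P \<and>
     (\<exists>v\<in>carrier_vec n. v \<noteq> 0\<^sub>v n \<and> M *\<^sub>v v = l \<cdot>\<^sub>v v \<and>
        (\<forall>x\<in>carrier_vec n. M *\<^sub>v x = l \<cdot>\<^sub>v x \<longrightarrow> P *\<^sub>v x = x \<and> (\<exists>c. x = c \<cdot>\<^sub>v v)))"

lemma smult_mat_mult_vec:
  "A \<in> carrier_mat n m \<Longrightarrow> x \<in> carrier_vec m \<Longrightarrow> (c \<cdot>\<^sub>m A) *\<^sub>v x = c \<cdot>\<^sub>v (A *\<^sub>v x)"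
  for A :: "'a::comm_ring_1 mat"
  by (rule eq_vecI) auto

lemma smult_smult_mat: "a \<cdot>\<^sub>m (b \<cdot>\<^sub>m A) = (a * b) \<cdot>\<^sub>m A" for A :: "'a::comm_ring_1 mat"
  by (rule eq_matI) (auto simp: mult.assoc)

lemma mult_mat_zero_vec: "A \<in> carrier_mat n m \<Longrightarrow> A *\<^sub>v 0\<^sub>v m = 0\<^sub>v n" for A :: "'a::comm_ring_1 mat"
  by (rule eq_vecI) auto

text \<open>Jacobi's formula for the derivative of the determinant of \<open>l - M\<close>, which is
  the matrix \<open>- char_matrix M l\<close>. A principal cofactor carries the sign +1, so it is
  the value at \<open>l\<close> of the characteristic polynomial of \<open>M\<close> with row and
  column \<open>i\<close> deleted.\<close>

lemma pderiv_char_poly_eq_trace_adj: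
  assumes M: "(M :: complex mat) \<in> carrier_mat n n"
  shows "poly (pderiv (char_poly M)) l = (\<Sum>i<n. cofactor (- char_matrix M l) i i)"
proof -
  have "poly (char_poly (mat_delete M i i)) l = cofactor (- char_matrix M l) i i" if "i < n" for i
  proof -
    have del: "mat_delete M i i \<in> carrier_mat (n - 1) (n - 1)"
      using mat_delete_carrier[OF M] .
    have "- char_matrix (mat_delete M i i) l = mat_delete (- char_matrix M l) i i"
      using M that by (intro eq_matI) (auto simp: mat_delete_def char_matrix_def)
    then show ?thesis
      using char_poly_matrix[OF del, of l] by (simp add: cofactor_def)
  qed
  then show ?thesis
    by (simp add: pderiv_char_poly[OF M] poly_sum)
qed

text \<open>Adding 1 to the \<open>i\<close>-th diagonal entry turns the determinant of a singular matrix into the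
  \<open>i\<close>-th principal cofactor.\<close>

lemma kernel_vec_zero_if_cofactor:
  assumes C: "(C :: complex mat) \<in> carrier_mat n n" "det C = 0" and i: "i < n" "cofactor C i i \<noteq> 0"
    and x: "x \<in> carrier_vec n" "C *\<^sub>v x = 0\<^sub>v n" "vec_index x i = 0"
  shows "x = 0\<^sub>v n"
proof (rule ccontr)
  assume "x \<noteq> 0\<^sub>v n"
  define C' where "C' = mat n n (\<lambda>(r, c). C $$ (r, c) + (if r = i \<and> c = i then 1 else 0))"
  have C': "C' \<in> carrier_mat n n"
    by (simp add: C'_def)
  have "mat_delete C' i j = mat_delete C i j" if "j < n" for j
    using C i that by (intro eq_matI) (auto simp: C'_def mat_delete_def)
  then have cof: "cofactor C' i j = cofactor C i j" if "j < n" for j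
    using that by (simp add: cofactor_def)
  have "det C' = (\<Sum>j<n. C' $$ (i, j) * cofactor C' i j)"
    using laplace_expansion_row[OF C' i(1)] .
  also have "\<dots> = (\<Sum>j<n. C $$ (i, j) * cofactor C i j) + (\<Sum>j<n. if j = i then cofactor C i i else 0)"
  proof -
    have "C' $$ (i, j) = C $$ (i, j) + (if j = i then 1 else 0)" if "j < n" for j
      using i that by (simp add: C'_def)
    then have "C' $$ (i, j) * cofactor C' i j = C $$ (i, j) * cofactor C i j + (if j = i then cofactor C i i else 0)"
      if "j < n" for j
      using that by (simp add: cof distrib_right)
    then show ?thesis
      by (subst sum.distrib[symmetric]) (auto intro!: sum.cong)
  qed
  also have "\<dots> = cofactor C i i"
    using laplace_expansion_row[OF C(1) i(1)] C(2) i by simp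
  finally have "det C' \<noteq> 0"
    using i by simp
  moreover have "C' *\<^sub>v x = 0\<^sub>v n"
  proof (rule eq_vecI)
    fix r assume "r < dim_vec (0\<^sub>v n :: complex vec)"
    then have r: "r < n" by simp
    have "(C' *\<^sub>v x) $ r = (\<Sum>c<n. C' $$ (r, c) * x $ c)"
      using C' x(1) r by (simp add: scalar_prod_def atLeast0LessThan)
    also have "\<dots> = (\<Sum>c<n. C $$ (r, c) * x $ c)"
      using r x(3) by (intro sum.cong) (auto simp: C'_def algebra_simps)
    also have "\<dots> = (C *\<^sub>v x) $ r"
      using C(1) x(1) r by (simp add: scalar_prod_def atLeast0LessThan)
    finally show "(C' *\<^sub>v x) $ r = 0\<^sub>v n $ r"
      using x(2) by simp
  qed (use C' in simp)
  ultimately show False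
    using det_0_iff_vec_prod_zero[OF C'] x(1) \<open>x \<noteq> 0\<^sub>v n\<close> by blast
qed

text \<open>The derivative at \<open>l\<close> is the trace \<open>t\<close> of the adjugate
  \<open>G\<close> of \<open>C = l - M\<close>. As it is nonzero, some principal cofactor is
  nonzero, and the kernel of \<open>C\<close> is a line spanned by some \<open>v\<close>. Every
  column of \<open>G\<close> lies on this line, so \<open>G\<close> is an outer product with trace
  \<open>t\<close>; hence \<open>G * G\<close> is \<open>t\<close> times \<open>G\<close>, and
  dividing by \<open>t\<close> yields the projection.\<close>

lemma simple_root_eigenprojection:
  assumes M: "M \<in> carrier_mat n n"
    and root: "poly (char_poly M) l = 0" "poly (pderiv (char_poly M)) l \<noteq> 0"
  shows "simple_eigenprojection n M l (inverse (poly (pderiv (char_poly M)) l) \<cdot>\<^sub>m adj_mat (- char_matrix M l))"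
proof -
  define C where "C = - char_matrix M l"
  define G where "G = adj_mat C"
  define t where "t = poly (pderiv (char_poly M)) l"
  have t0: "t \<noteq> 0"
    using root by (simp add: t_def)
  have C: "C \<in> carrier_mat n n"
    using M by (simp add: C_def)
  have det: "det C = 0"
    using root char_poly_matrix[OF M, of l] by (simp add: C_def)
  have "0 \<cdot>\<^sub>m 1\<^sub>m n = (0\<^sub>m n n :: complex mat)"
    by (rule eq_matI) auto
  \<comment> \<open>With \<open>det C = 0\<close> the adjugate identities become
    \<open>C * G = 0\<close> and \<open>G * C = 0\<close>.\<close>
  note G = adj_mat[OF C, folded G_def, unfolded det this]
  have CM: "C = l \<cdot>\<^sub>m 1\<^sub>m n - M"
    using M by (intro eq_matI) (auto simp: C_def char_matrix_def)
  have Cx: "C *\<^sub>v x = l \<cdot>\<^sub>v x - M *\<^sub>v x" if "x \<in> carrier_vec n" for x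
    using M that by (simp add: CM minus_mult_distrib_mat_vec[of _ n n] smult_mat_mult_vec[of _ n n])
  have kerC: "C *\<^sub>v x = 0\<^sub>v n \<longleftrightarrow> M *\<^sub>v x = l \<cdot>\<^sub>v x" if "x \<in> carrier_vec n" for x
    using M that by (auto simp: Cx vec_eq_iff)
  have tr: "t = (\<Sum>i<n. cofactor C i i)"
    by (simp add: t_def C_def pderiv_char_poly_eq_trace_adj[OF M])
  then obtain i where i: "i < n" "cofactor C i i \<noteq> 0"
    using t0 by (metis (no_types, lifting) lessThan_iff sum.neutral)
  obtain v where v: "v \<in> carrier_vec n" "v \<noteq> 0\<^sub>v n" "C *\<^sub>v v = 0\<^sub>v n"
    using det det_0_iff_vec_prod_zero[OF C] by auto
  have vi: "v $ i \<noteq> 0"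
    using kernel_vec_zero_if_cofactor[OF C det i v(1,3)] v(2) by auto
  have mult: "x = (x $ i / v $ i) \<cdot>\<^sub>v v" if x: "x \<in> carrier_vec n" "C *\<^sub>v x = 0\<^sub>v n" for x
  proof -
    define c where "c = x $ i / v $ i"
    have "x - c \<cdot>\<^sub>v v = 0\<^sub>v n"
    proof (rule kernel_vec_zero_if_cofactor[OF C det i])
      show "C *\<^sub>v (x - c \<cdot>\<^sub>v v) = 0\<^sub>v n"
        using C x v by (simp add: mult_minus_distrib_mat_vec[of _ n n] mult_mat_vec[of _ n n])
          (auto simp: vec_eq_iff)
      show "(x - c \<cdot>\<^sub>v v) $ i = 0"
        using x v i vi by (simp add: c_def)
    qed (use x v in simp)
    then have "(x - c \<cdot>\<^sub>v v) $ k = 0" if "k < n" for k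
      using that by simp
    then show ?thesis
      using x v by (intro eq_vecI) (auto simp: c_def)
  qed
  define g where "g = (\<lambda>k. col G k $ i / v $ i)"
  have Gent: "G $$ (r, k) = g k * v $ r" if "r < n" "k < n" for r k
  proof -
    have "C *\<^sub>v col G k = col (C * G) k"
      using that by (intro col_mult2[OF C G(1), symmetric])
    also have "\<dots> = 0\<^sub>v n"
      using G that by simp
    finally have "col G k = g k \<cdot>\<^sub>v v"
      unfolding g_def using G(1) that by (intro mult) auto
    then have "col G k $ r = (g k \<cdot>\<^sub>v v) $ r"
      by simp
    then show ?thesis
      using G(1) v that by simp
  qed
  have tg: "t = (\<Sum>k<n. g k * v $ k)"
    unfolding tr using Gent C by (intro sum.cong) (auto simp: G_def adj_mat_def)
  have GG: "G * G = t \<cdot>\<^sub>m G"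
  proof (rule eq_matI)
    fix r c assume "r < dim_row (t \<cdot>\<^sub>m G)" "c < dim_col (t \<cdot>\<^sub>m G)"
    then have rc: "r < n" "c < n"
      using G(1) by auto
    have "(G * G) $$ (r, c) = (\<Sum>k<n. G $$ (r, k) * G $$ (k, c))"
      using G(1) rc by (simp add: scalar_prod_def atLeast0LessThan)
    also have "\<dots> = (\<Sum>k<n. g k * v $ k) * (g c * v $ r)"
      unfolding sum_distrib_right using rc by (intro sum.cong) (auto simp: Gent)
    finally show "(G * G) $$ (r, c) = (t \<cdot>\<^sub>m G) $$ (r, c)"
      using G(1) rc by (simp add: tg Gent)
  qed (use G in auto)
  have Gx: "G *\<^sub>v x = t \<cdot>\<^sub>v x" if x: "x \<in> carrier_vec n" "C *\<^sub>v x = 0\<^sub>v n" for x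
  proof (rule eq_vecI)
    define c where "c = x $ i / v $ i"
    have "x = c \<cdot>\<^sub>v v"
      unfolding c_def by (rule mult[OF x])
    then have xk: "x $ k = c * v $ k" if "k < n" for k
      using v that by simp
    fix r assume "r < dim_vec (t \<cdot>\<^sub>v x)"
    then have r: "r < n"
      using x by simp
    have "(G *\<^sub>v x) $ r = (\<Sum>k<n. G $$ (r, k) * x $ k)"
      using G(1) x r by (simp add: scalar_prod_def atLeast0LessThan)
    also have "\<dots> = (\<Sum>k<n. g k * v $ k) * (c * v $ r)"
      unfolding sum_distrib_right using r by (intro sum.cong) (auto simp: Gent xk)
    finally show "(G *\<^sub>v x) $ r = (t \<cdot>\<^sub>v x) $ r"
      using x r by (simp add: tg xk)
  qed (use G x in simp)
  define P where "P = inverse t \<cdot>\<^sub>m G"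
  have P: "P \<in> carrier_mat n n"
    using G by (simp add: P_def)
  have PP: "P * P = P"
    unfolding P_def using G t0 GG
    by (simp add: mult_smult_assoc_mat[of _ n n _ n] mult_smult_distrib[of _ n n _ n] smult_smult_mat)
  have "l \<cdot>\<^sub>m G - M * G = 0\<^sub>m n n"
    using G(2) M G(1) by (simp add: CM minus_mult_distrib_mat[of _ n n _ _ n] mult_smult_assoc_mat[of _ n n _ n])
  then have MG: "M * G = l \<cdot>\<^sub>m G"
    using M G(1) by (auto simp: mat_eq_iff)
  have "l \<cdot>\<^sub>m G - G * M = 0\<^sub>m n n"
    using G(3) M G(1) by (simp add: CM mult_minus_distrib_mat[of _ n n _ n] mult_smult_distrib[of _ n n _ n])
  then have GM: "G * M = l \<cdot>\<^sub>m G"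
    using M G(1) by (auto simp: mat_eq_iff)
  have MP: "M * P = l \<cdot>\<^sub>m P" "P * M = l \<cdot>\<^sub>m P"
    unfolding P_def using G(1) M MG GM
    by (simp_all add: mult_smult_assoc_mat[of _ n n _ n] mult_smult_distrib[of _ n n _ n] smult_smult_mat mult.commute)
  have Px: "P *\<^sub>v x = x" if "x \<in> carrier_vec n" "C *\<^sub>v x = 0\<^sub>v n" for x
    unfolding P_def using Gx[OF that] that G(1) t0
    by (simp add: smult_mat_mult_vec[of _ n n] smult_smult_assoc)
  have "simple_eigenprojection n M l P"
    unfolding simple_eigenprojection_def
    using M P PP MP v Px mult by (auto simp: kerC intro!: bexI[of _ v])
  then show ?thesis
    by (simp add: P_def t_def G_def C_def)
qed

text \<open>\<open>P\<close> annihilates the range of \<open>C = M - l\<close> and fixes its kernel,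
  so a vector \<open>x\<close> with \<open>C C x = 0\<close> satisfies
  \<open>C x = P C x = 0\<close>. Hence there are no proper generalized eigenvectors, and the kernel
  of every positive power of \<open>C\<close> is the eigenline.\<close>

lemma simple_eigenprojection_is_eigenprojection:
  assumes "simple_eigenprojection n M l P"
  shows "is_eigenprojection M l P" "vec_space.rank n P = 1" "eigenvalue M l"
proof -
  from assms obtain v where M: "M \<in> carrier_mat n n" and P: "P \<in> carrier_mat n n" and PP: "P * P = P"
    and MP: "M * P = l \<cdot>\<^sub>m P" and PM: "P * M = l \<cdot>\<^sub>m P"
    and v: "v \<in> carrier_vec n" "v \<noteq> 0\<^sub>v n" "M *\<^sub>v v = l \<cdot>\<^sub>v v"
    and ker: "\<And>x. x \<in> carrier_vec n \<Longrightarrow> M *\<^sub>v x = l \<cdot>\<^sub>v x \<Longrightarrow> P *\<^sub>v x = x \<and> (\<exists>c. x = c \<cdot>\<^sub>v v)"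
    unfolding simple_eigenprojection_def by auto
  show "eigenvalue M l"
    using M v by (auto simp: eigenvalue_def eigenvector_def)
  define C where "C = char_matrix M l"
  have C: "C \<in> carrier_mat n n"
    using M by (simp add: C_def)
  have CM: "C = M - l \<cdot>\<^sub>m 1\<^sub>m n"
    using M by (intro eq_matI) (auto simp: C_def char_matrix_def)
  have Cx: "C *\<^sub>v x = M *\<^sub>v x - l \<cdot>\<^sub>v x" if "x \<in> carrier_vec n" for x
    using M that by (simp add: CM minus_mult_distrib_mat_vec[of _ n n] smult_mat_mult_vec[of _ n n])
  have kerC: "C *\<^sub>v x = 0\<^sub>v n \<longleftrightarrow> M *\<^sub>v x = l \<cdot>\<^sub>v x" if "x \<in> carrier_vec n" for x
    using M that by (auto simp: Cx vec_eq_iff)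
  have PC: "P *\<^sub>v (C *\<^sub>v x) = 0\<^sub>v n" if x: "x \<in> carrier_vec n" for x
  proof -
    have "P *\<^sub>v (M *\<^sub>v x) = l \<cdot>\<^sub>v (P *\<^sub>v x)"
      using assoc_mult_mat_vec[OF P M x] P x by (simp add: PM smult_mat_mult_vec[of _ n n])
    then show ?thesis
      using P M x by (simp add: Cx mult_minus_distrib_mat_vec[of _ n n] mult_mat_vec[of _ n n])
  qed
  have MPx: "M *\<^sub>v (P *\<^sub>v x) = l \<cdot>\<^sub>v (P *\<^sub>v x)" if x: "x \<in> carrier_vec n" for x
    using assoc_mult_mat_vec[OF M P x] P x by (simp add: MP smult_mat_mult_vec[of _ n n])
  have pow: "C ^\<^sub>m k *\<^sub>v x = 0\<^sub>v n \<Longrightarrow> C *\<^sub>v x = 0\<^sub>v n" if "x \<in> carrier_vec n" for k x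
    using that
  proof (induction k arbitrary: x)
    case 0
    then show ?case
      using C by (simp add: mult_mat_zero_vec[of _ n n])
  next
    case (Suc k)
    then have "C ^\<^sub>m k *\<^sub>v (C *\<^sub>v x) = 0\<^sub>v n"
      using C by (simp add: assoc_mult_mat_vec[of _ n n _ n])
    then have "C *\<^sub>v (C *\<^sub>v x) = 0\<^sub>v n"
      using Suc.IH[of "C *\<^sub>v x"] C Suc.prems by auto
    then have "P *\<^sub>v (C *\<^sub>v x) = C *\<^sub>v x"
      using kerC[of "C *\<^sub>v x"] ker[of "C *\<^sub>v x"] C Suc.prems by auto
    then show ?case
      using PC[of x] Suc.prems by simp
  qed
  \<comment> \<open>A positive exponent is needed for \<open>C ^\<^sub>m n\<close> to annihilate the
    eigenline.\<close>
  have "n \<noteq> 0"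
    using v by auto
  then obtain m where m: "n = Suc m"
    by (cases n) auto
  have "(\<lambda>v. P *\<^sub>v v) ` carrier_vec n = mat_kernel (C ^\<^sub>m n)"
  proof (intro equalityI subsetI)
    fix y assume "y \<in> (\<lambda>v. P *\<^sub>v v) ` carrier_vec n"
    then obtain x where x: "x \<in> carrier_vec n" "y = P *\<^sub>v x"
      by auto
    have y: "y \<in> carrier_vec n"
      using P x by simp
    have "C *\<^sub>v y = 0\<^sub>v n"
      using kerC[OF y] MPx x by simp
    then have "C ^\<^sub>m Suc m *\<^sub>v y = C ^\<^sub>m m *\<^sub>v 0\<^sub>v n"
      using C y by (simp add: assoc_mult_mat_vec[of _ n n _ n])
    also have "\<dots> = 0\<^sub>v n"
      using C by (intro mult_mat_zero_vec) auto
    finally show "y \<in> mat_kernel (C ^\<^sub>m n)"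
      using C y m by (simp add: mat_kernel_def)
  next
    fix x assume "x \<in> mat_kernel (C ^\<^sub>m n)"
    then have x: "x \<in> carrier_vec n" "C ^\<^sub>m n *\<^sub>v x = 0\<^sub>v n"
      using mat_kernelD[OF pow_carrier_mat[OF C]] by auto
    then have "P *\<^sub>v x = x"
      using pow[OF x] kerC[OF x(1)] ker[OF x(1)] by simp
    then show "x \<in> (\<lambda>v. P *\<^sub>v v) ` carrier_vec n"
      using x(1) by (metis imageI)
  qed
  then show "is_eigenprojection M l P"
    unfolding is_eigenprojection_def using M P PP MP PM by (simp add: C_def)
  have "\<exists>c. col P k = c \<cdot>\<^sub>v v" if "k < n" for k
  proof -
    have colP: "col P k = P *\<^sub>v unit_vec n k"
      using P that by (intro eq_vecI) auto
    show ?thesis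
      using ker[of "col P k"] MPx[of "unit_vec n k"] P unfolding colP by simp
  qed
  then obtain g where g: "\<And>k. k < n \<Longrightarrow> col P k = g k \<cdot>\<^sub>v v"
    by metis
  have "P $$ (r, k) = v $ r * g k" if "r < n" "k < n" for r k
  proof -
    have "P $$ (r, k) = col P k $ r"
      using P that by simp
    then show ?thesis
      using v that by (simp add: g)
  qed
  then have le: "vec_space.rank n P \<le> 1"
    using P by (intro vec_space.rank_le_1_product_entries[of P n n "\<lambda>r. v $ r" g]) auto
  have Pv: "P *\<^sub>v v = v"
    using ker v by simp
  \<comment> \<open>Lower bound for the rank: \<open>1 - P\<close> kills \<open>v\<close>, so its
    rank is below \<open>n\<close>, while the ranks of \<open>P\<close> and \<open>1 - P\<close> add
    up to at least \<open>n\<close>.\<close>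
  have "(1\<^sub>m n - P) *\<^sub>v v = 0\<^sub>v n"
    using P v Pv by (simp add: minus_mult_distrib_mat_vec[of _ n n])
  then have "det (1\<^sub>m n - P) = 0"
    using det_0_iff_vec_prod_zero[OF minus_carrier_mat[OF P, of "1\<^sub>m n"]] v by blast
  then have "vec_space.rank n (1\<^sub>m n - P) < n"
    using P by (intro vec_space.det_zero_low_rank) auto
  moreover have "vec_space.rank n (P + (1\<^sub>m n - P)) \<le> vec_space.rank n P + vec_space.rank n (1\<^sub>m n - P)"
    using P by (intro vec_space.rank_subadditive[of _ n n]) auto
  moreover have "P + (1\<^sub>m n - P) = 1\<^sub>m n"
    using P by (intro eq_matI) auto
  moreover have "vec_space.rank n (1\<^sub>m n :: complex mat) = n"
    using vec_space.det_rank_iff[of "1\<^sub>m n :: complex mat" n] by simp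
  ultimately show "vec_space.rank n P = 1"
    using le by simp
qed

lemma simple_eigenprojection_smult:
  assumes "simple_eigenprojection n M l P" "c \<noteq> 0"
  shows "simple_eigenprojection n (c \<cdot>\<^sub>m M) (c * l) P"
proof -
  from assms(1) obtain v where M: "M \<in> carrier_mat n n" and P: "P \<in> carrier_mat n n" and PP: "P * P = P"
    and MP: "M * P = l \<cdot>\<^sub>m P" and PM: "P * M = l \<cdot>\<^sub>m P"
    and v: "v \<in> carrier_vec n" "v \<noteq> 0\<^sub>v n" "M *\<^sub>v v = l \<cdot>\<^sub>v v"
    and ker: "\<And>x. x \<in> carrier_vec n \<Longrightarrow> M *\<^sub>v x = l \<cdot>\<^sub>v x \<Longrightarrow> P *\<^sub>v x = x \<and> (\<exists>c. x = c \<cdot>\<^sub>v v)"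
    unfolding simple_eigenprojection_def by auto
  have "(c \<cdot>\<^sub>m M) *\<^sub>v x = (c * l) \<cdot>\<^sub>v x \<longleftrightarrow> M *\<^sub>v x = l \<cdot>\<^sub>v x" if "x \<in> carrier_vec n" for x
    using M that \<open>c \<noteq> 0\<close> by (auto simp: vec_eq_iff smult_mat_mult_vec[of _ n n])
  moreover have "(c \<cdot>\<^sub>m M) * P = (c * l) \<cdot>\<^sub>m P" "P * (c \<cdot>\<^sub>m M) = (c * l) \<cdot>\<^sub>m P"
    using M P by (simp_all add: mult_smult_assoc_mat[of _ n n _ n] mult_smult_distrib[of _ n n _ n] MP PM smult_smult_mat)
  ultimately show ?thesis
    unfolding simple_eigenprojection_def using M P PP v ker by (auto intro!: bexI[of _ v])
qed

text \<open>The premise \<open>inv\<close> says that \<open>M\<close> is minus the inverse of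
  \<open>J * M' * J\<close>, so its eigenvectors are those of \<open>M'\<close> transported by
  \<open>J\<close>, with \<open>\<mu>\<close> replaced by its negative reciprocal.\<close>

lemma simple_eigenprojection_neg_inverse:
  assumes "simple_eigenprojection n M' \<mu> P" "\<mu> \<noteq> 0" and M: "M \<in> carrier_mat n n"
    and J: "J \<in> carrier_mat n n" "J * J = 1\<^sub>m n" and inv: "M * (J * M' * J) = - 1\<^sub>m n"
  shows "simple_eigenprojection n M (- inverse \<mu>) (J * P * J)"
proof -
  from assms(1) obtain v where M': "M' \<in> carrier_mat n n" and P: "P \<in> carrier_mat n n" and PP: "P * P = P"
    and MP: "M' * P = \<mu> \<cdot>\<^sub>m P" and PM: "P * M' = \<mu> \<cdot>\<^sub>m P"
    and v: "v \<in> carrier_vec n" "v \<noteq> 0\<^sub>v n" "M' *\<^sub>v v = \<mu> \<cdot>\<^sub>v v"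
    and ker: "\<And>x. x \<in> carrier_vec n \<Longrightarrow> M' *\<^sub>v x = \<mu> \<cdot>\<^sub>v x \<Longrightarrow> P *\<^sub>v x = x \<and> (\<exists>c. x = c \<cdot>\<^sub>v v)"
    unfolding simple_eigenprojection_def by auto
  define L where "L = J * M' * J"
  define Q where "Q = J * P * J"
  have L: "L \<in> carrier_mat n n" and Q: "Q \<in> carrier_mat n n"
    using J M' P by (auto simp: L_def Q_def intro!: mult_carrier_mat[of _ n n _ n])
  have conj: "(J * X * J) * (J * Y * J) = J * (X * Y) * J"
    if "X \<in> carrier_mat n n" "Y \<in> carrier_mat n n" for X Y
  proof -
    have "(J * X * J) * (J * Y * J) = J * X * (J * J) * Y * J"
      using J(1) that by (simp add: assoc_mult_mat[of _ n n _ n _ n] mult_carrier_mat[of _ n n _ n])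
    then show ?thesis
      using J that by (simp add: assoc_mult_mat[of _ n n _ n _ n] mult_carrier_mat[of _ n n _ n])
  qed
  have conj_smult: "J * (c \<cdot>\<^sub>m X) * J = c \<cdot>\<^sub>m (J * X * J)" if "X \<in> carrier_mat n n" for c X
    using J(1) that by (simp add: mult_smult_assoc_mat[of _ n n _ n] mult_smult_distrib[of _ n n _ n] mult_carrier_mat[of _ n n _ n])
  have QQ: "Q * Q = Q" and LQ: "L * Q = \<mu> \<cdot>\<^sub>m Q" and QL: "Q * L = \<mu> \<cdot>\<^sub>m Q"
    unfolding L_def Q_def using M' P by (simp_all add: conj PP MP PM conj_smult)
  have M_L: "M * L = - 1\<^sub>m n"
    using inv by (simp add: L_def)
  have negL: "- L \<in> carrier_mat n n"
    using L by simp
  have "M * (- L) = 1\<^sub>m n"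
    using M L M_L by simp
  then have "(- L) * M = 1\<^sub>m n"
    using mat_mult_left_right_inverse[OF M negL] by simp
  then have L_M: "L * M = - 1\<^sub>m n"
    using M L by (metis carrier_matD uminus_mult_left_mat uminus_uminus_mat)
  have "\<mu> \<cdot>\<^sub>m (M * Q) = M * L * Q"
    using M L Q by (simp add: assoc_mult_mat[of _ n n _ n _ n] LQ mult_smult_distrib[of _ n n _ n])
  also have "\<dots> = - Q"
    using Q by (simp add: M_L)
  finally have MQ: "M * Q = (- inverse \<mu>) \<cdot>\<^sub>m Q"
    using \<open>\<mu> \<noteq> 0\<close> M Q by (auto simp: mat_eq_iff field_simps)
  have "\<mu> \<cdot>\<^sub>m (Q * M) = Q * (L * M)"
    using M L Q by (simp add: assoc_mult_mat[of _ n n _ n _ n, symmetric] QL mult_smult_assoc_mat[of _ n n _ n])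
  also have "\<dots> = - Q"
    using Q by (simp add: L_M)
  finally have QM: "Q * M = (- inverse \<mu>) \<cdot>\<^sub>m Q"
    using \<open>\<mu> \<noteq> 0\<close> M Q by (auto simp: mat_eq_iff field_simps)
  have JJ: "J *\<^sub>v (J *\<^sub>v x) = x" if "x \<in> carrier_vec n" for x
    using J that by (simp flip: assoc_mult_mat_vec[of _ n n _ n])
  have Jc: "J *\<^sub>v x \<in> carrier_vec n" if "x \<in> carrier_vec n" for x
    using J that by simp
  have iff: "M *\<^sub>v x = (- inverse \<mu>) \<cdot>\<^sub>v x \<longleftrightarrow> M' *\<^sub>v (J *\<^sub>v x) = \<mu> \<cdot>\<^sub>v (J *\<^sub>v x)"
    if x: "x \<in> carrier_vec n" for x
  proof -
    have Lx: "L *\<^sub>v x = J *\<^sub>v (M' *\<^sub>v (J *\<^sub>v x))"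
      unfolding L_def using J M' x by (simp add: assoc_mult_mat_vec[of _ n n _ n] mult_carrier_mat[of _ n n _ n])
    have M_Lx: "M *\<^sub>v (L *\<^sub>v x) = - x" "L *\<^sub>v (M *\<^sub>v x) = - x"
      using M L x by (simp_all add: M_L L_M flip: assoc_mult_mat_vec[of _ n n _ n])
    show ?thesis
    proof
      assume "M *\<^sub>v x = (- inverse \<mu>) \<cdot>\<^sub>v x"
      then have "- x = (- inverse \<mu>) \<cdot>\<^sub>v (L *\<^sub>v x)"
        using M_Lx(2) L x by (simp add: mult_mat_vec[of _ n n])
      then have "L *\<^sub>v x = \<mu> \<cdot>\<^sub>v x"
        using \<open>\<mu> \<noteq> 0\<close> L x by (auto simp: vec_eq_iff field_simps)
      then have "J *\<^sub>v (L *\<^sub>v x) = \<mu> \<cdot>\<^sub>v (J *\<^sub>v x)"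
        using J x by (simp add: mult_mat_vec[of _ n n])
      then show "M' *\<^sub>v (J *\<^sub>v x) = \<mu> \<cdot>\<^sub>v (J *\<^sub>v x)"
        unfolding Lx using JJ M' Jc[OF x] by simp
    next
      assume "M' *\<^sub>v (J *\<^sub>v x) = \<mu> \<cdot>\<^sub>v (J *\<^sub>v x)"
      then have "L *\<^sub>v x = \<mu> \<cdot>\<^sub>v x"
        unfolding Lx using J x JJ by (simp add: mult_mat_vec[of _ n n])
      then have "\<mu> \<cdot>\<^sub>v (M *\<^sub>v x) = - x"
        using M_Lx(1) M x by (simp add: mult_mat_vec[of _ n n])
      then show "M *\<^sub>v x = (- inverse \<mu>) \<cdot>\<^sub>v x"
        using \<open>\<mu> \<noteq> 0\<close> M x by (auto simp: vec_eq_iff field_simps)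
    qed
  qed
  have "Q *\<^sub>v x = x \<and> (\<exists>c. x = c \<cdot>\<^sub>v (J *\<^sub>v v))"
    if x: "x \<in> carrier_vec n" "M *\<^sub>v x = (- inverse \<mu>) \<cdot>\<^sub>v x" for x
  proof -
    obtain c where c: "P *\<^sub>v (J *\<^sub>v x) = J *\<^sub>v x" "J *\<^sub>v x = c \<cdot>\<^sub>v v"
      using ker[OF Jc[OF x(1)]] iff[OF x(1)] x(2) by auto
    have "Q *\<^sub>v x = J *\<^sub>v (P *\<^sub>v (J *\<^sub>v x))"
      unfolding Q_def using J P x by (simp add: assoc_mult_mat_vec[of _ n n _ n] mult_carrier_mat[of _ n n _ n])
    then have "Q *\<^sub>v x = x"
      using c(1) JJ x by simp
    moreover have "x = c \<cdot>\<^sub>v (J *\<^sub>v v)"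
      using JJ[OF x(1)] c(2) J v by (simp add: mult_mat_vec[of _ n n])
    ultimately show ?thesis
      by blast
  qed
  moreover have "M *\<^sub>v (J *\<^sub>v v) = (- inverse \<mu>) \<cdot>\<^sub>v (J *\<^sub>v v)"
    using iff[OF Jc[OF v(1)]] JJ v by simp
  moreover have "J *\<^sub>v v \<noteq> 0\<^sub>v n"
  proof
    assume "J *\<^sub>v v = 0\<^sub>v n"
    then have "J *\<^sub>v (J *\<^sub>v v) = 0\<^sub>v n"
      using J by (simp add: mult_mat_zero_vec)
    then show False
      using JJ v by simp
  qed
  ultimately show ?thesis
    unfolding simple_eigenprojection_def Q_def[symmetric]
    using M Q QQ MQ QM Jc[OF v(1)] by (auto intro!: bexI[of _ "J *\<^sub>v v"])
qed

section \<open>Perturbation of simple eigenvalues in a linear pencil\<close>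

lemma set_eq_roots_prod_linear:
  "set es = {w. poly (\<Prod>e\<leftarrow>es. [:- e, 1:]) w = 0}" for es :: "complex list"
  by (induction es) auto

text \<open>A multiple root would occur several times in \<open>es\<close>, and all its copies would
  pass the filter. Hence \<open>e0\<close> occurs once, and the remaining factor \<open>q\<close>
  does not vanish there.\<close>

lemma unique_simple_root:
  fixes es :: "complex list"
  assumes "filter Q es = [e0]" "p = (\<Prod>e\<leftarrow>es. [:- e, 1:])"
  shows "poly p e0 = 0" "Q e0" "poly (pderiv p) e0 \<noteq> 0" "\<And>w. poly p w = 0 \<Longrightarrow> Q w \<Longrightarrow> w = e0"
proof -
  obtain ys zs where es: "es = ys @ e0 # zs" and ys: "\<forall>u\<in>set ys. \<not> Q u" and zs: "[] = filter Q zs" and "Q e0"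
    using assms(1) unfolding filter_eq_Cons_iff by blast
  show "Q e0" by fact
  have nin: "e0 \<notin> set ys" "e0 \<notin> set zs"
    using ys zs[symmetric] \<open>Q e0\<close> by (auto simp: filter_empty_conv)
  define q where "q = (\<Prod>e\<leftarrow>ys @ zs. [:- e, 1:])"
  have p: "p = [:- e0, 1:] * q"
    by (simp only: assms(2) es q_def map_append prod_list.append list.map prod_list.Cons mult.left_commute)
  show "poly p e0 = 0"
    by (simp add: p)
  have "poly q e0 \<noteq> 0"
    unfolding q_def using nin set_eq_roots_prod_linear[of "ys @ zs"] by auto
  then show "poly (pderiv p) e0 \<noteq> 0"
    unfolding p pderiv_mult by (simp add: pderiv_pCons)
  show "w = e0" if "poly p w = 0" "Q w" for w
  proof -
    have "w \<in> set (filter Q es)"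
      using that set_eq_roots_prod_linear[of es] assms(2) by auto
    then show ?thesis
      by (simp add: assms(1))
  qed
qed

text \<open>The perturbation argument sees the block matrices only through an orthogonal
  diagonalization of \<open>B\<close> and a norm bound for \<open>K\<close>. That both are real
  gives the conjugation symmetry of the roots at real parameters.\<close>

locale linear_pencil =
  fixes n :: nat and B K U :: "real mat" and d :: "nat \<Rightarrow> real" and \<omega> :: real
  assumes K: "K \<in> carrier_mat n n"
    and U: "U \<in> carrier_mat n n" "transpose_mat U * U = 1\<^sub>m n" "U * transpose_mat U = 1\<^sub>m n"
    and B: "B = U * mat_diag n d * transpose_mat U"
    and omega: "0 < \<omega>" "\<And>x. x \<in> carrier_vec n \<Longrightarrow> cnorm2 (cplx_mat K *\<^sub>v x) \<le> \<omega>\<^sup>2 * cnorm2 x"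
begin

definition T :: "complex \<Rightarrow> complex mat" where
  "T z = cplx_mat B + z \<cdot>\<^sub>m cplx_mat K"

lemma B_carrier: "B \<in> carrier_mat n n"
  using U by (simp add: B)

lemma T_carrier: "T z \<in> carrier_mat n n"
  using K B_carrier by (simp add: T_def)

lemma cplx_B:
  "cplx_mat B = cplx_mat U * mat_diag n (\<lambda>i. of_real (d i)) * mat_adjoint (cplx_mat U)"
  "cplx_mat U \<in> carrier_mat n n" "mat_adjoint (cplx_mat U) * cplx_mat U = 1\<^sub>m n"
proof -
  have adj: "mat_adjoint (cplx_mat U) = cplx_mat (transpose_mat U)"
    by (rule eq_matI) (auto simp: mat_adjoint_alt)
  have diag: "cplx_mat (mat_diag n d) = mat_diag n (\<lambda>i. of_real (d i))"
    by (rule eq_matI) (auto simp: mat_diag_def)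
  show "cplx_mat B = cplx_mat U * mat_diag n (\<lambda>i. of_real (d i)) * mat_adjoint (cplx_mat U)"
    unfolding adj diag[symmetric] B using U(1)
    by (simp add: of_real_hom.mat_hom_mult[of _ n n _ n])
  show "cplx_mat U \<in> carrier_mat n n"
    using U by simp
  have "cplx_mat (transpose_mat U * U) = 1\<^sub>m n"
    by (simp add: U(2) of_real_hom.mat_hom_one)
  then show "mat_adjoint (cplx_mat U) * cplx_mat U = 1\<^sub>m n"
    unfolding adj using U(1) by (simp add: of_real_hom.mat_hom_mult[of _ n n _ n])
qed

text \<open>An eigenvector \<open>x\<close> for \<open>w\<close> satisfies
  \<open>(B - w) x = - z K x\<close>, of norm at most \<open>cmod z * \<omega>\<close> times that of
  \<open>x\<close>. Since \<open>B - w\<close> is unitarily diagonalized with entries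
  \<open>d i - w\<close>, one of these must be that small.\<close>

lemma bauer_fike:
  assumes "poly (char_poly (T z)) w = 0"
  shows "\<exists>i<n. cmod (of_real (d i) - w) \<le> cmod z * \<omega>"
proof -
  define V where "V = cplx_mat U"
  note V = cplx_B(2,3)[folded V_def]
  have adjV: "mat_adjoint V \<in> carrier_mat n n"
    using V by simp
  have "eigenvalue (T z) w"
    using assms eigenvalue_root_char_poly[OF T_carrier] by simp
  then obtain x where x: "x \<in> carrier_vec n" "x \<noteq> 0\<^sub>v n" "T z *\<^sub>v x = w \<cdot>\<^sub>v x"
    using T_carrier[of z] by (auto simp: eigenvalue_def eigenvector_def)
  have "mat_diag n (\<lambda>i. of_real (d i) - w) = mat_diag n (\<lambda>i. of_real (d i)) - w \<cdot>\<^sub>m 1\<^sub>m n"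
    by (rule eq_matI) (auto simp: mat_diag_def)
  then have "V * mat_diag n (\<lambda>i. of_real (d i) - w) * mat_adjoint V = cplx_mat B - w \<cdot>\<^sub>m 1\<^sub>m n"
    unfolding cplx_B(1) V_def[symmetric] using V adjV mat_adjoint_eq_inverse[OF V]
    by (simp add: mult_minus_distrib_mat[of _ n n _ n] minus_mult_distrib_mat[of _ n n _ _ n]
        mult_smult_distrib[of _ n n _ n] mult_smult_assoc_mat[of _ n n _ n])
  moreover have "(cplx_mat B - w \<cdot>\<^sub>m 1\<^sub>m n) *\<^sub>v x = - z \<cdot>\<^sub>v (cplx_mat K *\<^sub>v x)"
  proof -
    have "cplx_mat B *\<^sub>v x + z \<cdot>\<^sub>v (cplx_mat K *\<^sub>v x) = w \<cdot>\<^sub>v x"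
      using x K B_carrier by (simp add: T_def add_mult_distrib_mat_vec[of _ n n] smult_mat_mult_vec[of _ n n])
    moreover have "(cplx_mat B - w \<cdot>\<^sub>m 1\<^sub>m n) *\<^sub>v x = cplx_mat B *\<^sub>v x - w \<cdot>\<^sub>v x"
      using x B_carrier by (simp add: minus_mult_distrib_mat_vec[of _ n n] smult_mat_mult_vec[of _ n n])
    ultimately show ?thesis
      using x K B_carrier by (auto simp: vec_eq_iff algebra_simps eq_neg_iff_add_eq_0)
  qed
  ultimately have "cnorm2 ((V * mat_diag n (\<lambda>i. of_real (d i) - w) * mat_adjoint V) *\<^sub>v x) \<le> (cmod z * \<omega>)\<^sup>2 * cnorm2 x"
    using mult_left_mono[OF omega(2)[OF x(1)], of "(cmod z)\<^sup>2"]
    by (simp add: cnorm2_smult power_mult_distrib mult.assoc)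
  then show ?thesis
    using cnorm2_diagonalization_lower_bound[OF V x(1,2)] omega(1) by simp
qed

text \<open>The characteristic polynomial of the pencil with \<open>z\<close> kept as an
  indeterminate. This is the two-variable shape that the holomorphy of parameter-dependent contour
  integrals asks for.\<close>

definition charp :: "complex poly poly" where
  "charp = char_poly (mat n n (\<lambda>(i, j). [:of_real (B $$ (i, j)), of_real (K $$ (i, j)):]))"

lemma char_poly_T: "char_poly (T z) = map_poly (\<lambda>c. poly c z) charp"
proof -
  have hom: "comm_ring_hom (\<lambda>c. poly c z)"
    by unfold_locales auto
  have "T z = map_mat (\<lambda>c. poly c z) (mat n n (\<lambda>(i, j). [:of_real (B $$ (i, j)), of_real (K $$ (i, j)):]))"
    using K B_carrier by (intro eq_matI) (auto simp: T_def)
  then show ?thesis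
    unfolding charp_def by (simp add: comm_ring_hom.char_poly_hom[OF hom, of _ n])
qed

text \<open>Two weights are used in the contour integral. Weight 1 counts the eigenvalues in the
  disc; the count is continuous with finitely many values, so it keeps the value 1 that it has at
  \<open>z = 0\<close>. Weight \<open>w\<close> then returns the single eigenvalue itself, which is
  therefore holomorphic. The radius is the bound below which \<open>cmod z * \<omega>\<close> is
  less than \<open>\<delta> / 2\<close>.\<close>

lemma simple_branch:
  assumes b: "\<exists>!i. i < n \<and> d i = b" and \<delta>: "0 < \<delta>" "\<And>i. i < n \<Longrightarrow> d i \<noteq> b \<Longrightarrow> \<delta> \<le> \<bar>d i - b\<bar>"
  obtains ev where "ev holomorphic_on ball 0 (\<delta> / (2 * \<omega>))"
    "\<And>z. z \<in> ball 0 (\<delta> / (2 * \<omega>)) \<Longrightarrow> poly (char_poly (T z)) (ev z) = 0"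
    "\<And>z. z \<in> ball 0 (\<delta> / (2 * \<omega>)) \<Longrightarrow> cmod (ev z - of_real b) < \<delta> / 2"
    "\<And>z. z \<in> ball 0 (\<delta> / (2 * \<omega>)) \<Longrightarrow> poly (pderiv (char_poly (T z))) (ev z) \<noteq> 0"
    "\<And>z w. z \<in> ball 0 (\<delta> / (2 * \<omega>)) \<Longrightarrow> poly (char_poly (T z)) w = 0 \<Longrightarrow>
       cmod (w - of_real b) < \<delta> / 2 \<Longrightarrow> w = ev z"
proof -
  define r where "r = \<delta> / (2 * \<omega>)"
  define \<rho> where "\<rho> = \<delta> / 2"
  define Q where "Q = (\<lambda>w. cmod (w - complex_of_real b) < \<rho>)"
  have \<rho>: "0 < \<rho>"
    using \<delta> by (simp add: \<rho>_def)
  have "\<exists>es. char_poly (T z) = (\<Prod>e\<leftarrow>es. [:- e, 1:])" for z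
    using char_poly_factorized[OF T_carrier] by auto
  then obtain es where es: "\<And>z. char_poly (T z) = (\<Prod>e\<leftarrow>es z. [:- e, 1:])"
    by metis
  have circle: "cmod (w - of_real b) \<noteq> \<rho>" if z: "z \<in> ball 0 r" and w: "poly (char_poly (T z)) w = 0" for z w
  proof
    assume eq: "cmod (w - of_real b) = \<rho>"
    obtain i where i: "i < n" and le: "cmod (of_real (d i) - w) \<le> cmod z * \<omega>"
      using bauer_fike[OF w] by auto
    note le
    also have "cmod z * \<omega> < r * \<omega>"
      using z omega by (intro mult_strict_right_mono) auto
    also have "r * \<omega> = \<rho>"
      using omega by (simp add: r_def \<rho>_def)
    finally have lt: "cmod (of_real (d i) - w) < \<rho>" .
    \<comment> \<open>\<open>w\<close> is at distance exactly \<open>\<rho>\<close> from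
      \<open>b\<close> but closer than that to \<open>d i\<close>; so \<open>d i\<close> is another
      diagonal entry, at least \<open>2 * \<rho>\<close> away from \<open>b\<close>, against the
      triangle inequality.\<close>
    then have "d i \<noteq> b"
      using eq by (auto simp: norm_minus_commute)
    then have "2 * \<rho> \<le> cmod (of_real (d i) - of_real b)"
      using \<delta>(2)[OF i] by (simp add: \<rho>_def flip: of_real_diff)
    also have "\<dots> \<le> cmod (of_real (d i) - w) + cmod (w - of_real b)"
      using norm_triangle_ineq[of "of_real (d i) - w" "w - of_real b"] by simp
    finally show False
      using lt eq by simp
  qed
  \<comment> \<open>By the residue theorem \<open>I f z\<close> is the sum of \<open>f\<close> over the eigenvalues of \<open>T z\<close> inside the circle.\<close>
  define I where "I = (\<lambda>f z. contour_integral (circlepath (of_real b) \<rho>)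
     (\<lambda>w. f w * poly (pderiv (char_poly (T z))) w / poly (char_poly (T z)) w) / (2 * of_real pi * \<i>))"
  have I: "I f z = (\<Sum>e\<leftarrow>filter Q (es z). f e)" if "f holomorphic_on UNIV" "z \<in> ball 0 r" for f z
  proof -
    have "cmod (e - of_real b) \<noteq> \<rho>" if "e \<in> set (es z)" for e
      using that circle[OF \<open>z \<in> ball 0 r\<close>] set_eq_roots_prod_linear[of "es z"] by (auto simp: es)
    from contour_integral_unique[OF circlepath_log_derivative_integral[OF that(1) \<rho> this es]]
    show ?thesis
      by (simp add: I_def Q_def)
  qed
  have hol: "I f holomorphic_on ball 0 r" if "f holomorphic_on UNIV" for f
    unfolding I_def char_poly_T map_poly_pderiv[symmetric] using that \<rho> circle
    by (intro holomorphic_intros circlepath_integral_quotient_holomorphic) (auto simp: char_poly_T)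
  have one: "(\<lambda>w::complex. 1) holomorphic_on UNIV" and id: "(\<lambda>w::complex. w) holomorphic_on UNIV"
    by (auto intro: holomorphic_intros)
  have count: "I (\<lambda>_. 1) z = of_nat (length (filter Q (es z)))" if "z \<in> ball 0 r" for z
    by (simp add: I[OF one that] sum_list_triv)
  have len: "length (es z) = n" for z
  proof -
    have "degree (char_poly (T z)) = length (es z)"
      using degree_linear_factors[of uminus "es z"] by (simp add: es)
    then show ?thesis
      using degree_monic_char_poly[OF T_carrier[of z]] by simp
  qed
  have "I (\<lambda>_. 1) ` ball 0 r \<subseteq> of_nat ` {..n}"
    using count len length_filter_le by (metis (no_types, lifting) atMost_iff image_eqI image_subsetI)
  then have "finite (I (\<lambda>_. 1) ` ball 0 r)"
    by (rule finite_subset) auto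
  then have "I (\<lambda>_. 1) constant_on ball 0 r"
    using hol[OF one] by (intro continuous_finite_range_constant) (auto intro: holomorphic_on_imp_continuous_on)
  then have const: "I (\<lambda>_. 1) z = I (\<lambda>_. 1) 0" if "z \<in> ball 0 r" for z
  proof -
    have "0 \<in> ball (0::complex) r"
      using \<delta>(1) omega(1) by (simp add: r_def)
    then show ?thesis
      using that \<open>I (\<lambda>_. 1) constant_on ball 0 r\<close> unfolding constant_on_def by metis
  qed
  have "length (filter Q (es 0)) = 1"
  proof -
    have T0: "T 0 = cplx_mat B"
      using K B_carrier by (intro eq_matI) (auto simp: T_def)
    have "char_poly (T 0) = (\<Prod>i<n. [:- complex_of_real (d i), 1:])"
      unfolding T0 cplx_B(1) using cplx_B(2,3) mat_adjoint_eq_inverse[OF cplx_B(2,3)]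
      by (intro char_poly_diagonalization) auto
    then have "(\<Sum>i<n. {#complex_of_real (d i)#}) = proots (\<Prod>e\<leftarrow>es 0. [:- e, 1:])"
      by (simp add: proots_prod flip: es)
    also have "proots (\<Prod>e\<leftarrow>xs. [:- e, 1:]) = mset xs" for xs :: "complex list"
    proof (induction xs)
      case (Cons a xs)
      have "(\<Prod>e\<leftarrow>xs. [:- e, 1:]) \<noteq> 0"
        by (auto simp: prod_list_zero_iff)
      then show ?case
        using Cons.IH proots_mult[of "[:- a, 1:]" "\<Prod>e\<leftarrow>xs. [:- e, 1:]"] by (simp del: mult_pCons_left)
    qed simp
    finally have "mset (es 0) = image_mset (\<lambda>i. complex_of_real (d i)) (mset_set {..<n})"
      by (simp add: sum_singleton_mset)
    then have "size (filter_mset Q (mset (es 0))) = card {i. i < n \<and> Q (of_real (d i))}"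
      by (simp add: filter_mset_image_mset)
    then have "length (filter Q (es 0)) = card {i. i < n \<and> Q (of_real (d i))}"
      by (simp only: size_mset flip: mset_filter)
    \<comment> \<open>Every other diagonal entry is at least \<open>\<delta>\<close>, twice the
      radius of the disc, away from \<open>b\<close>.\<close>
    also have "{i. i < n \<and> Q (of_real (d i))} = {i. i < n \<and> d i = b}"
      using \<delta> by (force simp: Q_def \<rho>_def simp flip: of_real_diff)
    also have "card \<dots> = 1"
    proof -
      obtain i where "{i. i < n \<and> d i = b} = {i}"
        using b by (elim ex1E) auto
      then show ?thesis
        by simp
    qed
    finally show ?thesis .
  qed
  then have one_root: "length (filter Q (es z)) = 1" if "z \<in> ball 0 r" for z
    using const[OF that] count[OF that] count[of 0] \<delta>(1) omega(1) by (simp add: r_def)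
  then have single: "filter Q (es z) = [I (\<lambda>w. w) z]" if z: "z \<in> ball 0 r" for z
  proof -
    obtain y where "filter Q (es z) = [y]"
      using one_root[OF z] by (auto simp: length_Suc_conv)
    then show ?thesis
      using I[OF id z] by simp
  qed
  show thesis
  proof (rule that[of "I (\<lambda>w. w)"], unfold r_def[symmetric] \<rho>_def[symmetric])
    show "I (\<lambda>w. w) holomorphic_on ball 0 r"
      by (rule hol[OF id])
    fix z :: complex assume z: "z \<in> ball 0 r"
    note root = unique_simple_root[OF single[OF z] es]
    show "poly (char_poly (T z)) (I (\<lambda>w. w) z) = 0" "poly (pderiv (char_poly (T z))) (I (\<lambda>w. w) z) \<noteq> 0"
      by (rule root)+
    show "cmod (I (\<lambda>w. w) z - of_real b) < \<rho>"
      using root(2) by (simp add: Q_def)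
    show "w = I (\<lambda>w. w) z" if "poly (char_poly (T z)) w = 0" "cmod (w - of_real b) < \<rho>" for w
      using root(4)[OF that(1)] that(2) by (simp add: Q_def)
  qed
qed

lemma real_root_cnj:
  assumes "poly (char_poly (T (of_real x))) w = 0"
  shows "poly (char_poly (T (of_real x))) (cnj w) = 0"
proof -
  have "T (of_real x) = cplx_mat (B + x \<cdot>\<^sub>m K)"
    using K B_carrier by (intro eq_matI) (auto simp: T_def)
  then have "char_poly (T (of_real x)) = map_poly of_real (char_poly (B + x \<cdot>\<^sub>m K))"
    using K B_carrier by (simp add: of_real_hom.char_poly_hom[of _ n])
  then have "\<And>i. coeff (char_poly (T (of_real x))) i \<in> \<real>"
    by (simp add: coeff_map_poly)
  then show ?thesis
    using assms by (simp add: real_poly_cnj_root_iff)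
qed

end

section \<open>Holomorphic dependence of determinants, adjugates and products on a parameter\<close>

lemma holomorphic_det:
  assumes "\<And>z. M z \<in> carrier_mat n n" "\<And>i j. i < n \<Longrightarrow> j < n \<Longrightarrow> (\<lambda>z. M z $$ (i, j)) holomorphic_on X"
  shows "(\<lambda>z. det (M z)) holomorphic_on X"
proof -
  have "(\<lambda>z. \<Sum>p | p permutes {0..<n}. signof p * (\<Prod>i = 0..<n. M z $$ (i, p i))) holomorphic_on X"
    using assms(2) by (intro holomorphic_intros) (auto dest: permutes_in_image)
  then show ?thesis
    using det_def'[OF assms(1)] by simp
qed

lemma holomorphic_adj_mat:
  assumes M: "\<And>z. M z \<in> carrier_mat n n" "\<And>i j. i < n \<Longrightarrow> j < n \<Longrightarrow> (\<lambda>z. M z $$ (i, j)) holomorphic_on X"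
    and ij: "i < n" "j < n"
  shows "(\<lambda>z. adj_mat (M z) $$ (i, j)) holomorphic_on X"
proof -
  have "(\<lambda>z. det (mat_delete (M z) j i)) holomorphic_on X"
  proof (rule holomorphic_det)
    show "mat_delete (M z) j i \<in> carrier_mat (n - 1) (n - 1)" for z
      using mat_delete_carrier[OF M(1)] .
    show "(\<lambda>z. mat_delete (M z) j i $$ (k, l)) holomorphic_on X" if "k < n - 1" "l < n - 1" for k l
      using M that by (simp add: mat_delete_def carrier_matD[OF M(1)])
  qed
  then have "(\<lambda>z. (- 1) ^ (j + i) * det (mat_delete (M z) j i)) holomorphic_on X"
    by (intro holomorphic_intros)
  then show ?thesis
    using ij by (simp add: adj_mat_def cofactor_def carrier_matD[OF M(1)])
qed

lemma holomorphic_mat_mult: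
  assumes "\<And>z. M z \<in> carrier_mat n n" "\<And>z. L z \<in> carrier_mat n n"
    and "\<And>i j. i < n \<Longrightarrow> j < n \<Longrightarrow> (\<lambda>z. M z $$ (i, j)) holomorphic_on X"
    and "\<And>i j. i < n \<Longrightarrow> j < n \<Longrightarrow> (\<lambda>z. L z $$ (i, j)) holomorphic_on X"
    and ij: "i < n" "j < n"
  shows "(\<lambda>z. (M z * L z) $$ (i, j)) holomorphic_on X"
proof -
  have "(M z * L z) $$ (i, j) = (\<Sum>k<n. M z $$ (i, k) * L z $$ (k, j))" for z
    using assms(1)[of z] assms(2)[of z] ij by (simp add: scalar_prod_def atLeast0LessThan)
  then show ?thesis
    using assms by (auto intro!: holomorphic_intros)
qed

context linear_pencil
begin

text \<open>The projection is the adjugate divided by its trace. The entries of the adjugate are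
  polynomial in \<open>ev z\<close> and the entries of \<open>T z\<close>, and the trace has no zero
  on \<open>X\<close>. Since the pencil is regular at \<open>z = 0\<close>, that point may belong to
  \<open>X\<close>.\<close>

lemma analytic_eigenprojection:
  assumes ev: "ev holomorphic_on X" and "\<And>z. z \<in> X \<Longrightarrow> poly (char_poly (T z)) (ev z) = 0"
    and nz: "\<And>z. z \<in> X \<Longrightarrow> poly (pderiv (char_poly (T z))) (ev z) \<noteq> 0"
  obtains P where "\<And>z. P z \<in> carrier_mat n n"
    "\<And>i k. i < n \<Longrightarrow> k < n \<Longrightarrow> (\<lambda>z. P z $$ (i, k)) holomorphic_on X"
    "\<And>z. z \<in> X \<Longrightarrow> simple_eigenprojection n (T z) (ev z) (P z)"
proof -
  define G where "G = (\<lambda>z. adj_mat (- char_matrix (T z) (ev z)))"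
  define t where "t = (\<lambda>z. poly (pderiv (char_poly (T z))) (ev z))"
  define P where "P = (\<lambda>z. inverse (t z) \<cdot>\<^sub>m G z)"
  have C: "- char_matrix (T z) (ev z) \<in> carrier_mat n n" for z
    using T_carrier[of z] by simp
  have Chol: "(\<lambda>z. (- char_matrix (T z) (ev z)) $$ (i, j)) holomorphic_on X" if "i < n" "j < n" for i j
  proof -
    have "(- char_matrix (T z) (ev z)) $$ (i, j) =
        (if i = j then ev z else 0) - (of_real (B $$ (i, j)) + z * of_real (K $$ (i, j)))" for z
      using that T_carrier[of z] K B_carrier by (auto simp: char_matrix_def T_def)
    then show ?thesis
      using ev by (cases "i = j") (auto intro!: holomorphic_intros)
  qed
  have G: "G z \<in> carrier_mat n n" for z
    unfolding G_def using adj_mat(1)[OF C] .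
  have Ghol: "(\<lambda>z. G z $$ (i, j)) holomorphic_on X" if "i < n" "j < n" for i j
    unfolding G_def using holomorphic_adj_mat[OF C Chol that] .
  \<comment> \<open>Written as the trace of \<open>G\<close>, the derivative of the characteristic
    polynomial inherits holomorphy from the entries.\<close>
  have "t = (\<lambda>z. \<Sum>i<n. G z $$ (i, i))"
  proof
    fix z
    have "G z $$ (i, i) = cofactor (- char_matrix (T z) (ev z)) i i" if "i < n" for i
      using C[of z] that unfolding G_def adj_mat_def by (metis (no_types, lifting) carrier_matD case_prod_conv index_mat(1))
    then show "t z = (\<Sum>i<n. G z $$ (i, i))"
      unfolding t_def pderiv_char_poly_eq_trace_adj[OF T_carrier] by simp
  qed
  then have thol: "t holomorphic_on X"
    using Ghol by (auto intro!: holomorphic_intros)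
  show thesis
  proof (rule that[of P])
    show "P z \<in> carrier_mat n n" for z
      using G[of z] by (simp add: P_def)
    show "(\<lambda>z. P z $$ (i, k)) holomorphic_on X" if "i < n" "k < n" for i k
    proof -
      have "(\<lambda>z. P z $$ (i, k)) = (\<lambda>z. inverse (t z) * G z $$ (i, k))"
        using carrier_matD[OF G] that by (simp add: P_def)
      moreover have "t z \<noteq> 0" if "z \<in> X" for z
        using nz[OF that] by (simp add: t_def)
      ultimately show ?thesis
        using holomorphic_on_mult[OF holomorphic_on_inverse[OF thol] Ghol[OF that]] by simp
    qed
    show "simple_eigenprojection n (T z) (ev z) (P z)" if "z \<in> X" for z
      unfolding P_def t_def G_def using simple_root_eigenprojection[OF T_carrier] assms(2,3)[OF that] .
  qed
qed

end

section \<open>Duality\<close>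

text \<open>Index 0 takes part in the minimum. The pair 0, 1 makes the set nonempty because
  \<open>0 < loss_rank R\<close>; pairs containing 0 have positive distance by \<open>nz\<close>,
  the others by \<open>inj\<close>.\<close>

lemma b_gap_props:
  assumes r: "0 < loss_rank R" and inj: "inj_on (b_val X R) {1..loss_rank R}"
    and nz: "\<And>k. 1 \<le> k \<Longrightarrow> k \<le> loss_rank R \<Longrightarrow> b_val X R k \<noteq> 0"
  shows "0 < b_gap X R"
    and "\<And>i j. i \<le> loss_rank R \<Longrightarrow> j \<le> loss_rank R \<Longrightarrow> i \<noteq> j \<Longrightarrow>
           b_gap X R \<le> \<bar>b_val X R i - b_val X R j\<bar>"
proof -
  define D where "D = {\<bar>b_val X R i - b_val X R j\<bar> | i j. i \<le> loss_rank R \<and> j \<le> loss_rank R \<and> i \<noteq> j}"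
  have gap: "b_gap X R = Min D"
    by (simp add: b_gap_def D_def)
  have "D \<subseteq> (\<lambda>(i, j). \<bar>b_val X R i - b_val X R j\<bar>) ` ({..loss_rank R} \<times> {..loss_rank R})"
    by (auto simp: D_def)
  then have fin: "finite D"
    by (rule finite_subset) auto
  have "\<bar>b_val X R 0 - b_val X R 1\<bar> \<in> D"
    unfolding D_def using r by force
  then have "Min D \<in> D"
    using fin by (intro Min_in) auto
  then obtain i j where ij: "i \<le> loss_rank R" "j \<le> loss_rank R" "i \<noteq> j"
    and min: "b_gap X R = \<bar>b_val X R i - b_val X R j\<bar>"
    by (auto simp: gap D_def)
  have "b_val X R i \<noteq> b_val X R j"
  proof (cases "i = 0 \<or> j = 0")
    case True
    have "b_val X R 0 = 0"
      by (simp add: b_val_def)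
    then show ?thesis
      using True ij nz[of i] nz[of j] by auto
  next
    case False
    then show ?thesis
      using ij inj_onD[OF inj, of i j] by auto
  qed
  then show "0 < b_gap X R"
    by (simp add: min)
  show "b_gap X R \<le> \<bar>b_val X R i - b_val X R j\<bar>" if "i \<le> loss_rank R" "j \<le> loss_rank R" "i \<noteq> j" for i j
    unfolding gap using that by (intro Min_le[OF fin]) (auto simp: D_def)
qed

text \<open>The assumptions are symmetric in \<open>\<alpha>\<close> and \<open>\<eta>\<close>
  except for \<open>inj_b\<close>, which concerns \<open>\<alpha>\<close> alone. Results that rely
  on duality therefore take the swapped instance
  \<open>loss_system N \<eta> \<alpha> \<theta> R\<close> as a premise.\<close>

locale loss_system =
  fixes N :: nat and \<alpha> \<eta> \<theta> R :: "real mat"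
  assumes N: "N \<ge> 1"
    and \<alpha>: "\<alpha> \<in> carrier_mat N N" "pos_def_mat \<alpha>"
    and \<eta>: "\<eta> \<in> carrier_mat N N" "pos_def_mat \<eta>"
    and \<theta>: "\<theta> \<in> carrier_mat N N" "transpose_mat \<theta> = - \<theta>"
    and R: "R \<in> carrier_mat N N" "pos_semidef_mat R" "0 < loss_rank R"
    and inj_b: "inj_on (b_val \<alpha> R) {1..loss_rank R}"
begin

definition K :: "real mat" where
  "K = four_block_mat (2 \<cdot>\<^sub>m (inv_sqrt \<alpha> * \<theta> * inv_sqrt \<alpha>)) (transpose_mat (Phi_mat \<alpha> \<eta>))
         (- Phi_mat \<alpha> \<eta>) (0\<^sub>m N N)"

definition J :: "complex mat" where
  "J = four_block_mat (0\<^sub>m N N) (1\<^sub>m N) (1\<^sub>m N) (0\<^sub>m N N)"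

abbreviation "W \<equiv> inv_sqrt \<alpha>"
abbreviation "S \<equiv> psd_sqrt \<alpha>"
abbreviation "\<Omega> \<equiv> Omega_mat \<alpha> \<eta> \<theta>"
abbreviation "\<omega> \<equiv> omega_max \<alpha> \<eta> \<theta>"

lemmas W = inv_sqrt[OF \<alpha>] and S = psd_sqrt[OF \<alpha>]
  and W\<eta> = inv_sqrt[OF \<eta>] and S\<eta> = psd_sqrt[OF \<eta>]

lemma Phi: "Phi_mat \<alpha> \<eta> \<in> carrier_mat N N"
  using S\<eta>(1) W(1) by (simp add: Phi_mat_def)

lemma K_carrier: "K \<in> carrier_mat (2 * N) (2 * N)"
  using Phi W(1) \<theta>(1) by (auto simp: K_def mult_2)

lemma J_carrier: "J \<in> carrier_mat (2 * N) (2 * N)"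
  by (auto simp: J_def mult_2)

lemma J_J: "J * J = 1\<^sub>m (2 * N)"
  unfolding J_def
  by (subst mult_four_block_mat[of _ N N _ N _ N _ _ N _ N]) (auto simp: intro!: eq_matI)

lemma K_skew: "transpose_mat K = - K"
proof -
  have "transpose_mat (W * \<theta> * W) = - (W * \<theta> * W)"
    using W \<theta> by (simp add: transpose_mult[of _ N N _ N] assoc_mult_mat[of _ N N _ N _ N])
  moreover have "transpose_mat (2 \<cdot>\<^sub>m L) = 2 \<cdot>\<^sub>m transpose_mat L" "2 \<cdot>\<^sub>m (- L) = - (2 \<cdot>\<^sub>m L)" for L :: "real mat"
    by (intro eq_matI; auto)+
  ultimately have skew: "transpose_mat (2 \<cdot>\<^sub>m (W * \<theta> * W)) = - (2 \<cdot>\<^sub>m (W * \<theta> * W))"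
    by metis
  have "transpose_mat K = four_block_mat (- (2 \<cdot>\<^sub>m (W * \<theta> * W))) (transpose_mat (- Phi_mat \<alpha> \<eta>)) (Phi_mat \<alpha> \<eta>) (0\<^sub>m N N)"
    unfolding K_def using Phi W \<theta> skew by (subst transpose_four_block_mat[of _ N N _ N _ N]) auto
  also have "\<dots> = - K"
    unfolding K_def using Phi W \<theta> by (intro eq_matI) auto
  finally show ?thesis .
qed

lemma Omega_eq: "\<Omega> = (- \<i>) \<cdot>\<^sub>m cplx_mat K"
  unfolding K_def Omega_mat_def using Phi W \<theta> \<alpha>(1)
  by (intro eq_matI) auto

lemma Omega_carrier: "\<Omega> \<in> carrier_mat (2 * N) (2 * N)"
  using K_carrier by (simp add: Omega_eq)

lemma Omega_hermitian: "mat_adjoint \<Omega> = \<Omega>"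
proof (rule eq_matI)
  fix i j assume "i < dim_row \<Omega>" "j < dim_col \<Omega>"
  then have ij: "i < 2 * N" "j < 2 * N"
    using Omega_carrier by auto
  then have "K $$ (j, i) = - K $$ (i, j)"
    using arg_cong[OF K_skew, of "\<lambda>M. M $$ (i, j)"] K_carrier by simp
  then show "mat_adjoint \<Omega> $$ (i, j) = \<Omega> $$ (i, j)"
    using ij K_carrier by (simp add: Omega_eq mat_adjoint_alt)
qed (use Omega_carrier in \<open>auto simp: mat_adjoint_alt\<close>)

lemma cnj_Omega: "map_mat cnj \<Omega> = - \<Omega>"
  using K_carrier by (intro eq_matI) (auto simp: Omega_eq)

lemma K_bound:
  assumes "x \<in> carrier_vec (2 * N)"
  shows "cnorm2 (cplx_mat K *\<^sub>v x) \<le> \<omega>\<^sup>2 * cnorm2 x"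
proof -
  have "\<Omega> *\<^sub>v x = (- \<i>) \<cdot>\<^sub>v (cplx_mat K *\<^sub>v x)"
    using K_carrier assms by (simp add: Omega_eq smult_mat_mult_vec[of _ "2 * N" "2 * N"])
  then have "cnorm2 (cplx_mat K *\<^sub>v x) = cnorm2 (\<Omega> *\<^sub>v x)"
    by (simp add: cnorm2_smult)
  then show ?thesis
    using hermitian_norm_bound(1)[OF Omega_carrier Omega_hermitian cnj_Omega assms]
    by (simp add: omega_max_def)
qed

abbreviation "A \<equiv> A_mat \<alpha> \<eta> \<theta> R"

lemma B_carrier: "B_mat \<alpha> R \<in> carrier_mat (2 * N) (2 * N)"
  using W R \<alpha> by (auto simp: B_mat_def mult_2)

lemma A_carrier: "A \<beta> \<in> carrier_mat (2 * N) (2 * N)"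
  unfolding A_mat_def using B_carrier by (intro minus_carrier_mat) simp

text \<open>The upper left block of \<open>A \<beta>\<close> stripped of a factor and of both copies
  of \<open>W\<close>. It involves neither \<open>\<alpha>\<close> nor \<open>\<eta>\<close> and so
  is common to the system and its dual.\<close>

definition M :: "complex \<Rightarrow> complex mat" where
  "M \<beta> = 2 \<cdot>\<^sub>m cplx_mat \<theta> + \<beta> \<cdot>\<^sub>m cplx_mat R"

lemma M_carrier: "M \<beta> \<in> carrier_mat N N"
  using \<theta> R by (simp add: M_def)

lemma A_block:
  "A \<beta> = four_block_mat ((- \<i>) \<cdot>\<^sub>m (cplx_mat W * M \<beta> * cplx_mat W)) ((- \<i>) \<cdot>\<^sub>m cplx_mat (transpose_mat (Phi_mat \<alpha> \<eta>)))
     (\<i> \<cdot>\<^sub>m cplx_mat (Phi_mat \<alpha> \<eta>)) (0\<^sub>m N N)"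
proof -
  have "cplx_mat W * M \<beta> * cplx_mat W = 2 \<cdot>\<^sub>m cplx_mat (W * \<theta> * W) + \<beta> \<cdot>\<^sub>m cplx_mat (W * R * W)"
    using W(1) \<theta>(1) R(1)
    by (simp add: M_def of_real_hom.mat_hom_mult[of _ N N _ N] mult_add_distrib_mat[of _ N N _ N]
        add_mult_distrib_mat[of _ N N _ _ N] mult_smult_distrib[of _ N N _ N] mult_smult_assoc_mat[of _ N N _ N])
  then show ?thesis
    unfolding A_mat_def Omega_mat_def B_mat_def using W(1) \<theta>(1) R(1) \<alpha>(1) Phi
    by (intro eq_matI) (auto simp: algebra_simps)
qed

end

lemma swap_conj_four_block:
  assumes "a \<in> carrier_mat N N" "b \<in> carrier_mat N N" "c \<in> carrier_mat N N" "d \<in> carrier_mat N N"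
  shows "four_block_mat (0\<^sub>m N N) (1\<^sub>m N) (1\<^sub>m N) (0\<^sub>m N N) * four_block_mat a b c d *
    four_block_mat (0\<^sub>m N N) (1\<^sub>m N) (1\<^sub>m N) (0\<^sub>m N N) = four_block_mat d c b (a :: complex mat)"
proof -
  have "four_block_mat (0\<^sub>m N N) (1\<^sub>m N) (1\<^sub>m N) (0\<^sub>m N N) * four_block_mat a b c d = four_block_mat c d a b"
    using assms by (subst mult_four_block_mat[of _ N N _ N _ N _ _ N _ N]) (auto simp: left_mult_zero_mat)
  moreover have "four_block_mat c d a b * four_block_mat (0\<^sub>m N N) (1\<^sub>m N) (1\<^sub>m N) (0\<^sub>m N N) = four_block_mat d c b a"
    using assms by (subst mult_four_block_mat[of _ N N _ N _ N _ _ N _ N]) (auto simp: left_mult_zero_mat)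
  ultimately show ?thesis
    by simp
qed

context loss_system
begin

lemma Phi_dual: "Phi_mat \<alpha> \<eta> * Phi_mat \<eta> \<alpha> = 1\<^sub>m N" "Phi_mat \<eta> \<alpha> * Phi_mat \<alpha> \<eta> = 1\<^sub>m N"
proof -
  have "Phi_mat \<alpha> \<eta> * Phi_mat \<eta> \<alpha> = psd_sqrt \<eta> * (W * S) * inv_sqrt \<eta>"
    using W(1) S(1) W\<eta>(1) S\<eta>(1) by (simp add: Phi_mat_def assoc_mult_mat[of _ N N _ N _ N])
  then show "Phi_mat \<alpha> \<eta> * Phi_mat \<eta> \<alpha> = 1\<^sub>m N"
    using S\<eta>(1) by (simp add: W(2) W\<eta>(3))
  have "Phi_mat \<eta> \<alpha> * Phi_mat \<alpha> \<eta> = S * (inv_sqrt \<eta> * psd_sqrt \<eta>) * W"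
    using W(1) S(1) W\<eta>(1) S\<eta>(1) by (simp add: Phi_mat_def assoc_mult_mat[of _ N N _ N _ N])
  then show "Phi_mat \<eta> \<alpha> * Phi_mat \<alpha> \<eta> = 1\<^sub>m N"
    using S(1) by (simp add: W(3) W\<eta>(2))
qed

text \<open>The system and its dual share the middle matrix \<open>M \<beta>\<close>. In the block
  product the upper right block is \<open>G * \<psi> - \<phi>t * G'\<close>, and both terms reduce
  to \<open>w * M \<beta> * w'\<close> once square roots cancel; the diagonal blocks are minus the
  products of the mutually inverse pairs \<open>\<phi>t\<close>, \<open>\<psi>t\<close> and
  \<open>\<phi>\<close>, \<open>\<psi>\<close>.\<close>

lemma A_dual:
  assumes dual: "loss_system N \<eta> \<alpha> \<theta> R"
  shows "A \<beta> * (J * A_mat \<eta> \<alpha> \<theta> R \<beta> * J) = - 1\<^sub>m (2 * N)"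
proof -
  interpret dual: loss_system N \<eta> \<alpha> \<theta> R by (rule dual)
  define w where "w = cplx_mat W"
  define w' where "w' = cplx_mat (inv_sqrt \<eta>)"
  define s where "s = cplx_mat (psd_sqrt \<alpha>)"
  define s' where "s' = cplx_mat (psd_sqrt \<eta>)"
  define \<phi> where "\<phi> = cplx_mat (Phi_mat \<alpha> \<eta>)"
  define \<psi> where "\<psi> = cplx_mat (Phi_mat \<eta> \<alpha>)"
  define \<phi>t where "\<phi>t = cplx_mat (transpose_mat (Phi_mat \<alpha> \<eta>))"
  define \<psi>t where "\<psi>t = cplx_mat (transpose_mat (Phi_mat \<eta> \<alpha>))"
  define G where "G = w * M \<beta> * w"
  define G' where "G' = w' * M \<beta> * w'"
  have carrier: "w \<in> carrier_mat N N" "w' \<in> carrier_mat N N" "s \<in> carrier_mat N N" "s' \<in> carrier_mat N N"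
    "\<phi> \<in> carrier_mat N N" "\<psi> \<in> carrier_mat N N" "\<phi>t \<in> carrier_mat N N" "\<psi>t \<in> carrier_mat N N"
    using W(1) W\<eta>(1) S(1) S\<eta>(1) Phi dual.Phi
    by (simp_all add: w_def w'_def s_def s'_def \<phi>_def \<psi>_def \<phi>t_def \<psi>t_def)
  have G: "G \<in> carrier_mat N N" "G' \<in> carrier_mat N N"
    using carrier M_carrier by (simp_all add: G_def G'_def)
  have hom: "cplx_mat (X * Y) = cplx_mat X * cplx_mat Y" if "X \<in> carrier_mat N N" "Y \<in> carrier_mat N N" for X Y
    using that by (rule of_real_hom.mat_hom_mult)
  have ws: "w * s = 1\<^sub>m N" and sw': "s' * w' = 1\<^sub>m N"
    using hom[OF W(1) S(1)] hom[OF S\<eta>(1) W\<eta>(1)]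
    by (simp_all add: w_def s_def s'_def w'_def W(2) W\<eta>(3) of_real_hom.mat_hom_one)
  have \<psi>: "\<psi> = s * w'"
    using hom[OF S(1) W\<eta>(1)] by (simp add: \<psi>_def Phi_mat_def s_def w'_def)
  have \<phi>t: "\<phi>t = w * s'"
    using hom[OF W(1) S\<eta>(1)] transpose_mult[OF S\<eta>(1) W(1)]
    by (simp add: \<phi>t_def Phi_mat_def w_def s'_def W(4) S\<eta>(2))
  have \<phi>\<psi>: "\<phi> * \<psi> = 1\<^sub>m N"
    using hom[OF Phi dual.Phi] by (simp add: \<phi>_def \<psi>_def Phi_dual of_real_hom.mat_hom_one)
  have "transpose_mat (Phi_mat \<alpha> \<eta>) * transpose_mat (Phi_mat \<eta> \<alpha>) = 1\<^sub>m N"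
    using transpose_mult[OF dual.Phi Phi] by (simp add: Phi_dual)
  then have \<phi>\<psi>t: "\<phi>t * \<psi>t = 1\<^sub>m N"
    using hom[of "transpose_mat (Phi_mat \<alpha> \<eta>)" "transpose_mat (Phi_mat \<eta> \<alpha>)"] Phi dual.Phi
    by (simp add: \<phi>t_def \<psi>t_def of_real_hom.mat_hom_one)
  have "G * \<psi> = w * M \<beta> * (w * s) * w'"
    using carrier M_carrier by (simp add: G_def \<psi> assoc_mult_mat[of _ N N _ N _ N])
  then have G\<psi>: "G * \<psi> = w * M \<beta> * w'"
    using carrier M_carrier by (simp add: ws right_mult_one_mat[of _ N N])
  have "\<phi>t * G' = w * (s' * w') * M \<beta> * w'"
    using carrier M_carrier by (simp add: G'_def \<phi>t assoc_mult_mat[of _ N N _ N _ N])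
  then have \<phi>G: "\<phi>t * G' = w * M \<beta> * w'"
    using carrier M_carrier by (simp add: sw' right_mult_one_mat[of _ N N])
  have A: "A \<beta> = four_block_mat ((- \<i>) \<cdot>\<^sub>m G) ((- \<i>) \<cdot>\<^sub>m \<phi>t) (\<i> \<cdot>\<^sub>m \<phi>) (0\<^sub>m N N)"
    unfolding A_block by (simp add: G_def w_def \<phi>t_def \<phi>_def)
  have A': "J * A_mat \<eta> \<alpha> \<theta> R \<beta> * J =
      four_block_mat (0\<^sub>m N N) (\<i> \<cdot>\<^sub>m \<psi>) ((- \<i>) \<cdot>\<^sub>m \<psi>t) ((- \<i>) \<cdot>\<^sub>m G')"
    unfolding dual.A_block J_def
    using carrier G
    by (subst swap_conj_four_block) (simp_all add: G'_def w'_def \<psi>t_def \<psi>_def dual.M_def M_def)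
  have one: "- 1\<^sub>m (2 * N) = four_block_mat (- 1\<^sub>m N) (0\<^sub>m N N) (0\<^sub>m N N) (- 1\<^sub>m N :: complex mat)"
    by (rule eq_matI) auto
  have smult: "(a \<cdot>\<^sub>m X) * (b \<cdot>\<^sub>m Y) = (a * b) \<cdot>\<^sub>m (X * Y)"
    if "X \<in> carrier_mat N N" "Y \<in> carrier_mat N N" for a b :: complex and X Y
    using that by (simp add: mult_smult_assoc_mat[of _ N N _ N] mult_smult_distrib[of _ N N _ N] smult_smult_mat mult.commute)
  have neg: "(- 1) \<cdot>\<^sub>m X = - X" for X :: "complex mat"
    by (rule eq_matI) auto
  have block11: "((- \<i>) \<cdot>\<^sub>m G) * 0\<^sub>m N N + ((- \<i>) \<cdot>\<^sub>m \<phi>t) * ((- \<i>) \<cdot>\<^sub>m \<psi>t) = - 1\<^sub>m N"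
    using carrier G by (simp add: smult \<phi>\<psi>t neg)
  have block12: "((- \<i>) \<cdot>\<^sub>m G) * (\<i> \<cdot>\<^sub>m \<psi>) + ((- \<i>) \<cdot>\<^sub>m \<phi>t) * ((- \<i>) \<cdot>\<^sub>m G') = 0\<^sub>m N N"
    using carrier G M_carrier by (simp add: smult G\<psi> \<phi>G neg) (auto intro!: eq_matI)
  have block21: "(\<i> \<cdot>\<^sub>m \<phi>) * 0\<^sub>m N N + 0\<^sub>m N N * ((- \<i>) \<cdot>\<^sub>m \<psi>t) = 0\<^sub>m N N"
    using carrier by (simp add: left_mult_zero_mat)
  have block22: "(\<i> \<cdot>\<^sub>m \<phi>) * (\<i> \<cdot>\<^sub>m \<psi>) + 0\<^sub>m N N * ((- \<i>) \<cdot>\<^sub>m G') = - 1\<^sub>m N"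
    using carrier G by (simp add: smult \<phi>\<psi> neg left_mult_zero_mat)
  show ?thesis
  proof -
    have "A \<beta> * (J * A_mat \<eta> \<alpha> \<theta> R \<beta> * J) = four_block_mat
        (((- \<i>) \<cdot>\<^sub>m G) * 0\<^sub>m N N + ((- \<i>) \<cdot>\<^sub>m \<phi>t) * ((- \<i>) \<cdot>\<^sub>m \<psi>t))
        (((- \<i>) \<cdot>\<^sub>m G) * (\<i> \<cdot>\<^sub>m \<psi>) + ((- \<i>) \<cdot>\<^sub>m \<phi>t) * ((- \<i>) \<cdot>\<^sub>m G'))
        ((\<i> \<cdot>\<^sub>m \<phi>) * 0\<^sub>m N N + 0\<^sub>m N N * ((- \<i>) \<cdot>\<^sub>m \<psi>t))
        ((\<i> \<cdot>\<^sub>m \<phi>) * (\<i> \<cdot>\<^sub>m \<psi>) + 0\<^sub>m N N * ((- \<i>) \<cdot>\<^sub>m G'))"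
      unfolding A A' using carrier G by (intro mult_four_block_mat) auto
    then show ?thesis
      unfolding block11 block12 block21 block22 one .
  qed
qed

end

text \<open>By the product and chain rules, the term with the derivative of \<open>k\<close> drops
  out because \<open>q\<close> vanishes at \<open>m l\<close>, and the remaining term is a product
  of nonzero factors. It serves for a scaling and for the negative reciprocal.\<close>

lemma simple_root_transfer:
  fixes p q :: "complex poly"
  assumes eq: "\<And>x. x \<in> X \<Longrightarrow> poly p x = k x * poly q (m x)" and X: "open X" "l \<in> X"
    and k: "(k has_field_derivative k') (at l)" "k l \<noteq> 0"
    and m: "(m has_field_derivative m') (at l)" "m' \<noteq> 0"
    and q: "poly q (m l) = 0" "poly (pderiv q) (m l) \<noteq> 0"
  shows "poly p l = 0" "poly (pderiv p) l \<noteq> 0"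
proof -
  show "poly p l = 0"
    using eq X(2) q(1) by simp
  have "((\<lambda>x. poly q (m x)) has_field_derivative poly (pderiv q) (m l) * m') (at l)"
    using DERIV_chain2[OF poly_DERIV m(1)] .
  from DERIV_mult[OF k(1) this]
  have "((\<lambda>x. k x * poly q (m x)) has_field_derivative poly (pderiv q) (m l) * m' * k l) (at l)"
    by (simp add: q(1))
  then have "(poly p has_field_derivative poly (pderiv q) (m l) * m' * k l) (at l)"
    by (rule has_field_derivative_transform_within_open[OF _ X]) (simp add: eq)
  then have "poly (pderiv p) l = poly (pderiv q) (m l) * m' * k l"
    by (rule DERIV_unique[OF poly_DERIV])
  then show "poly (pderiv p) l \<noteq> 0"
    using k m q by simp
qed

lemma order_eq_1_if_simple_root:
  fixes p :: "complex poly"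
  assumes "poly p l = 0" "poly (pderiv p) l \<noteq> 0"
  shows "Polynomial.order l p = 1"
proof -
  have "p \<noteq> 0" "pderiv p \<noteq> 0"
    using assms by auto
  moreover have "Polynomial.order l (pderiv p) = 0"
    using assms by (simp add: order_0I)
  moreover have "Polynomial.order l p \<noteq> 0"
    using assms(1) \<open>p \<noteq> 0\<close> by (simp add: order_root)
  ultimately show ?thesis
    using order_pderiv[of p l] assms(1) by simp
qed

lemma char_poly_eval_det:
  assumes "(M :: complex mat) \<in> carrier_mat n n"
  shows "poly (char_poly M) x = det (x \<cdot>\<^sub>m 1\<^sub>m n - M)"
proof -
  have "- char_matrix M x = x \<cdot>\<^sub>m 1\<^sub>m n - M"
    using assms by (intro eq_matI) (auto simp: char_matrix_def)
  then show ?thesis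
    using char_poly_matrix[OF assms, of x] by simp
qed

lemma simple_root_smult:
  assumes M: "(M :: complex mat) \<in> carrier_mat n n" and "c \<noteq> 0"
    and root: "poly (char_poly M) l = 0" "poly (pderiv (char_poly M)) l \<noteq> 0"
  shows "poly (char_poly (c \<cdot>\<^sub>m M)) (c * l) = 0" "poly (pderiv (char_poly (c \<cdot>\<^sub>m M))) (c * l) \<noteq> 0"
proof -
  have eq: "poly (char_poly (c \<cdot>\<^sub>m M)) x = c ^ n * poly (char_poly M) (x / c)" for x
  proof -
    have "x \<cdot>\<^sub>m 1\<^sub>m n - c \<cdot>\<^sub>m M = c \<cdot>\<^sub>m ((x / c) \<cdot>\<^sub>m 1\<^sub>m n - M)"
      using M \<open>c \<noteq> 0\<close> by (intro eq_matI) (auto simp: field_simps)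
    then show ?thesis
      using M by (simp add: char_poly_eval_det[of _ n])
  qed
  have "((\<lambda>x. x / c) has_field_derivative 1 / c) (at (c * l))"
    by (rule DERIV_cdivide) (rule DERIV_ident)
  then show "poly (char_poly (c \<cdot>\<^sub>m M)) (c * l) = 0" "poly (pderiv (char_poly (c \<cdot>\<^sub>m M))) (c * l) \<noteq> 0"
    using root \<open>c \<noteq> 0\<close> simple_root_transfer[of UNIV "char_poly (c \<cdot>\<^sub>m M)" "\<lambda>_. c ^ n" "char_poly M" "\<lambda>x. x / c" "c * l" 0 "1 / c"]
    by (simp_all add: eq)
qed

text \<open>With \<open>L = J * M' * J\<close> one has
  \<open>(x - M) * L = x L + 1 = J * (1 + x M') * J\<close>, and \<open>1 + x M'\<close> is
  \<open>- x\<close> times \<open>- 1/x - M'\<close>. Determinants express the characteristic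
  polynomial of \<open>M\<close> at \<open>x \<noteq> 0\<close> as \<open>(- x)^n / det L\<close>
  times that of \<open>M'\<close> at \<open>- 1/x\<close>, which transports algebraic
  simplicity.\<close>

lemma simple_root_neg_inverse:
  fixes M M' J :: "complex mat"
  assumes M: "M \<in> carrier_mat n n" and M': "M' \<in> carrier_mat n n" and J: "J \<in> carrier_mat n n" "J * J = 1\<^sub>m n"
    and inv: "M * (J * M' * J) = - 1\<^sub>m n" and \<mu>: "\<mu> \<noteq> 0"
    and root: "poly (char_poly M') \<mu> = 0" "poly (pderiv (char_poly M')) \<mu> \<noteq> 0"
  shows "poly (char_poly M) (- inverse \<mu>) = 0" "poly (pderiv (char_poly M)) (- inverse \<mu>) \<noteq> 0"
proof -
  define L where "L = J * M' * J"
  have L: "L \<in> carrier_mat n n"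
    using J M' by (auto simp: L_def intro!: mult_carrier_mat[of _ n n _ n])
  have "det M * det L = (- 1) ^ n"
  proof -
    have "M * L = (- 1) \<cdot>\<^sub>m 1\<^sub>m n"
      using inv by (auto simp: L_def mat_eq_iff)
    then have "det (M * L) = (- 1) ^ n"
      by simp
    then show ?thesis
      by (simp add: det_mult[OF M L])
  qed
  then have "det M * det L \<noteq> 0"
    by simp
  then have detL: "det L \<noteq> 0"
    by simp
  have eq: "poly (char_poly M) x = (- x) ^ n / det L * poly (char_poly M') (- inverse x)" if "x \<noteq> 0" for x
  proof -
    define Y where "Y = (- inverse x) \<cdot>\<^sub>m 1\<^sub>m n - M'"
    have Y: "Y \<in> carrier_mat n n"
      using M' by (auto simp: Y_def)
    have "J * ((- x) \<cdot>\<^sub>m Y) * J = x \<cdot>\<^sub>m L + 1\<^sub>m n"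
    proof -
      have "(- x) \<cdot>\<^sub>m Y = 1\<^sub>m n + x \<cdot>\<^sub>m M'"
        using M' that by (intro eq_matI) (auto simp: Y_def field_simps)
      then have "J * ((- x) \<cdot>\<^sub>m Y) * J = J * J + x \<cdot>\<^sub>m L"
        using J(1) M' by (simp add: L_def mult_add_distrib_mat[of _ n n _ n] add_mult_distrib_mat[of _ n n _ _ n]
            mult_smult_distrib[of _ n n _ n] mult_smult_assoc_mat[of _ n n _ n])
      then show ?thesis
        using L by (simp add: J(2) comm_add_mat[of _ n n])
    qed
    also have "\<dots> = (x \<cdot>\<^sub>m 1\<^sub>m n - M) * L"
    proof -
      have "(x \<cdot>\<^sub>m 1\<^sub>m n - M) * L = x \<cdot>\<^sub>m L - M * L"
        using M L by (simp add: minus_mult_distrib_mat[of _ n n _ _ n] mult_smult_assoc_mat[of _ n n _ n])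
      then show ?thesis
        using inv L by (auto simp: mat_eq_iff simp flip: L_def)
    qed
    finally have "det (J * ((- x) \<cdot>\<^sub>m Y) * J) = det (x \<cdot>\<^sub>m 1\<^sub>m n - M) * det L"
      using M L by (simp add: det_mult[OF minus_carrier_mat[OF M] L])
    moreover have "det (J * ((- x) \<cdot>\<^sub>m Y) * J) = det J * det J * ((- x) ^ n * det Y)"
      using J(1) Y by (simp add: det_mult[of _ n])
    moreover have "det J * det J = 1"
      using det_mult[OF J(1) J(1)] by (simp add: J(2))
    ultimately have "det (x \<cdot>\<^sub>m 1\<^sub>m n - M) * det L = (- x) ^ n * det Y"
      by simp
    then show ?thesis
      using detL by (simp add: char_poly_eval_det[OF M] char_poly_eval_det[OF M'] Y_def field_simps)
  qed
  define l where "l = - inverse \<mu>"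
  have l: "l \<noteq> 0" "- inverse l = \<mu>"
    using \<mu> by (auto simp: l_def)
  have k: "((\<lambda>x. (- x) ^ n / det L) has_field_derivative of_nat n * (- l) ^ (n - 1) * (- 1) / det L) (at l)"
    using detL by (auto intro!: derivative_eq_intros)
  have m: "((\<lambda>x. - inverse x) has_field_derivative inverse l * inverse l) (at l)"
    using l by (auto intro!: derivative_eq_intros simp: power2_eq_square)
  have "poly (char_poly M) l = 0 \<and> poly (pderiv (char_poly M)) l \<noteq> 0"
    using simple_root_transfer[of "- {0}" "char_poly M" "\<lambda>x. (- x) ^ n / det L" "char_poly M'" "\<lambda>x. - inverse x" l, OF eq _ _ k _ m]
      l detL root open_Compl[OF closed_singleton[of "0::complex"]] by simp
  then show "poly (char_poly M) (- inverse \<mu>) = 0" "poly (pderiv (char_poly M)) (- inverse \<mu>) \<noteq> 0"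
    by (simp_all add: l_def)
qed

text \<open>The passage in the other direction, from an eigenvalue of \<open>M\<close> to one of
  \<open>M'\<close>, needed to start from a given low-loss series. \<open>l = 0\<close> is
  impossible because \<open>inv\<close> makes \<open>M\<close> invertible.\<close>

lemma eigenvalue_neg_inverse:
  fixes M M' J :: "complex mat"
  assumes M: "M \<in> carrier_mat n n" and M': "M' \<in> carrier_mat n n" and J: "J \<in> carrier_mat n n" "J * J = 1\<^sub>m n"
    and inv: "M * (J * M' * J) = - 1\<^sub>m n" and ev: "eigenvalue M l"
  shows "l \<noteq> 0" "eigenvalue M' (- inverse l)"
proof -
  define L where "L = J * M' * J"
  have L: "L \<in> carrier_mat n n"
    using J M' by (auto simp: L_def intro!: mult_carrier_mat[of _ n n _ n])
  have "M * (- L) = 1\<^sub>m n"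
    using M L inv[folded L_def] by simp
  then have "(- L) * M = 1\<^sub>m n"
    using mat_mult_left_right_inverse[OF M, of "- L"] L by simp
  then have L_M: "L * M = - 1\<^sub>m n"
    using M L by (metis carrier_matD uminus_mult_left_mat uminus_uminus_mat)
  obtain x where x: "x \<in> carrier_vec n" "x \<noteq> 0\<^sub>v n" "M *\<^sub>v x = l \<cdot>\<^sub>v x"
    using ev M by (auto simp: eigenvalue_def eigenvector_def)
  have Lx: "L *\<^sub>v x = J *\<^sub>v (M' *\<^sub>v (J *\<^sub>v x))"
    unfolding L_def using J M' x by (simp add: assoc_mult_mat_vec[of _ n n _ n] mult_carrier_mat[of _ n n _ n])
  have "L *\<^sub>v (M *\<^sub>v x) = - x"
    using M L x(1) by (simp add: L_M flip: assoc_mult_mat_vec[of _ n n _ n])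
  then have eq: "l \<cdot>\<^sub>v (L *\<^sub>v x) = - x"
    using L x by (simp add: mult_mat_vec[of _ n n])
  show l: "l \<noteq> 0"
  proof
    assume "l = 0"
    then have "- x = 0\<^sub>v n"
      using eq L x(1) by (auto simp: vec_eq_iff)
    then show False
      using x by (auto simp: vec_eq_iff)
  qed
  have "L *\<^sub>v x = (- inverse l) \<cdot>\<^sub>v x"
    using eq l L x(1) by (auto simp: vec_eq_iff field_simps)
  then have "J *\<^sub>v (L *\<^sub>v x) = (- inverse l) \<cdot>\<^sub>v (J *\<^sub>v x)"
    using J x by (simp add: mult_mat_vec[of _ n n])
  moreover have JJ: "J *\<^sub>v (J *\<^sub>v y) = y" if "y \<in> carrier_vec n" for y
    using J that by (simp flip: assoc_mult_mat_vec[of _ n n _ n])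
  ultimately have "M' *\<^sub>v (J *\<^sub>v x) = (- inverse l) \<cdot>\<^sub>v (J *\<^sub>v x)"
    unfolding Lx using M' J x by (simp add: mult_mat_vec_carrier[of _ n n])
  moreover have "J *\<^sub>v x \<noteq> 0\<^sub>v n"
    using JJ[OF x(1)] x(2) J by (metis mult_mat_zero_vec)
  ultimately show "eigenvalue M' (- inverse l)"
    using M' J x by (auto simp: eigenvalue_def eigenvector_def intro!: exI[of _ "J *\<^sub>v x"])
qed

text \<open>By the identity theorem, equality at points accumulating at 0 makes \<open>f\<close> the
  Taylor series of \<open>g\<close> at 0, and this converges on every disc about 0 on which
  \<open>g\<close> is holomorphic. So a series of unknown radius inherits the radius
  \<open>r\<close>. Only \<open>frequently\<close> is asked for, as a choice among finitely many
  branches leaves no more.\<close>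

lemma fps_identity_real_axis:
  fixes f :: "complex fps"
  assumes f: "0 < fps_conv_radius f" and g: "g holomorphic_on ball 0 r" and r: "0 < r"
    and freq: "\<exists>\<^sub>F x in at_right (0::real). eval_fps f (of_real x) = g (of_real x)"
  shows "ereal r \<le> fps_conv_radius f" "\<And>z. z \<in> ball 0 r \<Longrightarrow> eval_fps f z = g z"
proof -
  obtain s where s: "0 < s" "ereal s < fps_conv_radius f"
    using ereal_dense2[OF f] by auto
  \<comment> \<open>On this smaller ball both sides are holomorphic; \<open>r\<close> may exceed the
    radius of convergence known so far.\<close>
  define t where "t = min r s"
  have t: "0 < t" "t \<le> r" "t \<le> s"
    using r s by (auto simp: t_def)
  define h where "h = (\<lambda>z. eval_fps f z - g z)"
  have sub: "ball (0::complex) t \<subseteq> eball 0 (fps_conv_radius f)"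
  proof
    fix z :: complex assume "z \<in> ball 0 t"
    then have "ereal (norm z) < ereal s"
      using t by simp
    then show "z \<in> eball 0 (fps_conv_radius f)"
      using less_trans[OF _ s(2)] by simp
  qed
  have h: "h holomorphic_on ball 0 t"
    unfolding h_def using t by (intro holomorphic_intros sub holomorphic_on_subset[OF g]) auto
  define Y where "Y = {z \<in> ball 0 t. z \<noteq> 0 \<and> h z = 0}"
  have lim: "0 islimpt Y"
    unfolding islimpt_approachable
  proof (intro allI impI)
    fix e :: real assume e: "0 < e"
    have "\<forall>\<^sub>F x in at_right (0::real). x \<in> {0<..<min e t}"
      using e t by (intro eventually_at_right_real) auto
    from frequently_ex[OF frequently_eventually_conj[OF freq this]]
    obtain x where x: "eval_fps f (of_real x) = g (of_real x)" "0 < x" "x < e" "x < t"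
      by auto
    then show "\<exists>y\<in>Y. y \<noteq> 0 \<and> dist y 0 < e"
      by (intro bexI[of _ "of_real x"]) (auto simp: Y_def h_def)
  qed
  have h0: "h z = 0" if "z \<in> ball 0 t" for z
    by (rule analytic_continuation[OF h open_ball _ _ _ lim _ that]) (use t in \<open>auto simp: Y_def\<close>)
  have "g has_fps_expansion f"
    unfolding has_fps_expansion_def
  proof
    have "\<forall>\<^sub>F z in nhds 0. z \<in> ball (0::complex) t"
      using t by (intro eventually_nhds_in_open) auto
    then show "\<forall>\<^sub>F z in nhds 0. eval_fps f z = g z"
      by eventually_elim (use h0 in \<open>simp add: h_def\<close>)
  qed (rule f)
  moreover have "g has_fps_expansion fps_expansion g 0"
    using g r by (intro has_fps_expansion_fps_expansion[of "ball 0 r"]) auto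
  ultimately have fg: "f = fps_expansion g 0"
    by (rule fps_expansion_unique_complex)
  show "ereal r \<le> fps_conv_radius f"
    unfolding fg using g by (intro conv_radius_fps_expansion) simp
  show "eval_fps f z = g z" if "z \<in> ball 0 r" for z
    unfolding fg using eval_fps_expansion[of g 0 "ereal r" z] g that by simp
qed

section \<open>High-loss and low-loss eigenvalues\<close>

context loss_system
begin

text \<open>If \<open>\<omega>\<close> were 0, then \<open>K\<close>, and with it
  \<open>A 0\<close>, would vanish on all vectors, although duality at \<open>\<beta> = 0\<close>
  makes \<open>A 0\<close> invertible. With \<open>\<omega> = 0\<close> the inverse of
  \<open>beta0\<close> would be 0 by convention, and the disc would be empty.\<close>

lemma omega_pos:
  assumes dual: "loss_system N \<eta> \<alpha> \<theta> R"
  shows "0 < \<omega>"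
proof (rule ccontr)
  assume "\<not> 0 < \<omega>"
  moreover have "0 \<le> \<omega>"
    using hermitian_norm_bound(2)[OF Omega_carrier Omega_hermitian cnj_Omega, of "0\<^sub>v (2 * N)"] N
    by (simp add: omega_max_def)
  ultimately have zero: "\<omega> = 0"
    by simp
  have K0: "cplx_mat K *\<^sub>v x = 0\<^sub>v (2 * N)" if "x \<in> carrier_vec (2 * N)" for x
  proof (rule ccontr)
    assume "cplx_mat K *\<^sub>v x \<noteq> 0\<^sub>v (2 * N)"
    then have "0 < cnorm2 (cplx_mat K *\<^sub>v x)"
      using K_carrier that by (intro cnorm2_pos[of _ "2 * N"]) (auto intro!: mult_mat_vec_carrier)
    then show False
      using K_bound[OF that] by (simp add: zero)
  qed
  define L where "L = J * A_mat \<eta> \<alpha> \<theta> R 0 * J"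
  have L: "L \<in> carrier_mat (2 * N) (2 * N)"
    using J_carrier loss_system.A_carrier[OF dual] by (auto simp: L_def intro!: mult_carrier_mat[of _ "2 * N" "2 * N"])
  define y where "y = L *\<^sub>v unit_vec (2 * N) 0"
  have y: "y \<in> carrier_vec (2 * N)"
    using L by (simp add: y_def)
  have A0: "A 0 = (- \<i>) \<cdot>\<^sub>m cplx_mat K"
    using K_carrier B_carrier by (intro eq_matI) (auto simp: A_mat_def Omega_eq)
  have "A 0 *\<^sub>v y = 0\<^sub>v (2 * N)"
    unfolding A0 using K_carrier y by (simp add: smult_mat_mult_vec[of _ "2 * N" "2 * N"] K0) (auto simp: vec_eq_iff)
  moreover have "A 0 *\<^sub>v y = (A 0 * L) *\<^sub>v unit_vec (2 * N) 0"
    using A_carrier L by (simp add: y_def assoc_mult_mat_vec[of _ "2 * N" "2 * N" _ "2 * N"])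
  moreover have "\<dots> = - unit_vec (2 * N) 0"
    using A_dual[OF dual, of 0] by (simp add: L_def)
  ultimately have "vec_index (- unit_vec (2 * N) 0 :: complex vec) 0 = 0"
    using N by simp
  then show False
    using N by simp
qed

text \<open>\<open>ev\<close> is the pencil eigenvalue near \<open>b_k\<close>, regular at
  \<open>z = 0\<close>; the matching eigenvalue of \<open>A (inverse z)\<close> is
  \<open>- \<i> / z * ev z\<close>, hence the punctured disc in those clauses. The isolation clause
  serves to recognize a given eigenvalue as this one, \<open>ev z \<noteq> 0\<close> permits the
  reciprocal in the dual system, and the last clause makes \<open>ev\<close> real on the real
  axis.\<close>

definition high_loss_branch :: "nat \<Rightarrow> (complex \<Rightarrow> complex) \<Rightarrow> (complex \<Rightarrow> complex mat) \<Rightarrow> bool" where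
  "high_loss_branch k ev P \<longleftrightarrow>
     (let r = inverse (beta0 \<alpha> \<eta> \<theta> R) in
      ev holomorphic_on ball 0 r \<and>
      (\<forall>z. P z \<in> carrier_mat (2 * N) (2 * N)) \<and>
      (\<forall>i<2 * N. \<forall>l<2 * N. (\<lambda>z. P z $$ (i, l)) holomorphic_on ball 0 r) \<and>
      (\<forall>z\<in>ball 0 r. ev z \<noteq> 0) \<and>
      (\<forall>z\<in>ball 0 r - {0}.
         simple_eigenprojection (2 * N) (A (inverse z)) (- \<i> / z * ev z) (P z) \<and>
         poly (char_poly (A (inverse z))) (- \<i> / z * ev z) = 0 \<and>
         poly (pderiv (char_poly (A (inverse z)))) (- \<i> / z * ev z) \<noteq> 0 \<and>
         (\<forall>l. eigenvalue (A (inverse z)) l \<longrightarrow> cmod (\<i> * z * l - of_real (b_val \<alpha> R k)) < b_gap \<alpha> R / 2 \<longrightarrow>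
            \<i> * z * l = ev z)) \<and>
      (\<forall>x. of_real x \<in> ball (0::complex) r \<longrightarrow> cnj (ev (of_real x)) = ev (of_real x)))"

text \<open>The last claim is the Bauer--Fike bound read in terms of \<open>A\<close>: a pencil
  eigenvalue near \<open>b_0 = 0\<close> belongs to an eigenvalue of modulus at most
  \<open>\<omega>\<close>, and every larger one sits in the disc of some \<open>b_k\<close>. Duality
  uses this to locate eigenvalues that tend to infinity.\<close>

lemma high_loss:
  assumes dual: "loss_system N \<eta> \<alpha> \<theta> R"
  shows "0 < inverse (beta0 \<alpha> \<eta> \<theta> R)"
    and "0 < b_gap \<alpha> R"
    and "\<And>k. 1 \<le> k \<Longrightarrow> k \<le> loss_rank R \<Longrightarrow> \<exists>ev P. high_loss_branch k ev P"
    and "\<And>z l. z \<in> ball 0 (inverse (beta0 \<alpha> \<eta> \<theta> R)) - {0} \<Longrightarrow> eigenvalue (A (inverse z)) l \<Longrightarrow>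
      cmod l \<le> \<omega> \<or>
      (\<exists>k\<in>{1..loss_rank R}. cmod (\<i> * z * l - of_real (b_val \<alpha> R k)) < b_gap \<alpha> R / 2)"
proof -
  obtain U d where U: "U \<in> carrier_mat (2 * N) (2 * N)" "transpose_mat U * U = 1\<^sub>m (2 * N)"
    "U * transpose_mat U = 1\<^sub>m (2 * N)" "B_mat \<alpha> R = U * mat_diag (2 * N) d * transpose_mat U"
    and d: "\<And>i. i < 2 * N \<Longrightarrow> \<exists>k\<le>loss_rank R. d i = b_val \<alpha> R k"
    and nz: "\<And>k. 1 \<le> k \<Longrightarrow> k \<le> loss_rank R \<Longrightarrow> b_val \<alpha> R k \<noteq> 0"
    and ex1: "\<And>k. 1 \<le> k \<Longrightarrow> k \<le> loss_rank R \<Longrightarrow> \<exists>!i. i < 2 * N \<and> d i = b_val \<alpha> R k"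
    by (rule B_mat_spectrum[OF \<alpha> R(1,2) inj_b]) (rule that; assumption)
  define \<gamma> where "\<gamma> = b_gap \<alpha> R"
  have gap: "0 < \<gamma>" "\<And>i j. i \<le> loss_rank R \<Longrightarrow> j \<le> loss_rank R \<Longrightarrow> i \<noteq> j \<Longrightarrow> \<gamma> \<le> \<bar>b_val \<alpha> R i - b_val \<alpha> R j\<bar>"
    unfolding \<gamma>_def by (rule b_gap_props[OF R(3) inj_b nz]; assumption)+
  show gap_pos: "0 < b_gap \<alpha> R"
    using gap(1) by (simp add: \<gamma>_def)
  have \<omega>: "0 < \<omega>"
    using omega_pos[OF dual] .
  have r: "inverse (beta0 \<alpha> \<eta> \<theta> R) = \<gamma> / (2 * \<omega>)"
    by (simp add: beta0_def \<gamma>_def)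
  show "0 < inverse (beta0 \<alpha> \<eta> \<theta> R)"
    unfolding r using \<omega> gap(1) by simp
  interpret lp: linear_pencil "2 * N" "B_mat \<alpha> R" K U d \<omega>
    using K_carrier U \<omega> K_bound by unfold_locales auto
  have A: "A (inverse z) = (- \<i> / z) \<cdot>\<^sub>m lp.T z" if "z \<noteq> 0" for z
    using that K_carrier B_carrier
    by (intro eq_matI) (auto simp: A_mat_def lp.T_def Omega_eq field_simps)
  have root: "poly (char_poly (lp.T z)) (\<i> * z * l) = 0" if z: "z \<noteq> 0" and l: "eigenvalue (A (inverse z)) l" for z l
  proof -
    obtain x where x: "x \<in> carrier_vec (2 * N)" "x \<noteq> 0\<^sub>v (2 * N)" "A (inverse z) *\<^sub>v x = l \<cdot>\<^sub>v x"
      using l A_carrier[of "inverse z"] by (auto simp: eigenvalue_def eigenvector_def)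
    have "lp.T z *\<^sub>v x = (\<i> * z) \<cdot>\<^sub>v (A (inverse z) *\<^sub>v x)"
      unfolding A[OF z] using lp.T_carrier[of z] x(1) z
      by (simp add: smult_mat_mult_vec[of _ "2 * N" "2 * N"] smult_smult_assoc)
    then have "lp.T z *\<^sub>v x = (\<i> * z * l) \<cdot>\<^sub>v x"
      by (simp add: x(3) smult_smult_assoc)
    then have "eigenvalue (lp.T z) (\<i> * z * l)"
      using x lp.T_carrier[of z] by (auto simp: eigenvalue_def eigenvector_def)
    then show ?thesis
      using eigenvalue_root_char_poly[OF lp.T_carrier] by simp
  qed
  show "\<exists>ev P. high_loss_branch k ev P" if k: "1 \<le> k" "k \<le> loss_rank R" for k
  proof -
    define b where "b = b_val \<alpha> R k"
    have sep: "\<gamma> \<le> \<bar>d i - b\<bar>" if "i < 2 * N" "d i \<noteq> b" for i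
    proof -
      obtain k' where "k' \<le> loss_rank R" "d i = b_val \<alpha> R k'"
        using d[OF \<open>i < 2 * N\<close>] by auto
      then show ?thesis
        using gap(2)[of k' k] k that(2) by (auto simp: b_def)
    qed
    obtain ev where ev: "ev holomorphic_on ball 0 (inverse (beta0 \<alpha> \<eta> \<theta> R))"
      "\<And>z. z \<in> ball 0 (inverse (beta0 \<alpha> \<eta> \<theta> R)) \<Longrightarrow> poly (char_poly (lp.T z)) (ev z) = 0"
      "\<And>z. z \<in> ball 0 (inverse (beta0 \<alpha> \<eta> \<theta> R)) \<Longrightarrow> cmod (ev z - of_real b) < \<gamma> / 2"
      "\<And>z. z \<in> ball 0 (inverse (beta0 \<alpha> \<eta> \<theta> R)) \<Longrightarrow> poly (pderiv (char_poly (lp.T z))) (ev z) \<noteq> 0"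
      "\<And>z w. z \<in> ball 0 (inverse (beta0 \<alpha> \<eta> \<theta> R)) \<Longrightarrow> poly (char_poly (lp.T z)) w = 0 \<Longrightarrow>
         cmod (w - of_real b) < \<gamma> / 2 \<Longrightarrow> w = ev z"
      by (rule lp.simple_branch[OF ex1[OF k, folded b_def] gap(1) sep, folded r]; (assumption | (rule that; assumption)))
    obtain P where P: "\<And>z. P z \<in> carrier_mat (2 * N) (2 * N)"
      "\<And>i l. i < 2 * N \<Longrightarrow> l < 2 * N \<Longrightarrow> (\<lambda>z. P z $$ (i, l)) holomorphic_on ball 0 (inverse (beta0 \<alpha> \<eta> \<theta> R))"
      "\<And>z. z \<in> ball 0 (inverse (beta0 \<alpha> \<eta> \<theta> R)) \<Longrightarrow> simple_eigenprojection (2 * N) (lp.T z) (ev z) (P z)"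
      by (rule lp.analytic_eigenprojection[OF ev(1,2,4)]; (assumption | (rule that; assumption)))
    have "ev z \<noteq> 0" if "z \<in> ball 0 (inverse (beta0 \<alpha> \<eta> \<theta> R))" for z
    proof
      assume "ev z = 0"
      then have "\<bar>b\<bar> < \<gamma> / 2"
        using ev(3)[OF that] by simp
      \<comment> \<open>The gap also bounds the distance from \<open>b_0 = 0\<close>, so the disc
        about \<open>b\<close> avoids the origin.\<close>
      moreover have "\<gamma> \<le> \<bar>b\<bar>"
        using gap(2)[of k 0] k by (simp add: b_def) (simp add: b_val_def)
      ultimately show False
        using gap(1) by simp
    qed
    moreover have "cnj (ev (of_real x)) = ev (of_real x)"
      if "of_real x \<in> ball (0::complex) (inverse (beta0 \<alpha> \<eta> \<theta> R))" for x
    proof (rule ev(5)[OF that])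
      show "poly (char_poly (lp.T (of_real x))) (cnj (ev (of_real x))) = 0"
        by (rule lp.real_root_cnj[OF ev(2)[OF that]])
      have "cnj (ev (of_real x)) - of_real b = cnj (ev (of_real x) - of_real b)"
        by simp
      then show "cmod (cnj (ev (of_real x)) - of_real b) < \<gamma> / 2"
        using ev(3)[OF that] by (simp only: complex_mod_cnj)
    qed
    moreover have "simple_eigenprojection (2 * N) (A (inverse z)) (- \<i> / z * ev z) (P z)"
      "poly (char_poly (A (inverse z))) (- \<i> / z * ev z) = 0"
      "poly (pderiv (char_poly (A (inverse z)))) (- \<i> / z * ev z) \<noteq> 0"
      if "z \<in> ball 0 (inverse (beta0 \<alpha> \<eta> \<theta> R))" "z \<noteq> 0" for z
      unfolding A[OF that(2)]
      using simple_eigenprojection_smult[OF P(3)[OF that(1)], of "- \<i> / z"] that(2)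
        simple_root_smult[OF lp.T_carrier _ ev(2,4)[OF that(1)], of "- \<i> / z"]
      by simp_all
    moreover have "\<i> * z * l = ev z"
      if "z \<in> ball 0 (inverse (beta0 \<alpha> \<eta> \<theta> R))" "z \<noteq> 0" "eigenvalue (A (inverse z)) l"
        "cmod (\<i> * z * l - of_real b) < \<gamma> / 2" for z l
      using ev(5)[OF that(1) root[OF that(2,3)] that(4)] .
    ultimately have "high_loss_branch k ev P"
      unfolding high_loss_branch_def Let_def b_def \<gamma>_def using ev(1) P(1,2) by blast
    then show ?thesis
      by blast
  qed
  show "cmod l \<le> \<omega> \<or> (\<exists>k\<in>{1..loss_rank R}. cmod (\<i> * z * l - of_real (b_val \<alpha> R k)) < b_gap \<alpha> R / 2)"
    if z: "z \<in> ball 0 (inverse (beta0 \<alpha> \<eta> \<theta> R)) - {0}" and l: "eigenvalue (A (inverse z)) l" for z l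
  proof -
    have z0: "z \<noteq> 0"
      using z by auto
    obtain i where i: "i < 2 * N" and le: "cmod (of_real (d i) - \<i> * z * l) \<le> cmod z * \<omega>"
      using lp.bauer_fike[OF root[OF z0 l]] by auto
    obtain k where k: "k \<le> loss_rank R" "d i = b_val \<alpha> R k"
      using d[OF i] by auto
    have "cmod z * \<omega> < \<gamma> / 2"
    proof -
      have "cmod z < \<gamma> / (2 * \<omega>)"
        using z unfolding r by simp
      then show ?thesis
        using \<omega> by (simp add: field_simps)
    qed
    show ?thesis
    proof (cases "k = 0")
      case True
      then have "cmod z * cmod l \<le> cmod z * \<omega>"
        using le k(2) by (simp add: b_val_def norm_mult)
      then show ?thesis
        using z0 by simp
    next
      case False
      then have "cmod (\<i> * z * l - of_real (b_val \<alpha> R k)) < b_gap \<alpha> R / 2"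
        using le k(2) \<open>cmod z * \<omega> < \<gamma> / 2\<close> by (simp add: \<gamma>_def norm_minus_commute)
      then show ?thesis
        using False k(1) by (intro disjI2 bexI[of _ k]) auto
    qed
  qed
qed

section \<open>Matching the given series with the isolated eigenvalues\<close>

lemma eventually_eigenvalue_at_right_0:
  assumes "\<forall>\<^sub>F \<beta>::real in at_top. eigenvalue (A (of_real \<beta>)) (branch Z (of_real \<beta>))"
  shows "\<forall>\<^sub>F x in at_right (0::real). eigenvalue (A (inverse (of_real x))) (eval_fls Z (of_real x))"
proof -
  have "\<forall>\<^sub>F x in at_right (0::real). eigenvalue (A (of_real (inverse x))) (branch Z (of_real (inverse x)))"
    using filterlim_inverse_at_top_right assms by (rule eventually_compose_filterlim[rotated])
  then show ?thesis
    by (simp add: branch_def)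
qed

lemma eventually_ball_at_right_0:
  assumes "0 < r"
  shows "\<forall>\<^sub>F x in at_right (0::real). 0 < x \<and> complex_of_real x \<in> ball 0 r - {0}"
proof -
  have "\<forall>\<^sub>F x in at_right (0::real). x \<in> {0<..<r}"
    using assms by (rule eventually_at_right_real)
  then show ?thesis
    by eventually_elim auto
qed

lemma eval_fps_tendsto_at_right_0:
  assumes "0 < fps_conv_radius (f :: complex fps)"
  shows "((\<lambda>x. eval_fps f (of_real x)) \<longlongrightarrow> fps_nth f 0) (at_right (0::real))"
proof -
  have "isCont (eval_fps f) 0"
    using assms by (intro continuous_eval_fps) (simp add: zero_ereal_def)
  then have "(eval_fps f \<longlongrightarrow> eval_fps f 0) (nhds 0)"
    by (simp add: continuous_within tendsto_at_iff_tendsto_nhds)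
  moreover have "filterlim (\<lambda>x. complex_of_real x) (nhds 0) (at_right (0::real))"
    using tendsto_of_real[OF tendsto_ident_at[of 0 "{0<..}"], where 'a = complex] by simp
  ultimately show ?thesis
    using filterlim_compose by (fastforce simp: eval_fps_at_0)
qed

text \<open>The simple pole makes \<open>z\<close> times the series a power series \<open>f\<close>
  with constant term \<open>- \<i> b_k\<close>. Thus \<open>\<i> f(x)\<close> is a pencil eigenvalue
  tending to \<open>b_k\<close>; it is eventually inside the isolation disc, where it can only be
  \<open>ev x\<close>.\<close>

lemma high_loss_branch_eval:
  assumes dual: "loss_system N \<eta> \<alpha> \<theta> R"
    and Z: "0 < fls_conv_radius Z" "fls_subdegree Z = - 1" "fls_nth Z (- 1) = - \<i> * of_real (b_val \<alpha> R k)"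
    and ev: "\<forall>\<^sub>F \<beta>::real in at_top. eigenvalue (A (of_real \<beta>)) (branch Z (of_real \<beta>))"
    and k: "high_loss_branch k ev P"
  shows "ereal (inverse (beta0 \<alpha> \<eta> \<theta> R)) \<le> fls_conv_radius Z"
    and "\<And>z. z \<in> ball 0 (inverse (beta0 \<alpha> \<eta> \<theta> R)) - {0} \<Longrightarrow> eval_fls Z z = - \<i> / z * ev z"
proof -
  define r where "r = inverse (beta0 \<alpha> \<eta> \<theta> R)"
  define f where "f = fls_base_factor_to_fps Z"
  define b where "b = b_val \<alpha> R k"
  have r: "0 < r"
    using high_loss(1)[OF dual] by (simp add: r_def)
  have hol: "ev holomorphic_on ball 0 r"
    and iso: "\<And>z l. z \<in> ball 0 r - {0} \<Longrightarrow> eigenvalue (A (inverse z)) l \<Longrightarrow>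
      cmod (\<i> * z * l - of_real b) < b_gap \<alpha> R / 2 \<Longrightarrow> \<i> * z * l = ev z"
    using k by (auto simp: high_loss_branch_def Let_def r_def b_def)
  have f: "0 < fps_conv_radius f" "fps_nth f 0 = - \<i> * of_real b"
    using Z by (simp_all add: f_def b_def fls_conv_radius_altdef)
  have eval: "eval_fls Z z = eval_fps f z / z" for z
    by (simp add: eval_fls_def f_def Z(2) power_int_minus divide_inverse)
  have "((\<lambda>x. \<i> * eval_fps f (of_real x)) \<longlongrightarrow> \<i> * (- \<i> * of_real b)) (at_right (0::real))"
    using tendsto_mult_left[OF eval_fps_tendsto_at_right_0[OF f(1)]] f(2) by metis
  then have "\<forall>\<^sub>F x in at_right (0::real). dist (\<i> * eval_fps f (of_real x)) (of_real b) < b_gap \<alpha> R / 2"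
    using high_loss(2)[OF dual] by (intro tendstoD) simp_all
  moreover note eventually_eigenvalue_at_right_0[OF ev] eventually_ball_at_right_0[OF r]
  ultimately have "\<forall>\<^sub>F x in at_right (0::real). eval_fps f (of_real x) = - \<i> * ev (of_real x)"
  proof eventually_elim
    case (elim x)
    have *: "\<i> * of_real x * eval_fls Z (of_real x) = \<i> * eval_fps f (of_real x)"
      using elim(3) by (simp add: eval)
    have "\<i> * of_real x * eval_fls Z (of_real x) = ev (of_real x)"
      using elim by (intro iso) (auto simp: * dist_norm)
    then have eq: "\<i> * eval_fps f (of_real x) = ev (of_real x)"
      unfolding * .
    have "eval_fps f (of_real x) = - \<i> * (\<i> * eval_fps f (of_real x))"
      by simp
    then show ?case
      unfolding eq .
  qed
  then have freq: "\<exists>\<^sub>F x in at_right (0::real). eval_fps f (of_real x) = - \<i> * ev (of_real x)"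
    by (intro eventually_frequently) auto
  have "(\<lambda>z. - \<i> * ev z) holomorphic_on ball 0 r"
    by (intro holomorphic_intros hol)
  note id = fps_identity_real_axis[OF f(1) this r freq]
  show "ereal (inverse (beta0 \<alpha> \<eta> \<theta> R)) \<le> fls_conv_radius Z"
    using id(1) by (simp add: r_def f_def fls_conv_radius_altdef)
  show "eval_fls Z z = - \<i> / z * ev z" if "z \<in> ball 0 (inverse (beta0 \<alpha> \<eta> \<theta> R)) - {0}" for z
    using id(2)[of z] that by (simp add: eval r_def)
qed

text \<open>The series tends to 0, so its negative reciprocal is a dual eigenvalue of unbounded
  modulus and must lie in one of the dual isolation discs. The limit 0 does not reveal which one, so
  the index \<open>k\<close> is only asserted to exist.\<close>

lemma low_loss_branch_eval:
  assumes dual: "loss_system N \<eta> \<alpha> \<theta> R"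
    and Z: "0 < fls_conv_radius Z" "0 \<le> fls_subdegree Z" "fls_nth Z 0 = 0"
    and ev: "\<forall>\<^sub>F \<beta>::real in at_top. eigenvalue (A (of_real \<beta>)) (branch Z (of_real \<beta>))"
  obtains k ev' P where "loss_system.high_loss_branch N \<eta> \<alpha> \<theta> R k ev' P" "1 \<le> k" "k \<le> loss_rank R"
    "ereal (inverse (beta0 \<eta> \<alpha> \<theta> R)) \<le> fls_conv_radius Z"
    "\<And>z. z \<in> ball 0 (inverse (beta0 \<eta> \<alpha> \<theta> R)) \<Longrightarrow> eval_fls Z z = - \<i> * z / ev' z"
proof -
  interpret dual: loss_system N \<eta> \<alpha> \<theta> R by (rule dual)
  have self: "loss_system N \<alpha> \<eta> \<theta> R" by unfold_locales
  define r where "r = inverse (beta0 \<eta> \<alpha> \<theta> R)"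
  note high = dual.high_loss[OF self, folded r_def]
  define f where "f = fls_regpart Z"
  have Zf: "Z = fps_to_fls f"
    using Z(2) by (simp add: f_def)
  have f: "0 < fps_conv_radius f" "fps_nth f 0 = 0"
    using Z by (simp_all add: f_def fls_conv_radius_def)
  obtain ev' P where k: "\<And>k. 1 \<le> k \<Longrightarrow> k \<le> loss_rank R \<Longrightarrow> dual.high_loss_branch k (ev' k) (P k)"
    using high(3) by metis
  have hol: "ev' k holomorphic_on ball 0 r" and ev'0: "\<And>z. z \<in> ball 0 r \<Longrightarrow> ev' k z \<noteq> 0"
    and iso: "\<And>z l. z \<in> ball 0 r - {0} \<Longrightarrow> eigenvalue (dual.A (inverse z)) l \<Longrightarrow>
      cmod (\<i> * z * l - of_real (b_val \<eta> R k)) < b_gap \<eta> R / 2 \<Longrightarrow> \<i> * z * l = ev' k z"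
    if "1 \<le> k" "k \<le> loss_rank R" for k
    using k[OF that] by (auto simp: dual.high_loss_branch_def Let_def r_def)
  \<comment> \<open>The bound \<open>s\<close> will keep \<open>x\<close> inside the disc of
    convergence, where evaluating \<open>Z\<close> agrees with evaluating \<open>f\<close>.\<close>
  obtain s where s: "0 < s" "ereal s < fps_conv_radius f"
    using ereal_dense2[OF f(1)] by auto
  have "((\<lambda>x. eval_fps f (of_real x)) \<longlongrightarrow> 0) (at_right (0::real))"
    using eval_fps_tendsto_at_right_0[OF f(1)] f(2) by simp
  \<comment> \<open>Below this threshold the reciprocal has modulus above
    \<open>dual.\<omega> + 1\<close>, which excludes the bounded alternative for the dual
    eigenvalue.\<close>
  then have "\<forall>\<^sub>F x in at_right (0::real). dist (eval_fps f (of_real x)) 0 < inverse (dual.\<omega> + 1)"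
    using dual.omega_pos[OF self] by (intro tendstoD) simp_all
  moreover note eventually_eigenvalue_at_right_0[OF ev] eventually_ball_at_right_0[OF high(1)] eventually_ball_at_right_0[OF s(1)]
  ultimately have "\<forall>\<^sub>F x in at_right (0::real). \<exists>k\<in>{1..loss_rank R}. eval_fps f (of_real x) = - \<i> * of_real x / ev' k (of_real x)"
  proof eventually_elim
    case (elim x)
    define l where "l = eval_fps f (of_real x)"
    have "ereal (norm (complex_of_real x)) < ereal s"
      using elim(4) by auto
    then have "ereal (norm (complex_of_real x)) < fps_conv_radius f"
      using s(2) by (rule less_trans)
    then have "eval_fls Z (of_real x) = l"
      unfolding Zf l_def by (rule eval_fps_to_fls)
    then have "eigenvalue (A (inverse (of_real x))) l"
      using elim(2) by simp
    from eigenvalue_neg_inverse[OF A_carrier dual.A_carrier J_carrier J_J A_dual[OF dual] this]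
    have l: "l \<noteq> 0" "eigenvalue (dual.A (inverse (of_real x))) (- inverse l)" .
    have "dual.\<omega> + 1 < inverse (cmod l)"
      using elim(1) l(1) dual.omega_pos[OF self] by (simp add: l_def dist_norm field_simps)
    then have "\<not> cmod (- inverse l) \<le> dual.\<omega>"
      by (simp add: norm_inverse)
    then obtain k where k: "k \<in> {1..loss_rank R}"
      "cmod (\<i> * of_real x * (- inverse l) - of_real (b_val \<eta> R k)) < b_gap \<eta> R / 2"
      using high(4)[OF _ l(2)] elim(3) by auto
    have "\<i> * of_real x * (- inverse l) = ev' k (of_real x)"
      using k elim(3) l(2) by (intro iso) auto
    then have "l = - \<i> * of_real x / ev' k (of_real x)"
      using l(1) elim(3) by (auto simp: field_simps)
    then show ?case
      using k(1) by (auto simp: l_def)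
  qed
  then have "\<exists>\<^sub>F x in at_right (0::real). \<exists>k\<in>{1..loss_rank R}. eval_fps f (of_real x) = - \<i> * of_real x / ev' k (of_real x)"
    by (intro eventually_frequently) auto
  \<comment> \<open>The index \<open>k\<close> depends on \<open>x\<close>, but one of them occurs for arbitrarily small \<open>x\<close>.\<close>
  then obtain k where kr: "1 \<le> k" "k \<le> loss_rank R"
    and freq: "\<exists>\<^sub>F x in at_right (0::real). eval_fps f (of_real x) = - \<i> * of_real x / ev' k (of_real x)"
    by (auto simp: frequently_bex_finite_distrib)
  have "(\<lambda>z. - \<i> * z / ev' k z) holomorphic_on ball 0 r"
    using ev'0[OF kr] by (intro holomorphic_intros hol[OF kr]) auto
  note id = fps_identity_real_axis[OF f(1) this high(1) freq]
  show thesis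
  proof (rule that[OF k[OF kr] kr])
    show "ereal (inverse (beta0 \<eta> \<alpha> \<theta> R)) \<le> fls_conv_radius Z"
      using id(1) by (simp add: Zf r_def)
    show "eval_fls Z z = - \<i> * z / ev' k z" if "z \<in> ball 0 (inverse (beta0 \<eta> \<alpha> \<theta> R))" for z
    proof -
      have "ereal (norm z) < ereal r"
        using that by (simp add: r_def)
      then have "ereal (norm z) < fps_conv_radius f"
        using id(1) by (rule less_le_trans)
      then have "eval_fls Z z = eval_fps f z"
        unfolding Zf by (rule eval_fps_to_fls)
      then show ?thesis
        using id(2)[of z] that by (simp add: r_def)
    qed
  qed
qed

end

section \<open>Both claims for the given eigenvalue series\<close>

lemma eigenvalue_if_similar_diag:
  assumes A: "(A :: complex mat) \<in> carrier_mat n n" "similar_mat A (mat_diag n f)" and i: "i < n"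
  shows "eigenvalue A (f i)"
proof -
  have "char_poly A = char_poly (1\<^sub>m n * mat_diag n f * 1\<^sub>m n)"
    using char_poly_similar[OF A(2)]
    by (simp add: left_mult_one_mat[OF mat_diag_dim] right_mult_one_mat[OF mat_diag_dim])
  also have "\<dots> = (\<Prod>i<n. [:- f i, 1:])"
    by (rule char_poly_diagonalization) auto
  finally show ?thesis
    using i by (auto simp: eigenvalue_root_char_poly[OF A(1)] poly_prod)
qed

lemma Re_imaginary_multiple_eq_0:
  assumes "cnj w = w"
  shows "Re (- \<i> / of_real x * w) = 0" "Re (- \<i> * of_real x / w) = 0"
proof -
  obtain y where w: "w = of_real y"
    using assms complex_is_Real_iff Reals_cnj_iff by (metis Reals_cases)
  show "Re (- \<i> / of_real x * w) = 0" "Re (- \<i> * of_real x / w) = 0"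
    unfolding w by (simp_all add: Re_divide)
qed

theorem corollary44:
  fixes N :: nat and \<alpha> \<eta> \<theta> R :: "real mat" and \<rho> :: "nat \<Rightarrow> real" and Z :: "nat \<Rightarrow> complex fls"
  assumes "N \<ge> 1"
    and "\<alpha> \<in> carrier_mat N N" "\<eta> \<in> carrier_mat N N" "\<theta> \<in> carrier_mat N N" "R \<in> carrier_mat N N"
    and "pos_def_mat \<alpha>" and "pos_def_mat \<eta>"
    and "transpose_mat \<theta> = - \<theta>"
    and "pos_semidef_mat R" and "loss_rank R > 0"
    and "inj_on (b_val \<alpha> R) {1..loss_rank R}"
    and "inj_on (b_val \<eta> R) {1..loss_rank R}"
    and "loss_branches \<alpha> \<eta> \<theta> R \<rho> Z"
    and "\<forall>j\<in>{loss_rank R + 1..2 * loss_rank R}. \<rho> j = 0"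
    and "\<forall>j\<in>{2 * loss_rank R + 1..2 * N}. \<rho> j \<noteq> 0"
  defines "A \<equiv> A_mat \<alpha> \<eta> \<theta> R" and "\<zeta> \<equiv> \<lambda>j. branch (Z j)"
    and "\<beta>\<^sub>0 \<equiv> beta0 \<alpha> \<eta> \<theta> R" and "\<beta>\<^sub>1 \<equiv> beta1 \<alpha> \<eta> \<theta> R"
  shows
    "(\<forall>j\<in>{1..loss_rank R}.
        (\<lambda>z. \<zeta> j (inverse z)) meromorphic_on {0} \<and>
        fls_conv_radius (Z j) \<ge> ereal (inverse \<beta>\<^sub>0) \<and>
        (\<forall>z. 0 < cmod z \<and> cmod z < inverse \<beta>\<^sub>0 \<longrightarrow> eigenvalue (A (inverse z)) (\<zeta> j (inverse z))) \<and>
        analytic_rank_one_eigenprojections (2 * N)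
          (\<lambda>z. A (inverse z)) (\<lambda>z. \<zeta> j (inverse z)) (inverse \<beta>\<^sub>0) \<and>
        (\<forall>\<beta>::real. \<beta> > \<beta>\<^sub>0 \<longrightarrow> Re (\<zeta> j (of_real \<beta>)) = 0))
     \<and>
     (\<forall>j\<in>{loss_rank R + 1..2 * loss_rank R}.
        (\<lambda>z. \<zeta> j (inverse z)) analytic_on {0} \<and>
        fls_conv_radius (Z j) \<ge> ereal (inverse \<beta>\<^sub>1) \<and>
        (\<forall>z. 0 < cmod z \<and> cmod z < inverse \<beta>\<^sub>1 \<longrightarrow> eigenvalue (A (inverse z)) (\<zeta> j (inverse z))) \<and>
        analytic_rank_one_eigenprojections (2 * N)
          (\<lambda>z. A (inverse z)) (\<lambda>z. \<zeta> j (inverse z)) (inverse \<beta>\<^sub>1) \<and>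
        (\<forall>\<beta>::real. \<beta> > \<beta>\<^sub>1 \<longrightarrow>
           Polynomial.order (\<zeta> j (of_real \<beta>)) (char_poly (A (of_real \<beta>))) = 1 \<and> Re (\<zeta> j (of_real \<beta>)) = 0))"
proof -
  define r where "r = loss_rank R"
  have self: "loss_system N \<alpha> \<eta> \<theta> R" and dual: "loss_system N \<eta> \<alpha> \<theta> R"
    using assms(1-12) by unfold_locales auto
  interpret primal: loss_system N \<alpha> \<eta> \<theta> R by (rule self)
  interpret dual: loss_system N \<eta> \<alpha> \<theta> R by (rule dual)
  \<comment> \<open>Indices up to \<open>2 * r\<close> must stay within the \<open>2 * N\<close>
    branches.\<close>
  have "r \<le> N"
    using vec_space.rank_le_nc[of R N N] assms(5) by (simp add: r_def loss_rank_def)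
  have conv: "\<And>j. j \<in> {1..2 * N} \<Longrightarrow> 0 < fls_conv_radius (Z j)"
    and sim: "\<forall>\<^sub>F \<beta>::real in at_top. similar_mat (A (of_real \<beta>))
           (mat_diag (2 * N) (\<lambda>i. branch (Z (i + 1)) (of_real \<beta>)))"
    and high: "\<And>j. j \<in> {1..r} \<Longrightarrow> fls_subdegree (Z j) = - 1 \<and> fls_nth (Z j) (- 1) = - \<i> * of_real (b_val \<alpha> R j)"
    and low: "\<And>j. j \<in> {r + 1..2 * N} \<Longrightarrow> fls_subdegree (Z j) \<ge> 0 \<and> fls_nth (Z j) 0 = of_real (\<rho> j)"
    using assms(2,13) by (auto simp: loss_branches_def Let_def r_def A_def)
  have ev: "\<forall>\<^sub>F \<beta>::real in at_top. eigenvalue (A_mat \<alpha> \<eta> \<theta> R (of_real \<beta>)) (branch (Z j) (of_real \<beta>))"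
    if "j \<in> {1..2 * N}" for j
    using sim
  proof eventually_elim
    case (elim \<beta>)
    \<comment> \<open>Branches are numbered from 1, diagonal positions from 0.\<close>
    have "j - 1 < 2 * N" "j - 1 + 1 = j"
      using that by auto
    then show ?case
      using eigenvalue_if_similar_diag[OF primal.A_carrier elim[unfolded A_def], of "j - 1"] by simp
  qed
  have \<zeta>: "\<zeta> j (inverse z) = eval_fls (Z j) z" for j z
    by (simp add: \<zeta>_def branch_def)
  have \<zeta>_real: "\<zeta> j (of_real \<beta>) = eval_fls (Z j) (of_real (inverse \<beta>))" for j and \<beta> :: real
    by (simp add: \<zeta>_def branch_def)
  have in_ball: "of_real (inverse \<beta>) \<in> ball (0::complex) (inverse b) - {0}" if "0 < inverse b" "b < \<beta>" for b \<beta> :: real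
  proof -
    have "norm (complex_of_real (inverse \<beta>)) = inverse \<beta>" "inverse \<beta> < inverse b"
      using that unfolding norm_of_real by (auto intro: less_imp_inverse_less)
    then show ?thesis
      using that by (simp del: of_real_inverse)
  qed
  note pos = primal.high_loss(1)[OF dual]
  note pos' = dual.high_loss(1)[OF self]
  have beta1: "inverse \<beta>\<^sub>1 \<le> inverse (beta0 \<eta> \<alpha> \<theta> R)" "0 < inverse \<beta>\<^sub>1"
  proof -
    have "\<beta>\<^sub>1 = max (beta0 \<alpha> \<eta> \<theta> R) (beta0 \<eta> \<alpha> \<theta> R)"
      by (simp add: \<beta>\<^sub>1_def beta1_def beta0_def)
    then show "inverse \<beta>\<^sub>1 \<le> inverse (beta0 \<eta> \<alpha> \<theta> R)" "0 < inverse \<beta>\<^sub>1"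
      using pos pos' by (auto simp: less_max_iff_disj intro!: le_imp_inverse_le)
  qed
  have a: "(\<lambda>z. \<zeta> j (inverse z)) meromorphic_on {0} \<and>
        fls_conv_radius (Z j) \<ge> ereal (inverse \<beta>\<^sub>0) \<and>
        (\<forall>z. 0 < cmod z \<and> cmod z < inverse \<beta>\<^sub>0 \<longrightarrow> eigenvalue (A (inverse z)) (\<zeta> j (inverse z))) \<and>
        analytic_rank_one_eigenprojections (2 * N)
          (\<lambda>z. A (inverse z)) (\<lambda>z. \<zeta> j (inverse z)) (inverse \<beta>\<^sub>0) \<and>
        (\<forall>\<beta>::real. \<beta> > \<beta>\<^sub>0 \<longrightarrow> Re (\<zeta> j (of_real \<beta>)) = 0)"
    if j: "j \<in> {1..r}" for j
  proof -
    have j': "j \<in> {1..2 * N}"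
      using j \<open>r \<le> N\<close> by auto
    obtain e P where eP: "primal.high_loss_branch j e P"
      using primal.high_loss(3)[OF dual, of j] j by (auto simp: r_def)
    note eval = primal.high_loss_branch_eval[OF dual conv[OF j'] _ _ ev[OF j'] eP, folded \<beta>\<^sub>0_def]
    have conv_ge: "ereal (inverse \<beta>\<^sub>0) \<le> fls_conv_radius (Z j)"
      and eval: "\<And>z. z \<in> ball 0 (inverse \<beta>\<^sub>0) - {0} \<Longrightarrow> eval_fls (Z j) z = - \<i> / z * e z"
      using eval high[OF j] by auto
    have P_hol: "\<And>i k. i < 2 * N \<Longrightarrow> k < 2 * N \<Longrightarrow> (\<lambda>z. P z $$ (i, k)) holomorphic_on ball 0 (inverse \<beta>\<^sub>0)"
      and simple: "\<And>z. z \<in> ball 0 (inverse \<beta>\<^sub>0) - {0} \<Longrightarrow> simple_eigenprojection (2 * N) (A (inverse z)) (- \<i> / z * e z) (P z)"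
      and real: "\<And>x. of_real x \<in> ball (0::complex) (inverse \<beta>\<^sub>0) \<Longrightarrow> cnj (e (of_real x)) = e (of_real x)"
      using eP by (auto simp: primal.high_loss_branch_def Let_def \<beta>\<^sub>0_def A_def)
    note proj = simple_eigenprojection_is_eigenprojection[OF simple]
    have "(\<lambda>z. \<zeta> j (inverse z)) meromorphic_on {0}"
      using conv[OF j'] by (auto simp: meromorphic_on_def has_laurent_expansion_def \<zeta>)
    moreover have "eigenvalue (A (inverse z)) (\<zeta> j (inverse z))" if "0 < cmod z" "cmod z < inverse \<beta>\<^sub>0" for z
      using proj(3)[of z] eval[of z] that by (auto simp: \<zeta>)
    moreover have "analytic_rank_one_eigenprojections (2 * N) (\<lambda>z. A (inverse z)) (\<lambda>z. \<zeta> j (inverse z)) (inverse \<beta>\<^sub>0)"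
      unfolding analytic_rank_one_eigenprojections_def \<zeta>
      using P_hol proj(1,2) eval by (intro exI[of _ P]) auto
    moreover have "Re (\<zeta> j (of_real \<beta>)) = 0" if "\<beta>\<^sub>0 < \<beta>" for \<beta> :: real
    proof -
      have x: "of_real (inverse \<beta>) \<in> ball (0::complex) (inverse \<beta>\<^sub>0) - {0}"
        using that pos by (intro in_ball) (auto simp: \<beta>\<^sub>0_def)
      show ?thesis
        unfolding \<zeta>_real eval[OF x] using x by (intro Re_imaginary_multiple_eq_0 real) auto
    qed
    ultimately show ?thesis
      using conv_ge by blast
  qed
  have b: "(\<lambda>z. \<zeta> j (inverse z)) analytic_on {0} \<and>
        fls_conv_radius (Z j) \<ge> ereal (inverse \<beta>\<^sub>1) \<and>
        (\<forall>z. 0 < cmod z \<and> cmod z < inverse \<beta>\<^sub>1 \<longrightarrow> eigenvalue (A (inverse z)) (\<zeta> j (inverse z))) \<and>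
        analytic_rank_one_eigenprojections (2 * N)
          (\<lambda>z. A (inverse z)) (\<lambda>z. \<zeta> j (inverse z)) (inverse \<beta>\<^sub>1) \<and>
        (\<forall>\<beta>::real. \<beta> > \<beta>\<^sub>1 \<longrightarrow>
           Polynomial.order (\<zeta> j (of_real \<beta>)) (char_poly (A (of_real \<beta>))) = 1 \<and> Re (\<zeta> j (of_real \<beta>)) = 0)"
    if j: "j \<in> {r + 1..2 * r}" for j
  proof -
    have j': "j \<in> {1..2 * N}" "j \<in> {r + 1..2 * N}"
      using j \<open>r \<le> N\<close> by auto
    have Zj: "0 \<le> fls_subdegree (Z j)" "fls_nth (Z j) 0 = 0"
      using low[OF j'(2)] assms(14) j by (auto simp: r_def)
    obtain k e P where eP: "dual.high_loss_branch k e P"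
      and conv_ge: "ereal (inverse (beta0 \<eta> \<alpha> \<theta> R)) \<le> fls_conv_radius (Z j)"
      and eval: "\<And>z. z \<in> ball 0 (inverse (beta0 \<eta> \<alpha> \<theta> R)) \<Longrightarrow> eval_fls (Z j) z = - \<i> * z / e z"
      by (rule primal.low_loss_branch_eval[OF dual conv[OF j'(1)] Zj ev[OF j'(1)]]) (rule that; assumption)
    \<comment> \<open>The work is done on the disc given by the dual system and then restricted to
      the disc of radius \<open>inverse \<beta>\<^sub>1\<close>.\<close>
    define s where "s = inverse (beta0 \<eta> \<alpha> \<theta> R)"
    have e_hol: "e holomorphic_on ball 0 s" and e0: "\<And>z. z \<in> ball 0 s \<Longrightarrow> e z \<noteq> 0"
      and P: "\<And>z. P z \<in> carrier_mat (2 * N) (2 * N)"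
      and P_hol: "\<And>i k. i < 2 * N \<Longrightarrow> k < 2 * N \<Longrightarrow> (\<lambda>z. P z $$ (i, k)) holomorphic_on ball 0 s"
      and simple: "\<And>z. z \<in> ball 0 s - {0} \<Longrightarrow> simple_eigenprojection (2 * N) (dual.A (inverse z)) (- \<i> / z * e z) (P z)"
      and root: "\<And>z. z \<in> ball 0 s - {0} \<Longrightarrow> poly (char_poly (dual.A (inverse z))) (- \<i> / z * e z) = 0"
        "\<And>z. z \<in> ball 0 s - {0} \<Longrightarrow> poly (pderiv (char_poly (dual.A (inverse z)))) (- \<i> / z * e z) \<noteq> 0"
      and real: "\<And>x. of_real x \<in> ball (0::complex) s \<Longrightarrow> cnj (e (of_real x)) = e (of_real x)"
      using eP by (auto simp: dual.high_loss_branch_def Let_def s_def)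
    have sub: "ball 0 (inverse \<beta>\<^sub>1) \<subseteq> ball (0::complex) s"
      using beta1 by (auto simp: s_def)
    \<comment> \<open>The negative reciprocal of the dual eigenvalue \<open>- \<i> / z * e z\<close>
      is \<open>- \<i> * z / e z\<close>: the pole at 0 becomes a zero.\<close>
    have neg_inv: "- inverse (- \<i> / z * e z) = eval_fls (Z j) z" "- \<i> / z * e z \<noteq> 0" if "z \<in> ball 0 s - {0}" for z
      using eval[of z] e0[of z] that by (auto simp: s_def field_simps)
    \<comment> \<open>Conjugation of the dual projection by the constant matrix \<open>J\<close>
      keeps the entries holomorphic, also at \<open>z = 0\<close>.\<close>
    define Q where "Q = (\<lambda>z. primal.J * P z * primal.J)"
    have simple': "simple_eigenprojection (2 * N) (A (inverse z)) (eval_fls (Z j) z) (Q z)" if "z \<in> ball 0 s - {0}" for z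
      using simple_eigenprojection_neg_inverse[OF simple[OF that] neg_inv(2)[OF that] primal.A_carrier
          primal.J_carrier primal.J_J primal.A_dual[OF dual]]
      unfolding neg_inv(1)[OF that] by (simp add: Q_def A_def)
    note proj = simple_eigenprojection_is_eigenprojection[OF simple']
    have Q_hol: "(\<lambda>z. Q z $$ (i, k)) holomorphic_on ball 0 s" if "i < 2 * N" "k < 2 * N" for i k
      unfolding Q_def using primal.J_carrier P P_hol that
      by (intro holomorphic_mat_mult[of _ "2 * N"]) (auto intro: mult_carrier_mat)
    have "(\<lambda>z. \<zeta> j (inverse z)) analytic_on {0}"
      unfolding analytic_at \<zeta>
    proof (intro exI conjI)
      show "0 \<in> ball (0::complex) s"
        using pos' by (simp add: s_def)
      have "(\<lambda>z. - \<i> * z / e z) holomorphic_on ball 0 s"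
        using e0 by (intro holomorphic_intros e_hol) auto
      then show "eval_fls (Z j) holomorphic_on ball 0 s"
        by (rule holomorphic_transform) (simp add: eval s_def)
    qed auto
    moreover have "ereal (inverse \<beta>\<^sub>1) \<le> fls_conv_radius (Z j)"
      using beta1(1) conv_ge by (meson ereal_less_eq(3) order_trans)
    moreover have "eigenvalue (A (inverse z)) (\<zeta> j (inverse z))" if "0 < cmod z" "cmod z < inverse \<beta>\<^sub>1" for z
      using proj(3)[of z] sub that by (auto simp: \<zeta>)
    moreover have "analytic_rank_one_eigenprojections (2 * N) (\<lambda>z. A (inverse z)) (\<lambda>z. \<zeta> j (inverse z)) (inverse \<beta>\<^sub>1)"
      unfolding analytic_rank_one_eigenprojections_def \<zeta>
      using holomorphic_on_subset[OF Q_hol sub] proj(1,2) sub by (intro exI[of _ Q]) blast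
    moreover have "Polynomial.order (\<zeta> j (of_real \<beta>)) (char_poly (A (of_real \<beta>))) = 1 \<and> Re (\<zeta> j (of_real \<beta>)) = 0"
      if "\<beta>\<^sub>1 < \<beta>" for \<beta> :: real
    proof
      define x where "x = complex_of_real (inverse \<beta>)"
      have x: "x \<in> ball 0 s - {0}"
        using in_ball[OF beta1(2) that] sub by (auto simp: x_def)
      have inv: "inverse x = of_real \<beta>"
        by (simp add: x_def)
      \<comment> \<open>Algebraic simplicity is carried over from the dual characteristic
        polynomial, not read off from the rank of the projection.\<close>
      from simple_root_neg_inverse[OF primal.A_carrier dual.A_carrier primal.J_carrier primal.J_J
          primal.A_dual[OF dual] neg_inv(2)[OF x] root(1,2)[OF x]]
      show "Polynomial.order (\<zeta> j (of_real \<beta>)) (char_poly (A (of_real \<beta>))) = 1"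
        unfolding neg_inv(1)[OF x] inv \<zeta>_real A_def x_def[symmetric]
        by (rule order_eq_1_if_simple_root)
      have "\<zeta> j (of_real \<beta>) = - \<i> * of_real (inverse \<beta>) / e (of_real (inverse \<beta>))"
        unfolding \<zeta>_real using x by (intro eval) (simp add: x_def s_def)
      then show "Re (\<zeta> j (of_real \<beta>)) = 0"
        using Re_imaginary_multiple_eq_0(2)[OF real, of "inverse \<beta>" "inverse \<beta>"] x by (simp add: x_def)
    qed
    ultimately show ?thesis
      by blast
  qed
  show ?thesis
    using a b by (simp add: r_def)
qed

end
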